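(* Let $C'\subset \mathbf{P}^2_{\mathbf{C}}$ be a reduced plane curve of degree $d$ with only nodes and ordinary cusps as singularities, and let $c$ be the number of irreducible components of $C'$. Let $\mathcal{N}$ be the set of nodes of $C'$, let $I'\subset S=\mathbf{C}[z_0,z_1,z_2]$ be the ideal of $\mathcal{N}$, and let $$0\to \bigoplus_i S(-b_i) \to \bigoplus_i S(-a_i) \to S \to S/I' \to 0$$ be a minimal graded free resolution. Then $b_i\leq d$ for all $i$ and $$\#\{i\mid b_i=d\}=c-1.$$
   Context: A node is a singularity analytically equivalent to $xy=0$, an ordinary cusp one analytically equivalent to $y^2=x^3$. $I'$ is the homogeneous ideal of all polynomials vanishing on $\mathcal{N}$; $S(-a)$ is the graded module $S$ with grading shifted so that its generator has degree $a$. *)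

theory Defs
  imports "HOL-Analysis.Analysis" "HOL-Library.Poly_Mapping"
    "HOL-Computational_Algebra.Squarefree"
begin

section \<open>The graded ring S\<close>

text \<open>
  The ring \<open>S = \<complex>[z\<^sub>0, z\<^sub>1, z\<^sub>2]\<close>. The variables are indexed by the numeral type \<open>3\<close>, whose
  elements are \<open>0, 1, 2\<close>; a monomial is its exponent vector, and the ring structure is the
  convolution product supplied by \<^theory>\<open>HOL-Library.Poly_Mapping\<close>.
\<close>

type_synonym S = "(3 \<Rightarrow>\<^sub>0 nat) \<Rightarrow>\<^sub>0 complex"

definition mdeg :: "(3 \<Rightarrow>\<^sub>0 nat) \<Rightarrow> nat" where
  "mdeg m = (\<Sum>i\<in>UNIV. Poly_Mapping.lookup m i)"

definition eval :: "S \<Rightarrow> complex^3 \<Rightarrow> complex" where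
  "eval F v = (\<Sum>m\<in>Poly_Mapping.keys F.
     Poly_Mapping.lookup F m * (\<Prod>i\<in>UNIV. (v $ i) ^ Poly_Mapping.lookup m i))"

text \<open>
  Degrees are integers because they arise as differences of shifts. The zero polynomial is
  homogeneous of every degree, and it is the only one of negative degree.
\<close>

definition homogeneous :: "int \<Rightarrow> S \<Rightarrow> bool" where
  "homogeneous k F \<longleftrightarrow> (\<forall>m\<in>Poly_Mapping.keys F. int (mdeg m) = k)"

text \<open>The ideal \<open>(z\<^sub>0, z\<^sub>1, z\<^sub>2)\<close>: the polynomials without constant term.\<close>

definition irrelevant_ideal :: "S set" where
  "irrelevant_ideal = {F. Poly_Mapping.lookup F 0 = 0}"

section \<open>The projective plane\<close>

definition proportional :: "complex^3 \<Rightarrow> complex^3 \<Rightarrow> bool" where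
  "proportional v w \<longleftrightarrow> v \<noteq> 0 \<and> w \<noteq> 0 \<and> (\<exists>c. c \<noteq> 0 \<and> w = c *s v)"

lemma part_equivp_proportional: "part_equivp proportional"
proof (rule part_equivpI)
  have "proportional (axis 0 1) (axis 0 1)"
    unfolding proportional_def
    by (auto simp: axis_eq_0_iff intro!: exI[of _ 1])
  then show "\<exists>v. proportional v v" by blast
  show "symp proportional"
  proof (rule sympI)
    fix v w assume "proportional v w"
    then obtain c where c: "v \<noteq> 0" "w \<noteq> 0" "c \<noteq> 0" "w = c *s v"
      unfolding proportional_def by blast
    then have "v = inverse c *s w" by (simp add: vector_smult_assoc)
    with c show "proportional w v"
      unfolding proportional_def by (metis inverse_nonzero_iff_nonzero)
  qed
  show "transp proportional"
  proof (rule transpI)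
    fix u v w assume "proportional u v" "proportional v w"
    then obtain c e where "u \<noteq> 0" "w \<noteq> 0" "c \<noteq> 0" "v = c *s u" "e \<noteq> 0" "w = e *s v"
      unfolding proportional_def by blast
    then show "proportional u w"
      unfolding proportional_def by (auto simp: vector_smult_assoc intro!: exI[of _ "e * c"])
  qed
qed

quotient_type P2 = "complex^3" / partial: proportional
  by (rule part_equivp_proportional)

text \<open>
  \<open>represents v p\<close>: the nonzero vector \<open>v\<close> is a tuple of homogeneous coordinates of \<open>p\<close>.
\<close>

definition represents :: "complex^3 \<Rightarrow> P2 \<Rightarrow> bool" where
  "represents v p \<longleftrightarrow> v \<noteq> 0 \<and> abs_P2 v = p"

text \<open>
  Asking for all homogeneous coordinates makes this meaningful for inhomogeneous \<open>F\<close> too: it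
  holds iff every homogeneous component of \<open>F\<close> vanishes at \<open>p\<close>.
\<close>

definition vanishes_at :: "S \<Rightarrow> P2 \<Rightarrow> bool" where
  "vanishes_at F p \<longleftrightarrow> (\<forall>v. represents v p \<longrightarrow> eval F v = 0)"

definition zero_locus :: "S set \<Rightarrow> P2 set" where
  "zero_locus T = {p. \<forall>F\<in>T. vanishes_at F p}"

definition vanishing_ideal :: "P2 set \<Rightarrow> S set" where
  "vanishing_ideal X = {F. \<forall>p\<in>X. vanishes_at F p}"

definition zariski_closed :: "P2 set \<Rightarrow> bool" where
  "zariski_closed Z \<longleftrightarrow> (\<exists>T. Z = zero_locus T)"

definition zariski_irreducible :: "P2 set \<Rightarrow> bool" where
  "zariski_irreducible Z \<longleftrightarrow> Z \<noteq> {} \<and>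
     (\<forall>A B. zariski_closed A \<longrightarrow> zariski_closed B \<longrightarrow> Z \<subseteq> A \<union> B \<longrightarrow> Z \<subseteq> A \<or> Z \<subseteq> B)"

definition irreducible_components :: "P2 set \<Rightarrow> P2 set set" where
  "irreducible_components X = {Z. Z \<subseteq> X \<and> zariski_irreducible Z \<and>
     (\<forall>Y. Y \<subseteq> X \<longrightarrow> zariski_irreducible Y \<longrightarrow> Z \<subseteq> Y \<longrightarrow> Y = Z)}"

section \<open>Plane curves and their singularities\<close>

definition reduced_plane_curve :: "S \<Rightarrow> nat \<Rightarrow> bool" where
  "reduced_plane_curve F d \<longleftrightarrow> 0 < d \<and> homogeneous (int d) F \<and> squarefree F"

definition curve_points :: "S \<Rightarrow> P2 set" where
  "curve_points F = zero_locus {F}"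

text \<open>The Jacobian criterion: all three partial derivatives of \<open>F\<close> vanish at \<open>p\<close>.\<close>

definition singular_at :: "S \<Rightarrow> P2 \<Rightarrow> bool" where
  "singular_at F p \<longleftrightarrow> p \<in> curve_points F \<and>
     (\<forall>v. represents v p \<longrightarrow> (eval F has_derivative (\<lambda>_. 0)) (at v))"

text \<open>
  Holomorphy in several variables on open sets: the Frechet derivative is complex linear.
\<close>

definition holomorphic_fun :: "(complex^'n \<Rightarrow> complex) \<Rightarrow> (complex^'n) set \<Rightarrow> bool" where
  "holomorphic_fun f U \<longleftrightarrow> open U \<and>
     (\<forall>z\<in>U. \<exists>a :: complex^'n. (f has_derivative (\<lambda>h. \<Sum>i\<in>UNIV. a $ i * h $ i)) (at z))"

definition holomorphic_map :: "(complex^'n \<Rightarrow> complex^'m) \<Rightarrow> (complex^'n) set \<Rightarrow> bool" where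
  "holomorphic_map f U \<longleftrightarrow> (\<forall>i. holomorphic_fun (\<lambda>z. f z $ i) U)"

definition biholomorphic ::
    "(complex^'n \<Rightarrow> complex^'n) \<Rightarrow> (complex^'n) set \<Rightarrow> (complex^'n) set \<Rightarrow> bool" where
  "biholomorphic \<phi> U V \<longleftrightarrow> bij_betw \<phi> U V \<and> holomorphic_map \<phi> U \<and>
     holomorphic_map (inv_into U \<phi>) V"

text \<open>
  The germ at \<open>w\<close> of the hypersurface \<open>f = 0\<close> is isomorphic to the germ at the origin of
  \<open>g = 0\<close>: a local biholomorphism carries one equation to the other up to a unit.
\<close>

definition analytically_equivalent ::
    "(complex^'n \<Rightarrow> complex) \<Rightarrow> complex^'n \<Rightarrow> (complex^'n \<Rightarrow> complex) \<Rightarrow> bool" where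
  "analytically_equivalent f w g \<longleftrightarrow> (\<exists>U V \<phi> u. w \<in> U \<and> biholomorphic \<phi> U V \<and> \<phi> w = 0 \<and>
     holomorphic_fun u U \<and> (\<forall>z\<in>U. u z \<noteq> 0) \<and> (\<forall>z\<in>U. f z = u z * g (\<phi> z)))"

text \<open>
  The affine chart on which the \<open>i\<close>-th homogeneous coordinate is \<open>1\<close>; index arithmetic in the
  type \<open>3\<close> is modulo 3, so \<open>i\<close>, \<open>i + 1\<close>, \<open>i + 2\<close> are the three indices.
\<close>

definition chart :: "3 \<Rightarrow> complex^2 \<Rightarrow> complex^3" where
  "chart i w = (\<chi> j. if j = i then 1 else if j = i + 1 then w $ 1 else w $ 2)"

definition has_singularity_type :: "S \<Rightarrow> P2 \<Rightarrow> (complex^2 \<Rightarrow> complex) \<Rightarrow> bool" where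
  "has_singularity_type F p g \<longleftrightarrow> (\<exists>i w. represents (chart i w) p \<and>
     analytically_equivalent (\<lambda>x. eval F (chart i x)) w g)"

definition node_at :: "S \<Rightarrow> P2 \<Rightarrow> bool" where
  "node_at F p \<longleftrightarrow> has_singularity_type F p (\<lambda>x. x $ 1 * x $ 2)"

definition cusp_at :: "S \<Rightarrow> P2 \<Rightarrow> bool" where
  "cusp_at F p \<longleftrightarrow> has_singularity_type F p (\<lambda>x. (x $ 2)\<^sup>2 - (x $ 1) ^ 3)"

definition nodes :: "S \<Rightarrow> P2 set" where
  "nodes F = {p. node_at F p}"

section \<open>Minimal graded free resolutions of length two\<close>

text \<open>
  The complex \<open>0 \<rightarrow> \<Oplus>\<^bsub>i<n\<^esub> S(-b\<^sub>i) \<rightarrow> \<Oplus>\<^bsub>j<m\<^esub> S(-a\<^sub>j) \<rightarrow> S \<rightarrow> S/I \<rightarrow> 0\<close>, whose last map is the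
  projection. The two other maps are given by their matrices: the generator of \<open>S(-a\<^sub>j)\<close> goes to
  \<open>g j\<close> and that of \<open>S(-b\<^sub>i)\<close> to \<open>(M i j)\<^sub>j\<close>. That the maps have degree \<open>0\<close> means that these entries
  are homogeneous of degrees \<open>a\<^sub>j\<close> and \<open>b\<^sub>i - a\<^sub>j\<close>. Values at indices outside the ranges are
  irrelevant.
\<close>

definition graded_free_resolution ::
    "S set \<Rightarrow> nat \<Rightarrow> (nat \<Rightarrow> int) \<Rightarrow> nat \<Rightarrow> (nat \<Rightarrow> int) \<Rightarrow>
     (nat \<Rightarrow> S) \<Rightarrow> (nat \<Rightarrow> nat \<Rightarrow> S) \<Rightarrow> bool" where
  "graded_free_resolution I m a n b g M \<longleftrightarrow>
     (\<forall>j<m. homogeneous (a j) (g j)) \<and>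
     (\<forall>i<n. \<forall>j<m. homogeneous (b i - a j) (M i j)) \<and>
     {\<Sum>j<m. h j * g j | h. True} = I \<and>
     (\<forall>h. (\<Sum>j<m. h j * g j) = 0 \<longleftrightarrow> (\<exists>k. \<forall>j<m. h j = (\<Sum>i<n. k i * M i j))) \<and>
     (\<forall>k. (\<forall>j<m. (\<Sum>i<n. k i * M i j) = 0) \<longrightarrow> (\<forall>i<n. k i = 0))"

text \<open>
  Minimality: the matrices have entries in the irrelevant ideal. For the degenerate ideal \<open>I = S\<close>
  no complex ending in \<open>S\<close> is minimal in this sense; the condition on \<open>g\<close> is then dropped, which
  leaves the minimal resolution of \<open>I\<close> as a module, namely \<open>m = 1\<close>, \<open>n = 0\<close>, \<open>a\<^sub>0 = 0\<close>.
\<close>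

definition minimal_graded_free_resolution ::
    "S set \<Rightarrow> nat \<Rightarrow> (nat \<Rightarrow> int) \<Rightarrow> nat \<Rightarrow> (nat \<Rightarrow> int) \<Rightarrow>
     (nat \<Rightarrow> S) \<Rightarrow> (nat \<Rightarrow> nat \<Rightarrow> S) \<Rightarrow> bool" where
  "minimal_graded_free_resolution I m a n b g M \<longleftrightarrow>
     graded_free_resolution I m a n b g M \<and>
     (I \<noteq> UNIV \<longrightarrow> (\<forall>j<m. g j \<in> irrelevant_ideal)) \<and>
     (\<forall>i<n. \<forall>j<m. M i j \<in> irrelevant_ideal)"

end

theory Submission
  imports Defs "HOL-Computational_Algebra.Polynomial_Factorial" "HOL-Computational_Algebra.Field_as_Ring"
    "HOL-Computational_Algebra.Fundamental_Theorem_Algebra" "HOL-Complex_Analysis.Conformal_Mappings"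
begin

text \<open>
  Let \<open>I\<close> be the ideal of the nodes. Multiplication by \<open>F \<in> I\<close> is null-homotopic on the resolution of
  \<open>S/I\<close>, which gives a matrix \<open>\<kappa>\<close> with \<open>M \<kappa>\<^sup>T = F\<close>. Its \<open>i\<close>-th row is an \<open>S\<close>-linear map
  \<open>\<rho>\<^sub>i : I \<rightarrow> S/F\<close> of degree \<open>d - b\<^sub>i\<close>. Every homogeneous \<open>\<rho> : I \<rightarrow> S/F\<close> has values in \<open>I/F\<close>, because the
  polars of \<open>F\<close> lie in \<open>I\<close> and the Hessian of \<open>F\<close> at a node has rank two. Hence \<open>\<rho>\<close> can be iterated:
  in negative degree it is nilpotent, so zero, and in degree zero it satisfies a polynomial with constant
  coefficients, so it is multiplication by a constant modulo each prime factor of \<open>F\<close>. By minimality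
  no \<open>\<rho>\<^sub>i\<close> vanishes, so \<open>b\<^sub>i \<le> d\<close>; moreover the \<open>\<rho>\<^sub>i\<close> with \<open>b\<^sub>i = d\<close> and the inclusion form a
  basis of the maps of degree zero. This space has dimension \<open>c\<close>, since for every prime factor \<open>P\<close> the
  idempotent of the component \<open>P = 0\<close> maps \<open>I\<close> to \<open>S/F\<close>: that is Noether's theorem for the
  curves \<open>P\<close> and \<open>F/P\<close>, which meet transversally because a cusp has only one branch.
\<close>

text \<open>A tuple \<open>t\<close> lifts a homomorphism \<open>g j \<mapsto> t j\<close> from
  \<open>I\<close> to \<open>S/F\<close> exactly when \<open>F\<close> divides all entries of
  \<open>M t\<close>, and then the vector \<open>M t / F\<close> measures it: it is \<open>0\<close>
  for the inclusion and the \<open>i\<close>-th unit vector for \<open>\<rho>\<^sub>i\<close>. This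
  explains the role of minimality: if \<open>F\<close> divided \<open>t\<close>, then
  \<open>M t / F\<close> would have no constant terms, so it could not be a unit vector. It also
  explains the basis: in degree zero the \<open>i\<close>-th entry of \<open>M t / F\<close> has
  degree \<open>b\<^sub>i - d\<close>, so once \<open>b\<^sub>i \<le> d\<close> is known only
  constants at the indices with \<open>b\<^sub>i = d\<close> survive, and a homomorphism with
  \<open>M t = 0\<close> is a constant multiple of the inclusion.

  The obstacle is that \<open>S/F\<close> is not a domain. Only modulo a single prime factor of
  \<open>F\<close> is a homomorphism multiplication by a fraction; iterating it, which needs values
  in \<open>I/F\<close>, bounds the powers of this fraction. Statements are therefore proved modulo
  each prime and then glued.\<close>

section \<open>Homomorphisms of commutative rings\<close>

locale comm_hom =
  fixes h :: "'a::comm_ring_1 \<Rightarrow> 'b::comm_ring_1"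
  assumes one [simp]: "h 1 = 1"
    and add: "h (a + b) = h a + h b"
    and mult: "h (a * b) = h a * h b"
begin

lemma zero [simp]: "h 0 = 0"
  using add[of 0 0] by simp

lemma uminus: "h (- a) = - h a"
  using add[of a "- a"] by (simp add: eq_neg_iff_add_eq_0 add.commute)

lemma diff: "h (a - b) = h a - h b"
  using add[of a "- b"] by (simp add: uminus)

lemma sum: "h (sum f A) = (\<Sum>x\<in>A. h (f x))"
  by (induction A rule: infinite_finite_induct) (auto simp: add)

lemma prod: "h (prod f A) = (\<Prod>x\<in>A. h (f x))"
  by (induction A rule: infinite_finite_induct) (auto simp: mult)

lemma power: "h (a ^ n) = h a ^ n"
  by (induction n) (auto simp: mult)

lemma coeff_map [simp]: "coeff (map_poly h p) n = h (coeff p n)"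
  by (rule coeff_map_poly) simp

lemma degree_map_le: "degree (map_poly h p) \<le> degree p"
  by (rule degree_le) (simp add: coeff_eq_0)

lemma comm_hom_map_poly: "comm_hom (map_poly h)"
proof
  show "map_poly h 1 = 1"
    by (rule poly_eqI) (simp add: coeff_1)
  show "map_poly h (p + q) = map_poly h p + map_poly h q" for p q
    by (rule poly_eqI) (simp add: add)
  show "map_poly h (p * q) = map_poly h p * map_poly h q" for p q
    by (rule poly_eqI) (simp add: coeff_mult sum mult)
qed

lemma comm_hom_poly_map_poly: "comm_hom (\<lambda>p. poly (map_poly h p) x)"
proof -
  interpret m: comm_hom "map_poly h" by (rule comm_hom_map_poly)
  show ?thesis by unfold_locales (simp_all add: m.add m.mult)
qed

lemma dvd: "a dvd b \<Longrightarrow> h a dvd h b"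
  by (auto simp: dvd_def mult)

end

lemma comm_hom_id: "comm_hom id"
  by unfold_locales auto

lemma comm_hom_comp: "comm_hom f \<Longrightarrow> comm_hom g \<Longrightarrow> comm_hom (f \<circ> g)"
  by (simp add: comm_hom_def)

lemma comm_hom_const: "comm_hom (\<lambda>c. [:c:])"
  by unfold_locales (auto simp: one_pCons)

section \<open>Constants, variables and substitution in \<open>S\<close>\<close>

definition Const :: "complex \<Rightarrow> S" where
  "Const c = Poly_Mapping.single 0 c"

definition X :: "3 \<Rightarrow> S" where
  "X i = Poly_Mapping.single (Poly_Mapping.single i 1) 1"

text \<open>The homomorphism given by the universal property of the polynomial ring:
  \<open>h\<close> acts on the coefficients and \<open>x\<close> lists the images of the variables.
  Evaluation, grading, differentiation, restriction to lines and elimination all start from an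
  instance of it.\<close>

definition psub :: "(complex \<Rightarrow> 'b::comm_ring_1) \<Rightarrow> (3 \<Rightarrow> 'b) \<Rightarrow> S \<Rightarrow> 'b" where
  "psub h x F = (\<Sum>m\<in>Poly_Mapping.keys F.
     h (Poly_Mapping.lookup F m) * (\<Prod>i\<in>UNIV. x i ^ Poly_Mapping.lookup m i))"

lemma comm_hom_Const: "comm_hom Const"
  by unfold_locales (auto simp: Const_def single_add mult_single)

interpretation Const: comm_hom Const
  by (rule comm_hom_Const)

lemma sum_singles: "(\<Sum>m\<in>Poly_Mapping.keys F. Poly_Mapping.single m (Poly_Mapping.lookup F m)) = F"
proof (rule poly_mapping_eqI)
  fix k
  have "Poly_Mapping.lookup (\<Sum>m\<in>Poly_Mapping.keys F. Poly_Mapping.single m (Poly_Mapping.lookup F m)) k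
     = (\<Sum>m\<in>Poly_Mapping.keys F. if m = k then Poly_Mapping.lookup F m else 0)"
    unfolding lookup_sum by (rule sum.cong) (auto simp: lookup_single when_def)
  also have "\<dots> = Poly_Mapping.lookup F k"
    by (simp add: in_keys_iff)
  finally show "Poly_Mapping.lookup (\<Sum>m\<in>Poly_Mapping.keys F. Poly_Mapping.single m (Poly_Mapping.lookup F m)) k
     = Poly_Mapping.lookup F k" .
qed


lemma psub_superset:
  assumes "comm_hom h" "finite A" "Poly_Mapping.keys F \<subseteq> A"
  shows "psub h x F = (\<Sum>m\<in>A. h (Poly_Mapping.lookup F m) * (\<Prod>i\<in>UNIV. x i ^ Poly_Mapping.lookup m i))"
proof -
  interpret comm_hom h by fact
  show ?thesis unfolding psub_def
    by (rule sum.mono_neutral_left) (use assms in \<open>auto simp: in_keys_iff\<close>)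
qed

lemma psub_single:
  assumes "comm_hom h"
  shows "psub h x (Poly_Mapping.single m c) = h c * (\<Prod>i\<in>UNIV. x i ^ Poly_Mapping.lookup m i)"
proof -
  interpret comm_hom h by fact
  have "psub h x (Poly_Mapping.single m c) = (\<Sum>m'\<in>{m}. h (Poly_Mapping.lookup (Poly_Mapping.single m c) m') * (\<Prod>i\<in>UNIV. x i ^ Poly_Mapping.lookup m' i))"
    by (rule psub_superset) (use assms in auto)
  then show ?thesis by simp
qed

lemma psub_add:
  assumes "comm_hom h"
  shows "psub h x (F + G) = psub h x F + psub h x G"
proof -
  interpret comm_hom h by fact
  let ?A = "Poly_Mapping.keys F \<union> Poly_Mapping.keys G"
  have "psub h x (F + G) = (\<Sum>m\<in>?A. h (Poly_Mapping.lookup (F + G) m) * (\<Prod>i\<in>UNIV. x i ^ Poly_Mapping.lookup m i))"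
    by (rule psub_superset) (use assms Poly_Mapping.keys_add[of F G] in auto)
  moreover have "psub h x F = (\<Sum>m\<in>?A. h (Poly_Mapping.lookup F m) * (\<Prod>i\<in>UNIV. x i ^ Poly_Mapping.lookup m i))"
    by (rule psub_superset) (use assms in auto)
  moreover have "psub h x G = (\<Sum>m\<in>?A. h (Poly_Mapping.lookup G m) * (\<Prod>i\<in>UNIV. x i ^ Poly_Mapping.lookup m i))"
    by (rule psub_superset) (use assms in auto)
  ultimately show ?thesis
    by (simp add: lookup_add add distrib_right sum.distrib)
qed

lemma psub_sum:
  assumes "comm_hom h"
  shows "psub h x (sum f A) = (\<Sum>a\<in>A. psub h x (f a))"
proof -
  have "psub h x 0 = 0" by (simp add: psub_def)
  then show ?thesis
    by (induction A rule: infinite_finite_induct) (auto simp: psub_add[OF assms])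
qed

lemma psub_mult:
  assumes "comm_hom h"
  shows "psub h x (F * G) = psub h x F * psub h x G"
proof -
  interpret comm_hom h by fact
  let ?s = "\<lambda>F m. Poly_Mapping.single m (Poly_Mapping.lookup F m)"
  have "psub h x (F * G) = psub h x ((\<Sum>m\<in>Poly_Mapping.keys F. ?s F m) * (\<Sum>n\<in>Poly_Mapping.keys G. ?s G n))"
    by (simp add: sum_singles)
  also have "\<dots> = (\<Sum>m\<in>Poly_Mapping.keys F. \<Sum>n\<in>Poly_Mapping.keys G. psub h x (?s F m * ?s G n))"
    by (simp add: sum_product psub_sum[OF assms])
  also have "\<dots> = (\<Sum>m\<in>Poly_Mapping.keys F. \<Sum>n\<in>Poly_Mapping.keys G. psub h x (?s F m) * psub h x (?s G n))"
    by (simp add: mult_single psub_single[OF assms] mult lookup_add power_add prod.distrib mult_ac)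
  also have "\<dots> = psub h x F * psub h x G"
    by (simp add: sum_product[symmetric] psub_sum[OF assms, symmetric] sum_singles)
  finally show ?thesis .
qed

lemma psub_Const: "comm_hom h \<Longrightarrow> psub h x (Const c) = h c"
  by (simp add: Const_def psub_single)

lemma psub_X:
  assumes "comm_hom h"
  shows "psub h x (X i) = x i"
proof -
  interpret comm_hom h by fact
  have "(\<Prod>j\<in>UNIV. x j ^ Poly_Mapping.lookup (Poly_Mapping.single i 1) j) = (\<Prod>j\<in>UNIV. if j = i then x j else 1)"
    by (rule prod.cong) (auto simp: lookup_single when_def)
  then show ?thesis by (simp add: X_def psub_single[OF assms])
qed

lemma comm_hom_psub:
  assumes "comm_hom h" shows "comm_hom (psub h x)"
proof
  interpret comm_hom h by fact
  show "psub h x 1 = 1"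
    using psub_Const[OF assms, of x 1] by simp
qed (simp_all add: psub_add psub_mult assms)

lemma prod_X: "(\<Prod>i\<in>UNIV. X i ^ Poly_Mapping.lookup m i) = Poly_Mapping.single m 1"
proof -
  have p: "X i ^ k = Poly_Mapping.single (Poly_Mapping.single i k) 1" for i k
    by (induction k) (auto simp: X_def mult_single single_add[symmetric])
  have "finite (A :: 3 set) \<Longrightarrow> (\<Prod>i\<in>A. Poly_Mapping.single (Poly_Mapping.single i (Poly_Mapping.lookup m i)) (1::complex))
      = Poly_Mapping.single (\<Sum>i\<in>A. Poly_Mapping.single i (Poly_Mapping.lookup m i)) 1" for A
    by (induction A rule: finite_induct) (auto simp: mult_single)
  moreover have "(\<Sum>i\<in>UNIV. Poly_Mapping.single i (Poly_Mapping.lookup m i)) = m"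
    by (rule poly_mapping_eqI) (simp add: lookup_sum lookup_single when_def)
  ultimately show ?thesis by (simp add: p)
qed

lemma single_conv: "Poly_Mapping.single m c = Const c * (\<Prod>i\<in>UNIV. X i ^ Poly_Mapping.lookup m i)"
  by (simp add: prod_X Const_def mult_single)

lemma psub_id: "psub Const X F = F"
  unfolding psub_def single_conv[symmetric] by (rule sum_singles)

text \<open>The identity \<open>psub Const X F = F\<close> builds every element from constants and
  variables by sums and products.\<close>

lemma S_induct [case_names Const X add mult]:
  assumes C: "\<And>c. P (Const c)" and X: "\<And>i. P (X i)"
    and a: "\<And>F G. P F \<Longrightarrow> P G \<Longrightarrow> P (F + G)"
    and m: "\<And>F G. P F \<Longrightarrow> P G \<Longrightarrow> P (F * G)"
  shows "P F"
proof -
  have 0: "P 0" and 1: "P 1" using C[of 0] C[of 1] by simp_all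
  have pw: "P (F ^ k)" if "P F" for F k
    by (induction k) (auto intro: 1 m that)
  have pr: "P (\<Prod>i\<in>A. f i)" if "\<And>i. P (f i)" for f and A :: "3 set"
    by (induction A rule: infinite_finite_induct) (auto intro: 1 m that)
  have sm: "P (\<Sum>k\<in>A. f k)" if "\<And>k. P (f k)" for f and A :: "(3 \<Rightarrow>\<^sub>0 nat) set"
    by (induction A rule: infinite_finite_induct) (auto intro: 0 a that)
  have "P (psub Const X F)"
    unfolding psub_def by (intro sm m C pr pw X)
  then show ?thesis by (simp add: psub_id)
qed

lemma comm_hom_eq_psub:
  assumes "comm_hom f"
  shows "f F = psub (\<lambda>c. f (Const c)) (\<lambda>i. f (X i)) F"
proof -
  have h: "comm_hom (\<lambda>c. f (Const c))"
    using comm_hom_comp[OF assms comm_hom_Const] by (simp add: o_def)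
  interpret f: comm_hom f by fact
  show ?thesis
    by (induction F rule: S_induct) (simp_all add: psub_Const[OF h] psub_X[OF h] psub_add[OF h] psub_mult[OF h] f.add f.mult)
qed

text \<open>Uniqueness in the universal property. Identities between composed substitutions are
  reduced by it to constants and variables.\<close>

lemma S_hom_eqI:
  assumes "comm_hom f" "comm_hom g" "\<And>c. f (Const c) = g (Const c)" "\<And>i. f (X i) = g (X i)"
  shows "f F = g F"
  using comm_hom_eq_psub[OF assms(1), of F] comm_hom_eq_psub[OF assms(2), of F] assms(3,4) by simp

lemma eval_psub: "eval F v = psub id (($) v) F"
  by (simp add: eval_def psub_def)

interpretation eval: comm_hom "\<lambda>F. eval F v"
  using comm_hom_psub[OF comm_hom_id] by (simp add: eval_psub)

lemma eval_Const [simp]: "eval (Const c) v = c"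
  by (simp add: eval_psub psub_Const[OF comm_hom_id])

lemma eval_X [simp]: "eval (X i) v = v $ i"
  by (simp add: eval_psub psub_X[OF comm_hom_id])

subsection \<open>Homogeneous components\<close>

text \<open>
  The homogeneous component of degree \<open>k\<close> of \<open>F\<close> is the coefficient of \<open>t\<^sup>k\<close> in \<open>F(t X)\<close>;
  working with \<open>theta\<close> makes multiplicativity of the grading automatic.
\<close>

definition theta :: "S \<Rightarrow> S poly" where
  "theta = psub (\<lambda>c. [:Const c:]) (\<lambda>i. [:0, X i:])"

lemma comm_hom_Const_const: "comm_hom (\<lambda>c. [:Const c:])"
  using comm_hom_comp[OF comm_hom_const comm_hom_Const] by (simp add: o_def)

interpretation theta: comm_hom theta
  unfolding theta_def by (rule comm_hom_psub[OF comm_hom_Const_const])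

lemma theta_Const [simp]: "theta (Const c) = [:Const c:]"
  by (simp add: theta_def psub_Const[OF comm_hom_Const_const])

lemma theta_X [simp]: "theta (X i) = [:0, X i:]"
  by (simp add: theta_def psub_X[OF comm_hom_Const_const])

lemma poly_theta_1: "poly (theta F) 1 = F"
proof -
  have "comm_hom (\<lambda>F. poly (theta F) 1)"
    by unfold_locales (simp_all add: theta.add theta.mult)
  from S_hom_eqI[OF this comm_hom_id, of F] show ?thesis by simp
qed

lemma theta_single: "theta (Poly_Mapping.single m c) = monom (Poly_Mapping.single m c) (mdeg m)"
proof -
  have x: "[:0, X i:] = monom (X i) 1" for i
    by (simp add: monom_altdef)
  have pw: "monom (a::S) k ^ n = monom (a ^ n) (k * n)" for a k n
    by (rule monom_power)
  have pr: "(\<Prod>i\<in>A. monom (f i) (k i)) = monom (\<Prod>i\<in>A. f i) (\<Sum>i\<in>A. k i)"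
    for A :: "3 set" and f :: "3 \<Rightarrow> S" and k
    by (induction A rule: infinite_finite_induct) (auto simp: mult_monom)
  have "theta (Poly_Mapping.single m c) = [:Const c:] * (\<Prod>i\<in>UNIV. [:0, X i:] ^ Poly_Mapping.lookup m i)"
    by (simp add: single_conv theta.mult theta.prod theta.power)
  also have "\<dots> = monom (Poly_Mapping.single m c) (mdeg m)"
    by (simp add: x pw pr mdeg_def smult_monom single_conv)
  finally show ?thesis .
qed

lemma lookup_coeff_theta:
  "Poly_Mapping.lookup (coeff (theta F) k) m = (if mdeg m = k then Poly_Mapping.lookup F m else 0)"
proof -
  have "theta F = (\<Sum>n\<in>Poly_Mapping.keys F. monom (Poly_Mapping.single n (Poly_Mapping.lookup F n)) (mdeg n))"
    by (subst (1) sum_singles[symmetric]) (simp add: theta.sum theta_single)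
  then have "Poly_Mapping.lookup (coeff (theta F) k) m
     = (\<Sum>n\<in>Poly_Mapping.keys F. if n = m then (if mdeg m = k then Poly_Mapping.lookup F m else 0) else 0)"
    by (auto simp: coeff_sum lookup_sum lookup_single when_def if_distrib intro!: sum.cong)
  then show ?thesis by (auto simp: in_keys_iff)
qed

lemma homogeneous_iff_theta: "homogeneous (int k) F \<longleftrightarrow> theta F = monom F k"
proof
  assume "homogeneous (int k) F"
  then show "theta F = monom F k"
    by (intro poly_eqI poly_mapping_eqI)
      (auto simp: lookup_coeff_theta homogeneous_def in_keys_iff)
next
  assume *: "theta F = monom F k"
  have "mdeg m = k" if "m \<in> Poly_Mapping.keys F" for m
    using lookup_coeff_theta[of F "mdeg m" m] that by (auto simp: * in_keys_iff split: if_splits)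
  then show "homogeneous (int k) F"
    by (auto simp: homogeneous_def)
qed

lemma homogeneous_neg: "homogeneous k F \<Longrightarrow> k < 0 \<Longrightarrow> F = 0"
  by (rule poly_mapping_eqI) (force simp: homogeneous_def in_keys_iff)

lemma homogeneous_0 [simp]: "homogeneous k 0"
  by (simp add: homogeneous_def)

text \<open>The index is an integer, with zero component in negative degrees, because differences
  such as \<open>k - a j\<close> have to be admissible.\<close>

definition hci :: "int \<Rightarrow> S \<Rightarrow> S" where
  "hci k F = (if k < 0 then 0 else coeff (theta F) (nat k))"

lemma lookup_hci: "Poly_Mapping.lookup (hci k F) m = (if int (mdeg m) = k then Poly_Mapping.lookup F m else 0)"
  by (auto simp: hci_def lookup_coeff_theta)

lemma homogeneous_hci: "homogeneous k (hci k F)"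
  by (auto simp: homogeneous_def in_keys_iff lookup_hci split: if_splits)

lemma hci_homogeneous: "homogeneous k F \<Longrightarrow> hci l F = (if l = k then F else 0)"
  by (rule poly_mapping_eqI) (auto simp: lookup_hci homogeneous_def in_keys_iff)

lemma hci_add: "hci k (F + G) = hci k F + hci k G"
  by (auto simp: hci_def theta.add)

lemma hci_0 [simp]: "hci k 0 = 0"
  by (auto simp: hci_def)

lemma hci_sum: "hci k (sum f A) = (\<Sum>a\<in>A. hci k (f a))"
  by (induction A rule: infinite_finite_induct) (auto simp: hci_add)

text \<open>Its use: in a relation between homogeneous elements, taking one component replaces the
  coefficients by homogeneous ones and keeps the relation.\<close>

lemma hci_mult:
  assumes "homogeneous l F"
  shows "hci k (F * G) = F * hci (k - l) G"
proof (cases "l < 0")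
  case True
  then show ?thesis using assms homogeneous_neg[of l F] by simp
next
  case False
  then obtain n where l: "l = int n" by (metis nat_0_le not_less)
  then have "theta F = monom F n" using assms by (simp add: homogeneous_iff_theta)
  then show ?thesis
    by (auto simp: hci_def theta.mult coeff_monom_mult l nat_diff_distrib)
qed

lemma homogeneous_add: "homogeneous k F \<Longrightarrow> homogeneous k G \<Longrightarrow> homogeneous k (F + G)"
  by (metis hci_add hci_homogeneous homogeneous_hci)

lemma homogeneous_sum: "(\<And>a. a \<in> A \<Longrightarrow> homogeneous k (f a)) \<Longrightarrow> homogeneous k (sum f A)"
  by (induction A rule: infinite_finite_induct) (auto intro: homogeneous_add)

lemma homogeneous_mult: "homogeneous k F \<Longrightarrow> homogeneous l G \<Longrightarrow> homogeneous (k + l) (F * G)"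
  using hci_mult[of k F "k + l" G] hci_homogeneous[of l G l] homogeneous_hci[of "k + l" "F * G"] by simp

lemma homogeneous_Const [simp]: "homogeneous 0 (Const c)"
  using homogeneous_iff_theta[of 0] by (simp add: monom_0)

lemma homogeneous_X [simp]: "homogeneous 1 (X i)"
  using homogeneous_iff_theta[of 1] by (simp add: monom_altdef)

lemma homogeneous_Const_mult: "homogeneous k F \<Longrightarrow> homogeneous k (Const c * F)"
  using homogeneous_mult[of 0 "Const c" k F] by simp

lemma homogeneous_uminus: "homogeneous k F \<Longrightarrow> homogeneous k (- F)"
  using homogeneous_Const_mult[of k F "-1"] by (simp add: Const.uminus)

lemma homogeneous_diff: "homogeneous k F \<Longrightarrow> homogeneous k G \<Longrightarrow> homogeneous k (F - G)"
  using homogeneous_add[of k F "- G"] homogeneous_uminus by simp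

lemma homogeneous_power: "homogeneous k F \<Longrightarrow> homogeneous (int n * k) (F ^ n)"
proof (induction n)
  case 0
  then show ?case using homogeneous_Const[of 1] by simp
next
  case (Suc n)
  then show ?case using homogeneous_mult[of k F "int n * k" "F ^ n"] by (simp add: algebra_simps)
qed

text \<open>Splitting off the highest powers of the variable leaves cofactors with nonzero constant
  terms. Comparison of the lowest terms shows that these multiply to a constant, so over a domain
  both have degree zero.\<close>

lemma monom_factor:
  fixes p q :: "'a::idom poly"
  assumes "p * q = monom c d" "c \<noteq> 0"
  obtains a k where "p = monom a k"
proof -
  have pq: "p \<noteq> 0" "q \<noteq> 0" using assms by auto
  obtain p' where p': "p = [:-0, 1:] ^ order 0 p * p'" "\<not> [:-0, 1:] dvd p'"
    using order_decomp[OF pq(1), of 0] by auto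
  obtain q' where q': "q = [:-0, 1:] ^ order 0 q * q'" "\<not> [:-0, 1:] dvd q'"
    using order_decomp[OF pq(2), of 0] by auto
  define s where "s = order 0 p + order 0 q"
  have x: "[:-0, 1:] ^ k = monom (1::'a) k" for k by (simp add: monom_altdef)
  have xx: "monom (1::'a) i * monom 1 j = monom 1 (i + j)" for i j by (simp add: mult_monom)
  have c0: "coeff p' 0 * coeff q' 0 \<noteq> 0"
    using p'(2) q'(2) by (auto simp: dvd_iff_poly_eq_0 poly_0_coeff_0)
  have "p * q = monom 1 s * (p' * q')"
    by (subst p'(1), subst q'(1)) (simp only: x s_def xx[symmetric] mult_ac)
  then have e: "monom 1 s * (p' * q') = monom c d" using assms by simp
  have "coeff (monom 1 s * (p' * q')) s \<noteq> 0"
    using c0 by (simp add: coeff_monom_mult coeff_mult_0)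
  then have "d = s" unfolding e by (auto split: if_splits)
  with e have "monom 1 s * (p' * q') = monom 1 s * [:c:]"
    by (simp add: mult_monom smult_monom)
  then have "p' * q' = [:c:]" by (metis mult_left_cancel monom_eq_0_iff one_neq_zero)
  then have "degree p' + degree q' = 0" using pq p' q'
    by (metis degree_mult_eq degree_pCons_0 mult_eq_0_iff)
  then have "p' = [:coeff p' 0:]" by (metis add_is_0 degree_eq_zeroE coeff_pCons_0)
  then have "p = monom (coeff p' 0) (order 0 p)"
    using p'(1) by (metis x mult_monom monom_0 mult_1 add_0_right)
  then show ?thesis by (rule that)
qed

text \<open>Under \<open>theta\<close> homogeneous elements become monomials, and factors of a
  monomial are monomials.\<close>

lemma homogeneous_factor:
  assumes "homogeneous d (F * G)" "F * G \<noteq> 0"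
  obtains k where "homogeneous (int k) F" "homogeneous (d - int k) G"
proof -
  have "\<not> d < 0" using homogeneous_neg assms by blast
  then obtain n where d: "d = int n" by (metis nat_0_le not_less)
  have *: "theta F * theta G = monom (F * G) n"
    using assms(1) by (simp add: d homogeneous_iff_theta theta.mult)
  obtain a k where k: "theta F = monom a k" using monom_factor[OF * assms(2)] .
  have "F = a" using poly_theta_1[of F] by (simp add: k poly_monom)
  then have F: "homogeneous (int k) F" using k by (simp add: homogeneous_iff_theta)
  have "F * hci (d - int k) G = F * G"
    using hci_mult[OF F, of d G] hci_homogeneous[OF assms(1), of d] by metis
  then have "homogeneous (d - int k) G"
    using assms(2) by (metis homogeneous_hci mult_left_cancel mult_not_zero)
  with F show ?thesis by (rule that)
qed

lemma homogeneous_dvd: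
  assumes "homogeneous k F" "homogeneous l (F * G)" "F \<noteq> 0"
  shows "homogeneous (l - k) G"
  using hci_mult[OF assms(1), of l G] hci_homogeneous[OF assms(2), of l] assms(3)
  by (metis homogeneous_hci mult_left_cancel)

lemma eval_homogeneous:
  assumes "homogeneous k F" "c \<noteq> 0"
  shows "eval F (c *s v) = c powi k * eval F v"
proof (cases "k < 0")
  case True
  then show ?thesis using assms homogeneous_neg[of k F] by simp
next
  case False
  then obtain n where l: "k = int n" by (metis nat_0_le not_less)
  have h1: "comm_hom (\<lambda>F. poly (map_poly (\<lambda>G. eval G v) (theta F)) c)"
  proof -
    interpret p: comm_hom "\<lambda>q. poly (map_poly (\<lambda>G. eval G v) q) c"
      by (rule eval.comm_hom_poly_map_poly)
    show ?thesis by unfold_locales (simp_all add: theta.add theta.mult p.add p.mult)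
  qed
  have h2: "comm_hom (\<lambda>F. eval F (c *s v))"
    by unfold_locales (simp_all add: eval.add eval.mult)
  \<comment> \<open>\<open>F(c v)\<close> arises from \<open>theta F\<close> by evaluating the
    coefficients at \<open>v\<close> and the grading variable at \<open>c\<close>.\<close>
  have "poly (map_poly (\<lambda>G. eval G v) (theta F)) c = eval F (c *s v)"
    by (rule S_hom_eqI[OF h1 h2]) (simp_all add: map_poly_pCons)
  moreover have "theta F = monom F n" using assms l by (simp add: homogeneous_iff_theta)
  ultimately show ?thesis
    by (simp add: map_poly_monom poly_monom l mult.commute)
qed

subsection \<open>Partial derivatives\<close>

text \<open>\<open>dual i F\<close> is \<open>F\<close> with \<open>\<epsilon>\<close> added to its \<open>i\<close>-th variable, as a polynomial in \<open>\<epsilon>\<close>.\<close>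

definition dual :: "3 \<Rightarrow> S \<Rightarrow> S poly" where
  "dual i = psub (\<lambda>c. [:Const c:]) (\<lambda>j. [:X j, if j = i then 1 else 0:])"

definition pd :: "3 \<Rightarrow> S \<Rightarrow> S" where
  "pd i F = coeff (dual i F) 1"

interpretation dual: comm_hom "dual i"
  unfolding dual_def by (rule comm_hom_psub[OF comm_hom_Const_const])

lemma coeff_dual_0 [simp]: "coeff (dual i F) 0 = F"
proof -
  have "comm_hom (\<lambda>F. coeff (dual i F) 0)"
    by unfold_locales (simp_all add: dual.add dual.mult coeff_mult_0)
  from S_hom_eqI[OF this comm_hom_id, of F] show ?thesis
    by (simp add: dual_def psub_Const[OF comm_hom_Const_const] psub_X[OF comm_hom_Const_const])
qed

lemma pd_Const [simp]: "pd i (Const c) = 0"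
  by (simp add: pd_def dual_def psub_Const[OF comm_hom_Const_const])

lemma pd_X: "pd i (X j) = (if j = i then 1 else 0)"
  by (simp add: pd_def dual_def psub_X[OF comm_hom_Const_const])

lemma pd_add: "pd i (F + G) = pd i F + pd i G"
  by (simp add: pd_def dual.add)

lemma pd_mult: "pd i (F * G) = pd i F * G + F * pd i G"
  by (simp add: pd_def dual.mult coeff_mult)

lemma pd_0 [simp]: "pd i 0 = 0"
  using pd_Const[of i 0] by simp

lemma pd_1 [simp]: "pd i 1 = 0"
  using pd_Const[of i 1] by simp

lemma pd_sum: "pd i (sum f A) = (\<Sum>a\<in>A. pd i (f a))"
  by (induction A rule: infinite_finite_induct) (auto simp: pd_add)

lemma pd_commute: "pd i (pd j F) = pd j (pd i F)"
  by (induction F rule: S_induct) (auto simp: pd_X pd_add pd_mult algebra_simps)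

text \<open>Both sides are the derivative of \<open>F(tX)\<close> at \<open>t = 1\<close>, the right
  one because \<open>theta F\<close> is a monomial.\<close>

lemma euler:
  assumes "homogeneous (int k) F"
  shows "(\<Sum>i\<in>UNIV. X i * pd i F) = of_nat k * F"
proof -
  have "(\<Sum>i\<in>UNIV. X i * pd i F) = poly (pderiv (theta F)) 1"
  proof (induction F rule: S_induct)
    case (X i)
    then show ?case by (simp add: pd_X pderiv_pCons if_distrib cong: if_cong)
  next
    case (mult F G)
    have "(\<Sum>i\<in>UNIV. X i * pd i (F * G)) = (\<Sum>i\<in>UNIV. X i * pd i F) * G + F * (\<Sum>i\<in>UNIV. X i * pd i G)"
      by (simp add: pd_mult algebra_simps sum.distrib sum_distrib_left)
    then show ?case
      by (simp add: mult theta.mult pderiv_mult poly_theta_1 algebra_simps)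
  qed (simp_all add: pd_add theta.add pderiv_add algebra_simps sum.distrib)
  also have "\<dots> = of_nat k * F"
    using assms by (simp add: homogeneous_iff_theta pderiv_monom poly_monom)
  finally show ?thesis .
qed

text \<open>The chain rule: differentiating \<open>F(tX)\<close> with respect to \<open>X i\<close>
  produces a factor \<open>t\<close>. This is the drop of the degree by one in
  \<open>homogeneous_pd\<close>.\<close>

lemma theta_pd: "map_poly (pd i) (theta F) = pCons 0 (theta (pd i F))"
proof (induction F rule: S_induct)
  case (X j)
  then show ?case by (simp add: map_poly_pCons pd_X)
next
  case (add F G)
  have "map_poly (pd i) (p + q) = map_poly (pd i) p + map_poly (pd i) q" for p q
    by (rule poly_eqI) (simp add: coeff_map_poly pd_add)
  then show ?case by (simp add: theta.add pd_add add)
next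
  case (mult F G)
  have "map_poly (pd i) (p * q) = map_poly (pd i) p * q + p * map_poly (pd i) q" for p q
    by (rule poly_eqI) (simp add: coeff_map_poly coeff_mult pd_mult pd_sum sum.distrib)
  then show ?case by (simp add: theta.mult theta.add pd_mult mult)
qed (simp_all add: map_poly_pCons)

lemma homogeneous_pd:
  assumes "homogeneous k F"
  shows "homogeneous (k - 1) (pd i F)"
proof (cases "k < 0")
  case True
  then show ?thesis using assms homogeneous_neg[of k F] by simp
next
  case False
  then obtain n where l: "k = int n" by (metis nat_0_le not_less)
  have *: "pCons 0 (theta (pd i F)) = monom (pd i F) n"
    using theta_pd[of i F] assms by (simp add: l homogeneous_iff_theta map_poly_monom)
  show ?thesis
  proof (cases n)
    case 0
    then have "coeff (monom (pd i F) n) 0 = 0" using * by (metis coeff_pCons_0)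
    then show ?thesis using 0 by simp
  next
    case (Suc n')
    then have "theta (pd i F) = monom (pd i F) n'" using * by (simp add: monom_Suc)
    then show ?thesis using Suc l homogeneous_iff_theta[of n' "pd i F"] by simp
  qed
qed

lemma has_derivative_eval:
  "(eval F has_derivative (\<lambda>h. \<Sum>i\<in>UNIV. eval (pd i F) v * h $ i)) (at v)"
proof (induction F rule: S_induct)
  case (Const c)
  then show ?case by (simp add: eval.zero has_derivative_const)
next
  case (X j)
  have "((\<lambda>v. v $ j) has_derivative (\<lambda>h. h $ j)) (at v)"
    by (rule bounded_linear_imp_has_derivative) (rule bounded_linear_vec_nth)
  moreover have "(\<lambda>h. \<Sum>i\<in>UNIV. eval (pd i (X j)) v * h $ i) = (\<lambda>h. h $ j)"
    by (rule ext) (simp add: pd_X if_distrib[of "\<lambda>x. eval x v"] if_distrib[of "\<lambda>x. x * _"] eval.one eval.zero cong: if_cong)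
  ultimately show ?case by simp
next
  case (add F G)
  then show ?case
    using has_derivative_add[OF add] by (simp add: pd_add eval.add distrib_right sum.distrib)
next
  case (mult F G)
  have "(\<lambda>h. \<Sum>i\<in>UNIV. eval (pd i (F * G)) v * h $ i) = (\<lambda>h. eval F v * (\<Sum>i\<in>UNIV. eval (pd i G) v * h $ i) + (\<Sum>i\<in>UNIV. eval (pd i F) v * h $ i) * eval G v)"
    by (rule ext) (simp add: pd_mult eval.add eval.mult sum_distrib_left sum_distrib_right sum.distrib algebra_simps)
  then show ?case
    using has_derivative_mult[OF mult] by (simp add: eval.mult)
qed

definition grad :: "S \<Rightarrow> complex^3 \<Rightarrow> complex^3 \<Rightarrow> complex" where
  "grad F v \<eta> = (\<Sum>i\<in>UNIV. eval (pd i F) v * \<eta> $ i)"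

definition hess :: "S \<Rightarrow> complex^3 \<Rightarrow> complex^3 \<Rightarrow> complex^3 \<Rightarrow> complex" where
  "hess F v \<eta> \<zeta> = (\<Sum>i\<in>UNIV. \<Sum>j\<in>UNIV. eval (pd i (pd j F)) v * \<eta> $ i * \<zeta> $ j)"

lemma hess_sym: "hess F v \<eta> \<zeta> = hess F v \<zeta> \<eta>"
  unfolding hess_def by (subst sum.swap) (simp add: pd_commute mult_ac)

lemma hess_add_left: "hess F v (\<eta> + \<eta>') \<zeta> = hess F v \<eta> \<zeta> + hess F v \<eta>' \<zeta>"
  by (simp add: hess_def algebra_simps sum.distrib)

lemma hess_add_right: "hess F v \<eta> (\<zeta> + \<zeta>') = hess F v \<eta> \<zeta> + hess F v \<eta> \<zeta>'"
  by (simp add: hess_def algebra_simps sum.distrib)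

lemma grad_add: "grad (F + G) v \<eta> = grad F v \<eta> + grad G v \<eta>"
  by (simp add: grad_def pd_add eval.add distrib_right sum.distrib)

lemma grad_mult: "grad (F * G) v \<eta> = grad F v \<eta> * eval G v + eval F v * grad G v \<eta>"
  by (simp add: grad_def pd_mult eval.add eval.mult sum.distrib sum_distrib_left sum_distrib_right algebra_simps)

lemma grad_sum_pd: "hess F v \<eta> \<zeta> = (\<Sum>j\<in>UNIV. grad (pd j F) v \<eta> * \<zeta> $ j)"
  unfolding hess_def grad_def by (subst sum.swap) (simp add: sum_distrib_right)

text \<open>At a common zero every term with an undifferentiated factor vanishes. At a crossing of
  two curves this translates nondegeneracy of the product into transversality of the
  gradients.\<close>

lemma hess_mult:
  assumes "eval F v = 0" "eval G v = 0"
  shows "hess (F * G) v \<eta> \<zeta> = grad F v \<eta> * grad G v \<zeta> + grad G v \<eta> * grad F v \<zeta>"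
proof -
  have "hess (F * G) v \<eta> \<zeta> = (\<Sum>j\<in>UNIV. (eval (pd j F) v * grad G v \<eta> + grad F v \<eta> * eval (pd j G) v) * \<zeta> $ j)"
    unfolding grad_sum_pd
    by (rule sum.cong) (simp_all add: pd_mult grad_mult assms grad_def[of "_ + _"] pd_add eval.add
        eval.mult distrib_right sum.distrib sum_distrib_left sum_distrib_right grad_def algebra_simps)
  also have "\<dots> = grad F v \<eta> * grad G v \<zeta> + grad G v \<eta> * grad F v \<zeta>"
    by (simp add: grad_def[of _ _ \<zeta>] sum_distrib_left sum.distrib algebra_simps)
  finally show ?thesis .
qed

subsection \<open>Restriction to a line\<close>

definition line :: "complex^3 \<Rightarrow> complex^3 \<Rightarrow> S \<Rightarrow> complex poly" where
  "line v \<eta> = psub (\<lambda>c. [:c:]) (\<lambda>i. [:v $ i, \<eta> $ i:])"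

interpretation line: comm_hom "line v \<eta>"
  unfolding line_def by (rule comm_hom_psub[OF comm_hom_const])

lemma line_Const [simp]: "line v \<eta> (Const c) = [:c:]"
  by (simp add: line_def psub_Const[OF comm_hom_const])

lemma line_X [simp]: "line v \<eta> (X i) = [:v $ i, \<eta> $ i:]"
  by (simp add: line_def psub_X[OF comm_hom_const])

lemma poly_line: "poly (line v \<eta> F) t = eval F (v + t *s \<eta>)"
proof -
  have 1: "comm_hom (\<lambda>F. poly (line v \<eta> F) t)"
    by unfold_locales (simp_all add: line.add line.mult)
  have 2: "comm_hom (\<lambda>F. eval F (v + t *s \<eta>))"
    by unfold_locales (simp_all add: eval.add eval.mult)
  show ?thesis by (rule S_hom_eqI[OF 1 2]) simp_all
qed

lemma pderiv_line: "pderiv (line v \<eta> F) = (\<Sum>i\<in>UNIV. smult (\<eta> $ i) (line v \<eta> (pd i F)))"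
proof (induction F rule: S_induct)
  case (X j)
  then show ?case by (simp add: pd_X pderiv_pCons if_distrib[of "line v \<eta>"] if_distrib[of "smult _"] cong: if_cong)
next
  case (mult F G)
  then show ?case
    by (simp add: line.mult line.add pd_mult pderiv_mult smult_add_right sum.distrib sum_distrib_left mult_ac)
qed (simp_all add: line.add pd_add pderiv_add smult_add_right sum.distrib)

lemma coeff_line_0: "coeff (line v \<eta> F) 0 = eval F v"
  using poly_line[of v \<eta> F 0] by (simp add: poly_0_coeff_0)

lemma coeff_line_1: "coeff (line v \<eta> F) 1 = grad F v \<eta>"
proof -
  have "coeff (line v \<eta> F) 1 = coeff (pderiv (line v \<eta> F)) 0" by (simp add: coeff_pderiv)
  also have "\<dots> = grad F v \<eta>"
    by (simp add: pderiv_line coeff_sum coeff_line_0 grad_def mult.commute)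
  finally show ?thesis .
qed

lemma coeff_line_2: "2 * coeff (line v \<eta> F) 2 = hess F v \<eta> \<eta>"
proof -
  have "2 * coeff (line v \<eta> F) 2 = coeff (pderiv (line v \<eta> F)) 1"
    by (simp add: coeff_pderiv numeral_2_eq_2)
  also have "\<dots> = hess F v \<eta> \<eta>"
    by (simp add: pderiv_line coeff_sum coeff_line_1 grad_sum_pd mult.commute del: One_nat_def)
  finally show ?thesis .
qed

subsection \<open>Unique factorization and elimination\<close>

lemma index3_exhaust: "j = i \<or> j = i + 1 \<or> j = i + 2" for i j :: 3
  using exhaust_3[of i] exhaust_3[of j] by auto

lemma index3_neq [simp]: "i + 1 \<noteq> i" "i + 2 \<noteq> i" "i + 1 \<noteq> i + 2" "i + 2 \<noteq> i + 1"
    "i \<noteq> i + 1" "i \<noteq> i + 2" for i :: 3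
  by auto

lemma UNIV_index3: "UNIV = {i, i + 1, i + 2}" for i :: 3
  using index3_exhaust[of _ i] by auto

lemma sum_index3: "sum f UNIV = f i + f (i + 1) + f (i + 2)" for i :: 3 and f :: "3 \<Rightarrow> 'a::comm_monoid_add"
  by (subst UNIV_index3[of i]) (simp add: add.assoc)

lemma poly_hom_eqI:
  assumes "comm_hom f" "comm_hom g" "\<And>a. f [:a:] = g [:a:]" "f [:0, 1:] = g [:0, 1:]"
  shows "f q = g q"
proof -
  interpret f: comm_hom f by fact
  interpret g: comm_hom g by fact
  show ?thesis
  proof (induction q)
    case (pCons a p)
    have "pCons a p = [:a:] + [:0, 1:] * p" by simp
    then show ?case using pCons assms(3,4) by (metis f.add f.mult g.add g.mult)
  qed simp
qed

text \<open>\<open>S\<close> as an iterated univariate polynomial ring with \<open>X i\<close>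
  outermost. Unique factorization is transported along it, and elimination of \<open>X i\<close>
  becomes a statement about univariate polynomials.\<close>

definition up :: "3 \<Rightarrow> S \<Rightarrow> complex poly poly poly" where
  "up i = psub (\<lambda>c. [:[:[:c:]:]:])
     (\<lambda>j. if j = i then [:0, 1:] else if j = i + 1 then [:[:0, 1:]:] else [:[:[:0, 1:]:]:])"

text \<open>The inverse of \<open>up i\<close> is built from the inside outwards. In particular
  \<open>down2 i r\<close> is the way to denote a polynomial free of \<open>X i\<close>.\<close>

definition down1 :: "3 \<Rightarrow> complex poly \<Rightarrow> S" where
  "down1 i s = poly (map_poly Const s) (X (i + 2))"

definition down2 :: "3 \<Rightarrow> complex poly poly \<Rightarrow> S" where
  "down2 i r = poly (map_poly (down1 i) r) (X (i + 1))"

definition down :: "3 \<Rightarrow> complex poly poly poly \<Rightarrow> S" where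
  "down i q = poly (map_poly (down2 i) q) (X i)"

lemma comm_hom_const3: "comm_hom (\<lambda>c::complex. [:[:[:c:]:]:])"
  by unfold_locales (auto simp: one_pCons)

interpretation up: comm_hom "up i"
  unfolding up_def by (rule comm_hom_psub[OF comm_hom_const3])

lemma up_Const [simp]: "up i (Const c) = [:[:[:c:]:]:]"
  by (simp add: up_def psub_Const[OF comm_hom_const3])

lemma up_X: "up i (X j) = (if j = i then [:0, 1:] else if j = i + 1 then [:[:0, 1:]:] else [:[:[:0, 1:]:]:])"
  by (simp add: up_def psub_X[OF comm_hom_const3])

interpretation down1: comm_hom "down1 i"
  unfolding down1_def[abs_def] by (rule Const.comm_hom_poly_map_poly)

interpretation down2: comm_hom "down2 i"
  unfolding down2_def[abs_def] by (rule down1.comm_hom_poly_map_poly)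

interpretation down: comm_hom "down i"
  unfolding down_def[abs_def] by (rule down2.comm_hom_poly_map_poly)

lemma down_simps [simp]:
  "down1 i [:c:] = Const c" "down1 i [:0, 1:] = X (i + 2)"
  "down2 i [:s:] = down1 i s" "down2 i [:0, 1:] = X (i + 1)"
  "down i [:r:] = down2 i r" "down i [:0, 1:] = X i"
  by (simp_all add: down1_def down2_def down_def map_poly_pCons)

lemma down_up [simp]: "down i (up i F) = F"
proof -
  have du: "comm_hom (\<lambda>F. down i (up i F))"
    by unfold_locales (simp_all add: up.add up.mult down.add down.mult)
  have "down i (up i (X j)) = id (X j)" for j
    using index3_exhaust[of j i] by (auto simp: up_X)
  then show ?thesis
    using S_hom_eqI[OF du comm_hom_id, of F] by simp
qed

lemma up_down [simp]: "up i (down i q) = q"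
proof -
  have ud: "comm_hom (\<lambda>q. up i (down i q))"
    by unfold_locales (simp_all add: up.add up.mult down.add down.mult)
  have ud2: "comm_hom (\<lambda>q. up i (down2 i q))"
    by unfold_locales (simp_all add: up.add up.mult down2.add down2.mult)
  have ud1: "comm_hom (\<lambda>q. up i (down1 i q))"
    by unfold_locales (simp_all add: up.add up.mult down1.add down1.mult)
  have c2: "comm_hom (\<lambda>r::complex poly poly. [:r:])" by (rule comm_hom_const)
  have c1: "comm_hom (\<lambda>s::complex poly. [:[:s:]:])"
    by unfold_locales (auto simp: one_pCons)
  have 1: "up i (down1 i s) = [:[:s:]:]" for s
    by (rule poly_hom_eqI[OF ud1 c1]) (simp_all add: up_X)
  have 2: "up i (down2 i r) = [:r:]" for r
    by (rule poly_hom_eqI[OF ud2 c2]) (simp_all add: up_X 1)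
  have "up i (down i q) = id q"
    by (rule poly_hom_eqI[OF ud comm_hom_id]) (simp_all add: up_X 2)
  then show ?thesis by simp
qed

lemma up_eq_0_iff [simp]: "up i F = 0 \<longleftrightarrow> F = 0"
  by (metis down.zero down_up up.zero)

lemma up_dvd_iff: "up i F dvd up i G \<longleftrightarrow> F dvd G"
  by (metis down.dvd down_up up.dvd)

lemma prime_elem_up_iff: "prime_elem (up i F) \<longleftrightarrow> prime_elem F"
proof -
  have "(\<forall>a b. up i F dvd a * b \<longrightarrow> up i F dvd a \<or> up i F dvd b) \<longleftrightarrow>
    (\<forall>a b. up i F dvd up i a * up i b \<longrightarrow> up i F dvd up i a \<or> up i F dvd up i b)"
    by (metis up_down)
  moreover have "up i F dvd 1 \<longleftrightarrow> F dvd 1"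
    using up_dvd_iff[of i F 1] by simp
  ultimately show ?thesis
    by (simp add: prime_elem_def up.mult[symmetric] up_dvd_iff)
qed

lemma squarefree_nonzero:
  fixes F :: S
  assumes "squarefree F"
  shows "F \<noteq> 0"
proof
  assume "F = 0"
  then have "X 0 dvd 1" using assms by (auto simp: squarefree_def)
  then obtain G where "1 = X 0 * G" by (elim dvdE)
  then have "eval 1 0 = eval (X 0) 0 * eval G 0" by (metis eval.mult)
  then show False by simp
qed

text \<open>Factoriality comes through \<open>up 0\<close>. The unit \<open>u\<close> absorbs the
  normalization of the primes, and squarefreeness excludes associated pairs, which turns the
  multiset of primes into a set.\<close>

lemma squarefree_prime_factorization:
  fixes F :: S
  assumes "squarefree F"
  obtains u PS where "u dvd 1" "finite PS" "\<And>P. P \<in> PS \<Longrightarrow> prime_elem P"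
    "\<And>P Q. P \<in> PS \<Longrightarrow> Q \<in> PS \<Longrightarrow> P dvd Q \<Longrightarrow> P = Q" "F = u * \<Prod>PS"
proof -
  have "F \<noteq> 0" by (rule squarefree_nonzero[OF assms])
  then have "up 0 F \<noteq> 0" by simp
  then obtain A where A: "\<And>x. x \<in># A \<Longrightarrow> prime x" "normalize (prod_mset A) = normalize (up 0 F)"
    using prime_factorization_exists' by blast
  from A(2) obtain u where u: "is_unit u" "up 0 F = u * prod_mset A"
    by (metis associatedE2)
  define B where "B = image_mset (down 0) A"
  have prod: "down 0 (prod_mset A) = prod_mset B"
    unfolding B_def by (induction A) (simp_all add: down.mult)
  have F: "F = down 0 u * prod_mset B"
    using arg_cong[OF u(2), of "down 0"] by (simp add: down.mult prod)
  have pr: "prime_elem P" if "P \<in># B" for P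
    using that A(1) by (auto simp: B_def prime_elem_up_iff[of 0, symmetric] intro: prime_imp_prime_elem)
  have nd: "\<not> P dvd Q" if "P \<in># B" "Q \<in># B - {#P#}" for P Q
  proof
    assume "P dvd Q"
    have "B = {#P#} + ({#Q#} + (B - {#P#} - {#Q#}))"
      using that by (metis add_mset_add_single insert_DiffM union_commute)
    then have "prod_mset B = P * (Q * prod_mset (B - {#P#} - {#Q#}))"
      by (metis prod_mset.union prod_mset_singleton)
    then have "P ^ 2 dvd prod_mset B"
      using \<open>P dvd Q\<close> by (simp add: power2_eq_square mult_dvd_mono)
    then have "P ^ 2 dvd F" by (simp add: F)
    then have "P dvd 1" using assms by (simp add: squarefree_def)
    then show False using pr[OF that(1)] by (simp add: prime_elem_def)
  qed
  have "count B P \<le> 1" for P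
  proof (rule ccontr)
    assume "\<not> count B P \<le> 1"
    then have "P \<in># B" "P \<in># B - {#P#}"
      by (auto simp: count_greater_zero_iff[symmetric] simp del: count_greater_zero_iff)
    from nd[OF this] show False by simp
  qed
  then have "B = mset_set (set_mset B)"
    by (intro multiset_eqI) (metis count_greater_zero_iff count_mset_set(1,3) finite_set_mset
        le_less_Suc_eq One_nat_def le_antisym not_in_iff Suc_leI)
  then have "prod_mset B = \<Prod>(set_mset B)"
    by (metis prod_unfold_prod_mset image_mset_id id_apply multiset.map_ident)
  moreover have "P = Q" if "P \<in># B" "Q \<in># B" "P dvd Q" for P Q
  proof (rule ccontr)
    assume "P \<noteq> Q"
    then have "Q \<in># B - {#P#}" using that(2) by (metis insert_DiffM2 insert_noteq_member that(1) add_mset_add_single)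
    then show False using nd that by blast
  qed
  moreover have "down 0 u dvd 1"
    using down.dvd[OF u(1), of 0] by simp
  ultimately show ?thesis
    using F pr by (intro that[of "down 0 u" "set_mset B"]) auto
qed

text \<open>A substitute for the resultant that avoids fractions. By pseudo-division, a nonzero
  element \<open>D\<close> of least degree in the ideal \<open>(A, B)\<close> divides
  \<open>A\<close> and \<open>B\<close> up to factors from the coefficient ring. Then the prime
  \<open>A\<close> divides \<open>D\<close> or the cofactor of \<open>D\<close>. In the first case
  \<open>A\<close> divides a constant and has degree zero, in the second \<open>D\<close> does; by
  the choice of \<open>D\<close> its degree is zero in both.\<close>

lemma elimination_poly:
  fixes A B :: "'a::idom poly"
  assumes A: "prime_elem A" and nd: "\<not> A dvd B"
  obtains U V r where "U * A + V * B = [:r:]" "r \<noteq> 0"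
proof -
  define J where "J = {D. D \<noteq> 0 \<and> (\<exists>U V. D = U * A + V * B)}"
  have "A = 1 * A + 0 * B" "A \<noteq> 0" using A by auto
  then have AJ: "A \<in> J" unfolding J_def by blast
  have "B \<noteq> 0" using nd by auto
  moreover have "B = 0 * A + 1 * B" by simp
  ultimately have BJ: "B \<in> J" unfolding J_def by blast
  define D where "D = arg_min degree (\<lambda>D. D \<in> J)"
  have D: "D \<in> J" and min: "\<And>E. E \<in> J \<Longrightarrow> degree D \<le> degree E"
    unfolding D_def using AJ arg_min_nat_lemma[of "\<lambda>D. D \<in> J" A degree] by auto
  obtain U V where UV: "D = U * A + V * B" "D \<noteq> 0" using D by (auto simp: J_def)
  have red: "\<exists>l Q. l \<noteq> 0 \<and> [:l:] * E = D * Q" if EJ: "E \<in> J" for E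
  proof -
    obtain Q R where qr: "pseudo_divmod E D = (Q, R)" by force
    define l where "l = coeff D (degree D) ^ (Suc (degree E) - degree D)"
    have l: "l \<noteq> 0" using UV(2) by (simp add: l_def)
    from pseudo_divmod[OF UV(2) qr] have e: "smult l E = D * Q + R" and R: "R = 0 \<or> degree R < degree D"
      by (simp_all add: l_def)
    obtain U' V' where E: "E = U' * A + V' * B" using EJ unfolding J_def by blast
    have "R = [:l:] * E - D * Q" using e by simp
    also have "\<dots> = ([:l:] * U' - Q * U) * A + ([:l:] * V' - Q * V) * B"
      by (simp add: E UV(1) algebra_simps)
    finally have "R \<noteq> 0 \<Longrightarrow> R \<in> J" by (auto simp: J_def)
    then have "R = 0" using R min[of R] by fastforce
    then show ?thesis using e l by (intro exI[of _ l] exI[of _ Q]) simp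
  qed
  have "degree D = 0"
  proof (rule ccontr)
    assume dD: "degree D \<noteq> 0"
    obtain l Q where l: "l \<noteq> 0" "[:l:] * A = D * Q" using red[OF AJ] by blast
    obtain l' Q' where l': "l' \<noteq> 0" "[:l':] * B = D * Q'" using red[OF BJ] by blast
    have "A dvd D * Q" using l(2) by (metis dvd_triv_right)
    then consider "A dvd D" | "A dvd Q" using A by (auto simp: prime_elem_dvd_mult_iff)
    then show False
    proof cases
      case 1
      then have "A dvd [:l':] * B" unfolding l'(2) by simp
      then have "A dvd [:l':]" using A nd by (metis prime_elem_dvd_mult_iff)
      then have "degree A \<le> degree [:l':]" using l'(1) by (intro dvd_imp_degree_le) auto
      then show False using min[OF AJ] dD by simp
    next
      case 2
      then obtain Q1 where "Q = A * Q1" by (elim dvdE)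
      then have "A * [:l:] = A * (D * Q1)" using l(2) by (simp add: mult_ac)
      then have "[:l:] = D * Q1" using A by (metis mult_left_cancel prime_elem_def)
      then have "degree D \<le> degree [:l:]" using l(1) by (intro dvd_imp_degree_le) auto
      then show False using dD by simp
    qed
  qed
  then obtain r where "D = [:r:]" by (metis degree_eq_zeroE)
  then show ?thesis using UV that by auto
qed

lemma elimination:
  assumes "prime_elem P" "\<not> P dvd H"
  obtains U V r where "U * P + V * H = down2 i r" "r \<noteq> 0"
proof -
  have "prime_elem (up i P)" "\<not> up i P dvd up i H"
    using assms by (simp_all add: prime_elem_up_iff up_dvd_iff)
  then obtain U V r where r: "U * up i P + V * up i H = [:r:]" "r \<noteq> 0"
    by (rule elimination_poly)
  have "down i U * P + down i V * H = down2 i r"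
    using arg_cong[OF r(1), of "down i"] by (simp add: down.add down.mult)
  then show ?thesis using r(2) that by blast
qed

lemma down2_expand:
  assumes "degree r < N" "\<And>a. degree (coeff r a) < N"
  shows "down2 i r = (\<Sum>a<N. \<Sum>b<N. Const (coeff (coeff r a) b) * X (i + 1) ^ a * X (i + 2) ^ b)"
proof -
  have p: "poly p x = (\<Sum>a<N. coeff p a * x ^ a)" if "degree p < N" for p :: "S poly" and x
    unfolding poly_altdef
    by (rule sum.mono_neutral_left) (use that in \<open>auto simp: coeff_eq_0\<close>)
  have d1: "degree (map_poly Const s) < N" if "degree s < N" for s
    using that Const.degree_map_le[of s] by linarith
  have d2: "degree (map_poly (down1 i) r) < N"
    using assms(1) down1.degree_map_le[of i r] by linarith
  show ?thesis
    unfolding down2_def p[OF d2]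
    by (rule sum.cong) (simp_all add: down1_def p[OF d1[OF assms(2)]] sum_distrib_left sum_distrib_right mult_ac)
qed

lemma degree_coeff_bound:
  fixes r :: "'a::zero poly poly"
  obtains N where "degree r < N" "\<And>a. degree (coeff r a) < N" "M < (N::nat)"
proof
  define N where "N = Suc (degree r + M + (\<Sum>a\<le>degree r. degree (coeff r a)))"
  show "degree r < N" "M < N" by (simp_all add: N_def)
  show "degree (coeff r a) < N" for a
  proof (cases "a \<le> degree r")
    case True
    then have "degree (coeff r a) \<le> (\<Sum>a\<le>degree r. degree (coeff r a))"
      by (intro member_le_sum) auto
    then show ?thesis by (simp add: N_def)
  qed (simp add: coeff_eq_0 N_def)
qed

lemma hci_down2:
  "hci (int e) (down2 i r) = (\<Sum>l\<le>e. Const (coeff (coeff r l) (e - l)) * X (i + 1) ^ l * X (i + 2) ^ (e - l))"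
proof -
  obtain N where N: "degree r < N" "\<And>a. degree (coeff r a) < N" "e < N"
    using degree_coeff_bound[of r e] by blast
  let ?t = "\<lambda>a b. Const (coeff (coeff r a) b) * X (i + 1) ^ a * X (i + 2) ^ b"
  have h: "homogeneous (int (a + b)) (?t a b)" for a b
  proof -
    have "homogeneous (0 + int a * 1 + int b * 1) (?t a b)"
      by (intro homogeneous_mult homogeneous_power homogeneous_Const homogeneous_X)
    then show ?thesis by simp
  qed
  have "hci (int e) (down2 i r) = (\<Sum>a<N. \<Sum>b<N. if b = e - a \<and> a \<le> e then ?t a b else 0)"
    unfolding down2_expand[OF N(1,2)] hci_sum hci_homogeneous[OF h]
    by (intro sum.cong) auto
  also have "\<dots> = (\<Sum>a<N. if a \<le> e then ?t a (e - a) else 0)"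
  proof (intro sum.cong refl)
    fix a assume "a \<in> {..<N}"
    show "(\<Sum>b<N. if b = e - a \<and> a \<le> e then ?t a b else 0) = (if a \<le> e then ?t a (e - a) else 0)"
      using N(3) by (cases "a \<le> e") (simp_all cong: if_cong)
  qed
  also have "\<dots> = (\<Sum>l\<le>e. ?t l (e - l))"
    by (rule sum.mono_neutral_cong_right) (use N(3) in auto)
  finally show ?thesis .
qed

lemma pd_power: "pd i (F ^ n) = of_nat n * F ^ (n - 1) * pd i F"
proof (induction n)
  case (Suc n)
  then show ?case by (cases n) (simp_all add: pd_mult algebra_simps)
qed simp

lemma pd_down2 [simp]: "pd i (down2 i r) = 0"
proof -
  obtain N where N: "degree r < N" "\<And>a. degree (coeff r a) < N" "0 < N"
    using degree_coeff_bound[of r 0] by blast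
  show ?thesis
    unfolding down2_expand[OF N(1,2)] by (simp add: pd_sum pd_mult pd_power pd_X)
qed

lemma exists_pd_nonzero:
  assumes "homogeneous k F" "F \<noteq> 0" "k \<noteq> 0"
  obtains i where "pd i F \<noteq> 0"
proof -
  obtain n where n: "k = int n" using assms homogeneous_neg by (metis nat_0_le not_less)
  have "of_nat n * F \<noteq> 0"
    using assms n Const.comm_hom_axioms by simp
  then have "(\<Sum>i\<in>UNIV. X i * pd i F) \<noteq> 0" using euler[of n F] assms(1) n by simp
  then obtain i where "X i * pd i F \<noteq> 0"
    by (auto elim: sum.not_neutral_contains_not_neutral)
  then show ?thesis using that[of i] by auto
qed

lemma nonvanishing_point:
  fixes N :: "complex poly poly"
  assumes "N \<noteq> 0"
  obtains y z where "poly (poly N [:y:]) z \<noteq> 0"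
proof -
  have "infinite (UNIV :: complex set)" by (rule infinite_UNIV_char_0)
  then have "infinite (range (\<lambda>y::complex. [:y:]))"
    by (subst finite_image_iff) (auto intro: injI)
  moreover have "finite {x. poly N x = 0}" using assms by (rule poly_roots_finite)
  ultimately obtain y where y: "poly N [:y:] \<noteq> 0"
    by (metis (mono_tags, lifting) finite_subset mem_Collect_eq rangeE subsetI)
  have "finite {z. poly (poly N [:y:]) z = 0}" using y by (rule poly_roots_finite)
  then obtain z where "poly (poly N [:y:]) z \<noteq> 0"
    using infinite_UNIV_char_0[where ?'a = complex] by (metis (mono_tags, lifting) UNIV_I finite_subset mem_Collect_eq subsetI)
  then show ?thesis by (rule that)
qed

text \<open>The Nullstellensatz for a hypersurface. If \<open>P\<close> did not divide
  \<open>H\<close>, elimination would give a nonzero \<open>r\<close> in \<open>(P, H)\<close> free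
  of \<open>X i\<close>. Over a point where neither \<open>r\<close> nor the leading coefficient of
  \<open>P\<close> vanishes, \<open>P\<close> has a root; there \<open>H\<close> vanishes, hence
  also \<open>r\<close>.\<close>

lemma vanishing_imp_dvd:
  assumes P: "prime_elem P" "homogeneous k P" "k \<noteq> 0"
    and H: "\<And>v. v \<noteq> 0 \<Longrightarrow> eval P v = 0 \<Longrightarrow> eval H v = 0"
  shows "P dvd H"
proof (rule ccontr)
  assume nd: "\<not> P dvd H"
  \<comment> \<open>The eliminated variable must occur in \<open>P\<close>, so that \<open>P\<close>
    has roots with respect to it.\<close>
  obtain i where i: "pd i P \<noteq> 0" using exists_pd_nonzero[OF P(2)] P by auto
  obtain U V r where r: "U * P + V * H = down2 i r" "r \<noteq> 0"
    using elimination[OF P(1) nd] .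
  define p where "p = up i P"
  have dp: "degree p \<noteq> 0"
  proof
    assume "degree p = 0"
    then obtain s where "p = [:s:]" by (metis degree_eq_zeroE)
    then have "P = down2 i s" by (metis down_up down_simps(5) p_def)
    then show False using i by simp
  qed
  \<comment> \<open>The last factor is the variable \<open>X (i + 1)\<close>. It forces
    \<open>y \<noteq> 0\<close>, so that the root is a nonzero vector.\<close>
  define N where "N = r * lead_coeff p * [:0, 1:]"
  have "N \<noteq> 0" using r(2) dp by (auto simp: N_def)
  then obtain y z where yz: "poly (poly N [:y:]) z \<noteq> 0" by (rule nonvanishing_point)
  define ev where "ev = (\<lambda>s. poly (poly s [:y:]) z)"
  have hev: "comm_hom ev" unfolding ev_def by unfold_locales auto
  interpret ev: comm_hom ev by (rule hev)
  interpret evm: comm_hom "map_poly ev" by (rule ev.comm_hom_map_poly)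
  have nz: "ev r \<noteq> 0" "ev (lead_coeff p) \<noteq> 0" "y \<noteq> 0"
    using yz by (auto simp: N_def ev_def)
  have "degree (map_poly ev p) = degree p"
    by (rule map_poly_degree_eq) (use nz in auto)
  then have "\<not> constant (poly (map_poly ev p))" using dp by (simp add: constant_degree)
  then obtain x where x: "poly (map_poly ev p) x = 0"
    using Fundamental_Theorem_Algebra.fundamental_theorem_of_algebra by blast
  define v :: "complex^3" where "v = (\<chi> j. if j = i then x else if j = i + 1 then y else z)"
  have evalv: "eval G v = poly (map_poly ev (up i G)) x" for G
  proof -
    have 1: "comm_hom (\<lambda>G. poly (map_poly ev (up i G)) x)"
      by unfold_locales (simp_all add: up.add up.mult evm.add evm.mult)
    show ?thesis
      by (rule S_hom_eqI[OF eval.comm_hom_axioms 1])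
        (auto simp: v_def up_X map_poly_pCons ev_def)
  qed
  have "eval P v = 0" using x by (simp add: evalv p_def)
  moreover have "v $ (i + 1) = y" by (simp add: v_def)
  then have "v \<noteq> 0" using nz(3) by (metis zero_index)
  ultimately have "eval (down2 i r) v = 0"
    using H r(1) by (metis add_0 eval.add eval.mult mult_zero_right)
  moreover have "eval (down2 i r) v = ev r"
    by (metis down_simps(5) evalv up_down map_poly_pCons ev.zero map_poly_0 poly_pCons poly_0 mult_zero_right add_0_right)
  ultimately show False using nz(1) by simp
qed

subsection \<open>Irreducible components\<close>

lemma represents_self: "v \<noteq> 0 \<Longrightarrow> represents v (abs_P2 v)"
  by (simp add: represents_def)

lemma proportional_refl: "v \<noteq> 0 \<Longrightarrow> proportional v v"
  unfolding proportional_def by (auto intro!: exI[of _ 1])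

lemma represents_exists: obtains v where "represents v p"
proof -
  have "proportional (rep_P2 p) (rep_P2 p)"
    by (rule Quotient_rep_reflp[OF Quotient_P2])
  then have "represents (rep_P2 p) p"
    by (simp add: represents_def proportional_def Quotient_abs_rep[OF Quotient_P2])
  then show ?thesis by (rule that)
qed

lemma represents_iff:
  assumes "represents v p"
  shows "represents w p \<longleftrightarrow> (\<exists>c. c \<noteq> 0 \<and> w = c *s v)"
proof -
  have v: "v \<noteq> 0" "abs_P2 v = p" using assms by (auto simp: represents_def)
  have "represents w p \<longleftrightarrow> proportional v w"
    using Quotient_rel[OF Quotient_P2, of v w] v
    by (auto simp: represents_def proportional_refl) (auto simp: proportional_def)
  also have "\<dots> \<longleftrightarrow> (\<exists>c. c \<noteq> 0 \<and> w = c *s v)"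
    using v by (auto simp: proportional_def)
  finally show ?thesis .
qed

lemma vanishes_at_homogeneous:
  assumes "homogeneous k F" "represents v p"
  shows "vanishes_at F p \<longleftrightarrow> eval F v = 0"
  using assms by (auto simp: vanishes_at_def represents_iff[OF assms(2)] eval_homogeneous intro: exI[of _ 1])

lemma curve_points_iff: "p \<in> curve_points F \<longleftrightarrow> vanishes_at F p"
  by (simp add: curve_points_def zero_locus_def)

lemma curve_points_mult:
  assumes "homogeneous k F" "homogeneous l G"
  shows "curve_points (F * G) = curve_points F \<union> curve_points G"
proof (rule set_eqI)
  fix p
  obtain v where v: "represents v p" by (rule represents_exists)
  show "p \<in> curve_points (F * G) \<longleftrightarrow> p \<in> curve_points F \<union> curve_points G"
    using assms homogeneous_mult[OF assms] v
    by (simp add: curve_points_iff vanishes_at_homogeneous[OF _ v] eval.mult)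
qed

lemma curve_points_one: "curve_points 1 = {}"
proof -
  have "\<not> vanishes_at 1 p" for p
    by (rule represents_exists[of p]) (auto simp: vanishes_at_def)
  then show ?thesis by (auto simp: curve_points_iff)
qed

lemma homogeneous_prod:
  assumes "finite A" "\<And>P. P \<in> A \<Longrightarrow> \<exists>k. homogeneous k P"
  shows "\<exists>k. homogeneous k (\<Prod>A)"
  using assms
proof (induction A rule: finite_induct)
  case empty
  then show ?case using homogeneous_Const[of 1] by auto
next
  case (insert P A)
  then obtain k l where "homogeneous k P" "homogeneous l (\<Prod>A)" by blast
  then have "homogeneous (k + l) (P * \<Prod>A)" by (rule homogeneous_mult)
  then show ?case using insert by auto
qed

lemma curve_points_prod:
  assumes "finite A" "\<And>P. P \<in> A \<Longrightarrow> \<exists>k. homogeneous k P"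
  shows "curve_points (\<Prod>A) = (\<Union>P\<in>A. curve_points P)"
  using assms
proof (induction A rule: finite_induct)
  case empty
  then show ?case by (simp add: curve_points_one)
next
  case (insert P A)
  obtain k where k: "homogeneous k P" using insert.prems by blast
  obtain l where l: "homogeneous l (\<Prod>A)" using homogeneous_prod[of A] insert by blast
  show ?case using insert curve_points_mult[OF k l] by simp
qed

lemma zariski_closed_curve_points: "zariski_closed (curve_points F)"
  by (auto simp: zariski_closed_def curve_points_def)

lemma vanishing_on_curve_imp_dvd:
  assumes P: "prime_elem P" "homogeneous k P" "k \<noteq> 0"
    and H: "\<And>p. p \<in> curve_points P \<Longrightarrow> vanishes_at H p"
  shows "P dvd H"
proof (rule vanishing_imp_dvd[OF P])
  fix v :: "complex^3" assume v: "v \<noteq> 0" "eval P v = 0"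
  have r: "represents v (abs_P2 v)" using v by (simp add: represents_self)
  then have "abs_P2 v \<in> curve_points P"
    using P(2) v by (simp add: curve_points_iff vanishes_at_homogeneous)
  from H[OF this] r show "eval H v = 0" by (simp add: vanishes_at_def)
qed

lemma dvd_vanishes_at: "P dvd H \<Longrightarrow> vanishes_at P p \<Longrightarrow> vanishes_at H p"
  by (auto simp: vanishes_at_def dvd_def eval.mult)

text \<open>The Nullstellensatz turns primality into irreducibility: two proper closed subsets
  covering the curve would give \<open>f\<close> and \<open>g\<close> whose product is divisible by
  \<open>P\<close> while neither factor is.\<close>

lemma zariski_irreducible_curve_points:
  assumes P: "prime_elem P" "homogeneous k P" "k \<noteq> 0"
  shows "zariski_irreducible (curve_points P)"
  unfolding zariski_irreducible_def
proof (intro conjI allI impI)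
  show "curve_points P \<noteq> {}"
  proof
    assume "curve_points P = {}"
    then have "P dvd 1" using vanishing_on_curve_imp_dvd[OF P, of 1] by simp
    then show False using P by (simp add: prime_elem_def)
  qed
  fix A B assume AB: "zariski_closed A" "zariski_closed B" "curve_points P \<subseteq> A \<union> B"
  obtain T U where T: "A = zero_locus T" "B = zero_locus U"
    using AB by (auto simp: zariski_closed_def)
  show "curve_points P \<subseteq> A \<or> curve_points P \<subseteq> B"
  proof (rule ccontr)
    assume "\<not> (curve_points P \<subseteq> A \<or> curve_points P \<subseteq> B)"
    then obtain p q f g where pq: "p \<in> curve_points P" "f \<in> T" "\<not> vanishes_at f p"
        "q \<in> curve_points P" "g \<in> U" "\<not> vanishes_at g q"
      by (auto simp: T zero_locus_def)
    have nd: "\<not> P dvd f" "\<not> P dvd g"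
      using pq dvd_vanishes_at by (auto simp: curve_points_iff)
    have "P dvd f * g"
    proof (rule vanishing_on_curve_imp_dvd[OF P])
      fix r assume "r \<in> curve_points P"
      then have "r \<in> A \<or> r \<in> B" using AB by auto
      then have "vanishes_at f r \<or> vanishes_at g r"
        using pq by (auto simp: T zero_locus_def)
      then show "vanishes_at (f * g) r"
        by (meson dvd_vanishes_at dvd_triv_left dvd_triv_right)
    qed
    then show False using P nd by (metis prime_elem_dvd_mult_iff)
  qed
qed

lemma irreducible_subset_finite_union:
  assumes "zariski_irreducible Y" "finite A" "\<And>P. P \<in> A \<Longrightarrow> \<exists>k. homogeneous k P"
    "Y \<subseteq> (\<Union>P\<in>A. curve_points P)"
  shows "\<exists>P\<in>A. Y \<subseteq> curve_points P"
  using assms(2-)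
proof (induction A rule: finite_induct)
  case empty
  then show ?case using assms(1) by (auto simp: zariski_irreducible_def)
next
  case (insert P A)
  have "Y \<subseteq> curve_points P \<union> curve_points (\<Prod>A)"
    using insert.prems(2) curve_points_prod[OF insert.hyps(1)] insert.prems(1) by auto
  then have "Y \<subseteq> curve_points P \<or> Y \<subseteq> curve_points (\<Prod>A)"
    using assms(1) zariski_closed_curve_points unfolding zariski_irreducible_def by blast
  then show ?case
    using insert curve_points_prod[OF insert.hyps(1)] by auto
qed

text \<open>An inclusion between two of the curves means divisibility of their primes, so these
  curves are pairwise incomparable, and every irreducible subset lies in one of them.\<close>

lemma card_irreducible_components:
  assumes PS: "finite PS" "\<And>P. P \<in> PS \<Longrightarrow> prime_elem P"
      "\<And>P. P \<in> PS \<Longrightarrow> \<exists>k. k \<noteq> 0 \<and> homogeneous k P"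
      "\<And>P Q. P \<in> PS \<Longrightarrow> Q \<in> PS \<Longrightarrow> P dvd Q \<Longrightarrow> P = Q"
    and F: "curve_points F = (\<Union>P\<in>PS. curve_points P)"
  shows "card (irreducible_components (curve_points F)) = card PS"
proof -
  have irr: "zariski_irreducible (curve_points P)" if "P \<in> PS" for P
    using zariski_irreducible_curve_points PS(2,3) that by blast
  have sub: "P = Q" if PQ: "P \<in> PS" "Q \<in> PS" "curve_points P \<subseteq> curve_points Q" for P Q
  proof -
    obtain k where k: "k \<noteq> 0" "homogeneous k P" using PS(3)[OF PQ(1)] by blast
    have "vanishes_at Q p" if "p \<in> curve_points P" for p
      using that PQ(3) by (auto simp: curve_points_iff)
    then have "P dvd Q"
      by (rule vanishing_on_curve_imp_dvd[OF PS(2)[OF PQ(1)] k(2,1)])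
    then show ?thesis using PS(4) PQ by simp
  qed
  have fin: "\<exists>P\<in>PS. Y \<subseteq> curve_points P" if "zariski_irreducible Y" "Y \<subseteq> curve_points F" for Y
    using irreducible_subset_finite_union[OF that(1) PS(1)] PS(3) that(2) F by blast
  have "irreducible_components (curve_points F) = curve_points ` PS"
  proof (intro set_eqI iffI)
    fix Z assume "Z \<in> irreducible_components (curve_points F)"
    then have Z: "Z \<subseteq> curve_points F" "zariski_irreducible Z"
      "\<And>Y. Y \<subseteq> curve_points F \<Longrightarrow> zariski_irreducible Y \<Longrightarrow> Z \<subseteq> Y \<Longrightarrow> Y = Z"
      by (auto simp: irreducible_components_def)
    obtain P where P: "P \<in> PS" "Z \<subseteq> curve_points P" using fin Z by blast
    then have "curve_points P = Z" using Z(3)[of "curve_points P"] irr F by blast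
    then show "Z \<in> curve_points ` PS" using P by blast
  next
    fix Z assume "Z \<in> curve_points ` PS"
    then obtain P where P: "P \<in> PS" "Z = curve_points P" by blast
    have "Y = Z" if Y: "Y \<subseteq> curve_points F" "zariski_irreducible Y" "Z \<subseteq> Y" for Y
    proof -
      obtain Q where Q: "Q \<in> PS" "Y \<subseteq> curve_points Q" using fin Y by blast
      then have "P = Q" using sub[of P Q] P Y by blast
      then show ?thesis using P Q Y by blast
    qed
    then show "Z \<in> irreducible_components (curve_points F)"
      using P irr F by (auto simp: irreducible_components_def)
  qed
  moreover have "inj_on curve_points PS"
    using sub by (auto simp: inj_on_def)
  ultimately show ?thesis by (simp add: card_image)
qed

subsection \<open>Nodes and cusps\<close>

lemma bounded_linear_axis: "bounded_linear (axis i :: complex \<Rightarrow> complex^'n)"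
  unfolding linear_conv_bounded_linear[symmetric]
  by (rule linearI) (simp_all add: axis_def vec_eq_iff)

lemma bounded_linear_smult_vec: "bounded_linear (\<lambda>s::complex. s *s (h :: complex^'n))"
  unfolding linear_conv_bounded_linear[symmetric]
  by (rule linearI) (simp_all add: vec_eq_iff algebra_simps)

lemma has_derivative_vec:
  fixes f :: "'a::real_normed_vector \<Rightarrow> complex^'n"
  assumes "\<And>i. ((\<lambda>x. f x $ i) has_derivative (\<lambda>h. f' h $ i)) (at a)"
  shows "(f has_derivative f') (at a)"
proof -
  have e: "v = (\<Sum>i\<in>UNIV. axis i (v $ i))" for v :: "complex^'n"
    by (simp add: vec_eq_iff axis_def if_distrib cong: if_cong)
  have "((\<lambda>x. \<Sum>i\<in>UNIV. axis i (f x $ i)) has_derivative (\<lambda>h. \<Sum>i\<in>UNIV. axis i (f' h $ i))) (at a)"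
    by (intro has_derivative_sum bounded_linear.has_derivative[OF bounded_linear_axis] assms)
  then show ?thesis by (simp add: e[symmetric])
qed

lemma holomorphic_map_derivative:
  fixes \<phi> :: "complex^'n \<Rightarrow> complex^'m"
  assumes "holomorphic_map \<phi> U" "w \<in> U"
  obtains L :: "complex^'n^'m" where "(\<phi> has_derivative (\<lambda>h. L *v h)) (at w)"
proof -
  have "\<forall>k. \<exists>a :: complex^'n. ((\<lambda>z. \<phi> z $ k) has_derivative (\<lambda>h. \<Sum>i\<in>UNIV. a $ i * h $ i)) (at w)"
    using assms by (auto simp: holomorphic_map_def holomorphic_fun_def)
  then obtain a :: "'m \<Rightarrow> complex^'n"
    where "\<And>k. ((\<lambda>z. \<phi> z $ k) has_derivative (\<lambda>h. \<Sum>i\<in>UNIV. a k $ i * h $ i)) (at w)" by metis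
  then have "(\<phi> has_derivative (\<lambda>h. (\<chi> k. a k) *v h)) (at w)"
    by (intro has_derivative_vec) (simp add: matrix_vector_mult_def)
  then show ?thesis by (rule that)
qed

text \<open>By the chain rule the derivative of the inverse map is a left inverse of
  \<open>L\<close>.\<close>

lemma biholomorphic_derivative:
  fixes \<phi> :: "complex^'n \<Rightarrow> complex^'n"
  assumes "biholomorphic \<phi> U V" "w \<in> U"
  obtains L where "(\<phi> has_derivative (\<lambda>h. L *v h)) (at w)" "\<And>h. L *v h = 0 \<Longrightarrow> h = 0"
proof -
  let ?\<psi> = "inv_into U \<phi>"
  have b: "bij_betw \<phi> U V" "holomorphic_map \<phi> U" "holomorphic_map ?\<psi> V" "open U"
    using assms by (auto simp: biholomorphic_def holomorphic_map_def holomorphic_fun_def)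
  obtain L where L: "(\<phi> has_derivative (\<lambda>h. L *v h)) (at w)"
    using holomorphic_map_derivative[OF b(2) assms(2)] .
  have "\<phi> w \<in> V" using b assms by (auto simp: bij_betw_def)
  then obtain M where M: "(?\<psi> has_derivative (\<lambda>h. M *v h)) (at (\<phi> w))"
    using holomorphic_map_derivative[OF b(3)] by blast
  have "((\<lambda>z. ?\<psi> (\<phi> z)) has_derivative (\<lambda>h. M *v (L *v h))) (at w)"
    by (rule has_derivative_compose[OF L M])
  then have "((\<lambda>z. z) has_derivative (\<lambda>h. M *v (L *v h))) (at w)"
    by (rule has_derivative_transform_within_open[OF _ b(4) assms(2)])
      (use b in \<open>auto simp: bij_betw_def inv_into_f_f\<close>)
  then have "(\<lambda>h. M *v (L *v h)) = (\<lambda>h. h)"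
    using has_derivative_unique has_derivative_ident by blast
  then have "M *v (L *v h) = h" for h by meson
  then have "\<And>h. L *v h = 0 \<Longrightarrow> h = 0" by (metis matrix_vector_mult_0_right)
  with L show ?thesis by (rule that)
qed

lemma directional_quotient:
  fixes f :: "complex^'n \<Rightarrow> complex"
  assumes "(f has_derivative f') (at w)" "f w = 0" "\<And>s. f' (s *s h) = s * f' h"
  shows "((\<lambda>t. f (w + t *s h) / t) \<longlongrightarrow> f' h) (at 0)"
proof -
  have 1: "((\<lambda>t. w + t *s h) has_derivative (\<lambda>s. s *s h)) (at 0)"
    using has_derivative_add[OF has_derivative_const[of w] bounded_linear_imp_has_derivative[OF bounded_linear_smult_vec[of h]]]
    by simp
  have "((\<lambda>t. f (w + t *s h)) has_derivative (\<lambda>s. f' (s *s h))) (at 0)"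
    by (rule has_derivative_compose[OF 1]) (use assms in simp)
  then have "((\<lambda>t. f (w + t *s h)) has_field_derivative f' h) (at 0)"
    by (simp add: has_field_derivative_def assms(3) mult.commute[of _ "f' h"])
  then show ?thesis by (simp add: has_field_derivative_iff assms(2))
qed

text \<open>The linear part of the affine map \<open>chart i\<close>, which sends tangent vectors of
  the chart to directions in the cone.\<close>

definition emb :: "3 \<Rightarrow> complex^2 \<Rightarrow> complex^3" where
  "emb i h = (\<chi> j. if j = i then 0 else if j = i + 1 then h $ 1 else h $ 2)"

lemma emb_add: "emb i (h + h') = emb i h + emb i h'"
  by (simp add: emb_def vec_eq_iff)

lemma chart_line: "eval F (chart i (w + t *s h)) = poly (line (chart i w) (emb i h) F) t"
proof -
  have "chart i (w + t *s h) = chart i w + t *s emb i h"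
    by (simp add: vec_eq_iff chart_def emb_def)
  then show ?thesis by (simp add: poly_line)
qed

text \<open>Multiplying the limit by \<open>t\<^sup>2\<close> and then by \<open>t\<close> forces
  the first two coefficients to vanish, after which the quotient is itself a polynomial.\<close>

lemma poly_quadratic_limit:
  fixes q :: "complex poly"
  assumes "((\<lambda>t. poly q t / t\<^sup>2) \<longlongrightarrow> L) (at 0)"
  shows "coeff q 0 = 0 \<and> coeff q 1 = 0 \<and> coeff q 2 = L"
proof -
  obtain a b c r where q: "q = pCons a (pCons b (pCons c r))"
    by (metis pCons_cases)
  have id: "((\<lambda>t::complex. t) \<longlongrightarrow> 0) (at 0)" by (rule tendsto_ident_at)
  have pc: "((\<lambda>t. poly s t) \<longlongrightarrow> coeff s 0) (at 0)" for s :: "complex poly"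
    using poly_isCont[of 0 s] unfolding isCont_def poly_0_coeff_0 .
  have ev: "\<forall>\<^sub>F t in at 0. t \<noteq> (0::complex)" by (simp add: eventually_at_filter)
  have "((\<lambda>t. poly q t / t\<^sup>2 * t\<^sup>2) \<longlongrightarrow> L * 0\<^sup>2) (at 0)"
    by (intro tendsto_mult assms tendsto_power id)
  moreover have "\<forall>\<^sub>F t in at 0. poly q t / t\<^sup>2 * t\<^sup>2 = poly q t"
    by (rule eventually_mono[OF ev]) simp
  ultimately have "((\<lambda>t. poly q t) \<longlongrightarrow> L * 0\<^sup>2) (at 0)"
    by (rule Lim_transform_eventually)
  with pc[of q] have a: "a = 0" using tendsto_unique[OF at_neq_bot] q by fastforce
  have "((\<lambda>t. poly q t / t\<^sup>2 * t) \<longlongrightarrow> L * 0) (at 0)"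
    by (intro tendsto_mult assms id)
  moreover have "\<forall>\<^sub>F t in at 0. poly q t / t\<^sup>2 * t = poly (pCons b (pCons c r)) t"
    by (rule eventually_mono[OF ev]) (simp add: q a power2_eq_square field_simps)
  ultimately have "((\<lambda>t. poly (pCons b (pCons c r)) t) \<longlongrightarrow> L * 0) (at 0)"
    by (rule Lim_transform_eventually)
  with pc[of "pCons b (pCons c r)"] have b: "b = 0" using tendsto_unique[OF at_neq_bot] by fastforce
  have "\<forall>\<^sub>F t in at 0. poly q t / t\<^sup>2 = poly (pCons c r) t"
    by (rule eventually_mono[OF ev]) (simp add: q a b power2_eq_square)
  with assms have "((\<lambda>t. poly (pCons c r) t) \<longlongrightarrow> L) (at 0)"
    by (rule Lim_transform_eventually)
  with pc[of "pCons c r"] have c: "c = L" using tendsto_unique[OF at_neq_bot] by fastforce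
  show ?thesis by (simp add: q a b c numeral_2_eq_2)
qed

text \<open>The proof works with first derivatives of \<open>\<phi>\<close> alone, so the quadratic
  part of \<open>F\<close> is read off a limit: on a line \<open>F\<close> is a polynomial in
  \<open>t\<close>, and its quotient by \<open>t\<^sup>2\<close> tends to
  \<open>u w * L\<close>.\<close>

lemma second_order:
  assumes f: "\<And>z. z \<in> U \<Longrightarrow> eval F (chart i z) = u z * g (\<phi> z)" and w: "w \<in> U"
    and u: "holomorphic_fun u U" and lim: "((\<lambda>t. g (\<phi> (w + t *s h)) / t\<^sup>2) \<longlongrightarrow> L) (at 0)"
  shows "eval F (chart i w) = 0" "grad F (chart i w) (emb i h) = 0"
    "coeff (line (chart i w) (emb i h) F) 2 = u w * L"
proof -
  have U: "open U" using u by (simp add: holomorphic_fun_def)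
  have "((\<lambda>t. w + t *s h) \<longlongrightarrow> w + 0 *s h) (at 0)"
    by (intro tendsto_add tendsto_const bounded_linear.tendsto[OF bounded_linear_smult_vec] tendsto_ident_at)
  then have l: "((\<lambda>t. w + t *s h) \<longlongrightarrow> w) (at 0)" by simp
  obtain a :: "complex^2" where "(u has_derivative (\<lambda>h. \<Sum>i\<in>UNIV. a $ i * h $ i)) (at w)"
    using u w unfolding holomorphic_fun_def by blast
  then have "isCont u w" by (rule has_derivative_continuous)
  then have "((\<lambda>t. u (w + t *s h)) \<longlongrightarrow> u w) (at 0)"
    using l isCont_tendsto_compose by blast
  then have "((\<lambda>t. u (w + t *s h) * (g (\<phi> (w + t *s h)) / t\<^sup>2)) \<longlongrightarrow> u w * L) (at 0)"
    by (intro tendsto_mult lim)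
  moreover have "\<forall>\<^sub>F t in at 0. u (w + t *s h) * (g (\<phi> (w + t *s h)) / t\<^sup>2)
      = poly (line (chart i w) (emb i h) F) t / t\<^sup>2"
    using topological_tendstoD[OF l U w] by (rule eventually_mono) (simp add: chart_line[symmetric] f)
  ultimately have "((\<lambda>t. poly (line (chart i w) (emb i h) F) t / t\<^sup>2) \<longlongrightarrow> u w * L) (at 0)"
    by (rule Lim_transform_eventually)
  from poly_quadratic_limit[OF this]
  show "eval F (chart i w) = 0" "grad F (chart i w) (emb i h) = 0"
    "coeff (line (chart i w) (emb i h) F) 2 = u w * L"
    by (auto simp: coeff_line_0 coeff_line_1 simp del: One_nat_def)
qed

lemma matrix_directional_quotient:
  fixes \<phi> :: "complex^'n \<Rightarrow> complex^'n"
  assumes "(\<phi> has_derivative (\<lambda>h. L *v h)) (at w)" "\<phi> w = 0"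
  shows "((\<lambda>t. \<phi> (w + t *s h) $ k / t) \<longlongrightarrow> (L *v h) $ k) (at 0)"
proof (rule directional_quotient)
  show "((\<lambda>z. \<phi> z $ k) has_derivative (\<lambda>h. (L *v h) $ k)) (at w)"
    by (rule bounded_linear.has_derivative[OF bounded_linear_vec_nth assms(1)])
qed (simp_all add: assms(2) vector_scalar_commute)

text \<open>
  Two isotropic directions that are not orthogonal: this excludes that the Hessian has rank at most
  one, and it holds with the tangents of the branches of a node.
\<close>

definition nondegenerate :: "S \<Rightarrow> complex^3 \<Rightarrow> bool" where
  "nondegenerate F v \<longleftrightarrow> (\<exists>\<eta> \<zeta>. hess F v \<eta> \<eta> = 0 \<and> hess F v \<zeta> \<zeta> = 0 \<and> hess F v \<eta> \<zeta> \<noteq> 0)"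

text \<open>The directions of the chart give two of the partial derivatives. The \<open>i\<close>-th
  follows from Euler's formula, since the \<open>i\<close>-th coordinate of the point is
  \<open>1\<close>.\<close>

lemma grad_chart_zero:
  assumes "homogeneous k F" "eval F (chart i w) = 0" "\<And>h. grad F (chart i w) (emb i h) = 0"
  shows "eval (pd j F) (chart i w) = 0"
proof -
  let ?v = "chart i w"
  have g: "grad F ?v \<eta> = eval (pd i F) ?v * \<eta> $ i + eval (pd (i + 1) F) ?v * \<eta> $ (i + 1)
      + eval (pd (i + 2) F) ?v * \<eta> $ (i + 2)" for \<eta>
    unfolding grad_def by (rule sum_index3)
  have 1: "eval (pd (i + 1) F) ?v = 0"
    using assms(3)[of "\<chi> k. if k = 1 then 1 else 0"] by (simp add: g emb_def)
  have 2: "eval (pd (i + 2) F) ?v = 0"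
    using assms(3)[of "\<chi> k. if k = 1 then 0 else 1"] by (simp add: g emb_def)
  have "eval (pd i F) ?v = 0"
  proof (cases "k < 0")
    case True
    then show ?thesis using assms(1) homogeneous_neg[of k F] by simp
  next
    case False
    then obtain n where "k = int n" by (metis nat_0_le not_less)
    then have "(\<Sum>l\<in>UNIV. X l * pd l F) = of_nat n * F" using euler assms(1) by simp
    then have "eval (\<Sum>l\<in>UNIV. X l * pd l F) ?v = 0"
      by (simp add: eval.mult assms(2))
    moreover have "?v $ i = 1" by (simp add: chart_def)
    ultimately show ?thesis
      by (simp add: sum_index3[of _ i] eval.add eval.mult 1 2)
  qed
  then show ?thesis using 1 2 index3_exhaust[of j i] by auto
qed

lemma node_at_coordinates:
  assumes F: "homogeneous k F" and p: "node_at F p" and v: "represents v p"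
  shows "eval F v = 0" "eval (pd j F) v = 0" "nondegenerate F v"
proof -
  obtain i w U V \<phi> u where w: "represents (chart i w) p"
    and b: "w \<in> U" "biholomorphic \<phi> U V" "\<phi> w = 0" "holomorphic_fun u U" "\<And>z. z \<in> U \<Longrightarrow> u z \<noteq> 0"
    and f: "\<And>z. z \<in> U \<Longrightarrow> eval F (chart i z) = u z * (\<phi> z $ 1 * \<phi> z $ 2)"
    using p unfolding node_at_def has_singularity_type_def analytically_equivalent_def by blast
  obtain L where L: "(\<phi> has_derivative (\<lambda>h. L *v h)) (at w)" "\<And>h. L *v h = 0 \<Longrightarrow> h = 0"
    using biholomorphic_derivative[OF b(2,1)] by blast
  let ?c = "chart i w"
  have "((\<lambda>t. \<phi> (w + t *s h) $ 1 / t * (\<phi> (w + t *s h) $ 2 / t)) \<longlongrightarrow> (L *v h) $ 1 * (L *v h) $ 2) (at 0)" for h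
    by (intro tendsto_mult matrix_directional_quotient L(1) b(3))
  then have lim: "((\<lambda>t. (\<phi> (w + t *s h) $ 1 * \<phi> (w + t *s h) $ 2) / t\<^sup>2) \<longlongrightarrow> (L *v h) $ 1 * (L *v h) $ 2) (at 0)" for h
    by (simp add: power2_eq_square)
  note so = second_order[of U F i u "\<lambda>x. x $ 1 * x $ 2" \<phi> w, OF f b(1,4) lim]
  have e: "eval F ?c = 0" by (rule so(1))
  have gz: "eval (pd j F) ?c = 0" for j
    by (rule grad_chart_zero[OF F e so(2)])
  have H: "hess F ?c (emb i h) (emb i h) = 2 * (u w * ((L *v h) $ 1 * (L *v h) $ 2))" for h
    using so(3)[of h] coeff_line_2[of ?c "emb i h" F] by simp
  \<comment> \<open>In dimension two each row of \<open>L\<close> kills a nonzero vector. The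
    vectors killed by the two rows are the tangents of the two branches.\<close>
  have ex: "\<exists>h. h \<noteq> 0 \<and> (L *v h) $ k = 0" for k
  proof (cases "L $ k = 0")
    case True
    then show ?thesis
      by (intro exI[of _ "axis 1 1"]) (simp add: matrix_vector_mult_def axis_eq_0_iff)
  next
    case False
    then show ?thesis
      by (intro exI[of _ "\<chi> j. if j = 1 then - L $ k $ 2 else L $ k $ 1"])
        (auto simp: matrix_vector_mult_def sum_2 vec_eq_iff forall_2)
  qed
  obtain h1 where h1: "h1 \<noteq> 0" "(L *v h1) $ 1 = 0" using ex by blast
  obtain h2 where h2: "h2 \<noteq> 0" "(L *v h2) $ 2 = 0" using ex by blast
  have nz: "(L *v h1) $ 2 \<noteq> 0" "(L *v h2) $ 1 \<noteq> 0"
    using L(2)[of h1] L(2)[of h2] h1 h2 by (auto simp: vec_eq_iff forall_2)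
  let ?\<eta> = "emb i h1" and ?\<zeta> = "emb i h2"
  have H1: "hess F ?c ?\<eta> ?\<eta> = 0" "hess F ?c ?\<zeta> ?\<zeta> = 0"
    by (simp_all add: H h1 h2)
  \<comment> \<open>Polarization recovers the mixed value from the quadratic form at the
    sum.\<close>
  have "hess F ?c (?\<eta> + ?\<zeta>) (?\<eta> + ?\<zeta>) = 2 * (u w * ((L *v h2) $ 1 * (L *v h1) $ 2))"
    unfolding emb_add[symmetric] H by (simp add: matrix_vector_right_distrib h1 h2)
  also have "\<dots> \<noteq> 0" using nz b(1,5) by simp
  finally have "2 * hess F ?c ?\<eta> ?\<zeta> \<noteq> 0"
    by (simp add: hess_add_left hess_add_right H1 hess_sym[of F ?c ?\<zeta> ?\<eta>])
  then have H2: "hess F ?c ?\<eta> ?\<zeta> \<noteq> 0" by simp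
  obtain c where c: "c \<noteq> 0" "v = c *s ?c" using represents_iff[OF w] v by blast
  show "eval F v = 0" using e by (simp add: c eval_homogeneous[OF F])
  show "eval (pd j F) v = 0" using gz by (simp add: c eval_homogeneous[OF homogeneous_pd[OF F]])
  \<comment> \<open>Second partial derivatives are homogeneous of degree \<open>k - 2\<close>, so
    other coordinates of the same point only scale the Hessian by a nonzero number.\<close>
  have "hess F v \<eta> \<zeta> = c powi (k - 1 - 1) * hess F ?c \<eta> \<zeta>" for \<eta> \<zeta>
    unfolding hess_def c(2)
    by (simp add: eval_homogeneous[OF homogeneous_pd[OF homogeneous_pd[OF F]] c(1)] sum_distrib_left mult_ac)
  moreover have "c powi (k - 1 - 1) \<noteq> 0" using c(1) by simp
  ultimately show "nondegenerate F v"
    unfolding nondegenerate_def using H1 H2 by (intro exI[of _ ?\<eta>] exI[of _ ?\<zeta>]) simp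
qed

section \<open>Smooth branches and cusps\<close>

lemma emb_smult: "emb i (s *s h) = s *s emb i h"
  by (simp add: emb_def vec_eq_iff)

lemma has_derivative_chart: "(chart i has_derivative emb i) (at x)"
proof (rule has_derivative_vec)
  fix j
  have c: "((\<lambda>x. x $ k) has_derivative (\<lambda>h. h $ k)) (at x)" for k and x :: "complex^2"
    by (rule bounded_linear_imp_has_derivative) (rule bounded_linear_vec_nth)
  show "((\<lambda>x. chart i x $ j) has_derivative (\<lambda>h. emb i h $ j)) (at x)"
    using c[of 1] c[of 2] index3_exhaust[of j i] by (auto simp: chart_def emb_def)
qed

lemma isCont_eval_chart: "isCont (\<lambda>x. eval F (chart i x)) x"
  by (rule has_derivative_continuous)
    (rule has_derivative_compose[OF has_derivative_chart has_derivative_eval])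

lemma holomorphic_eval_chart:
  assumes "\<And>t. t \<in> T \<Longrightarrow> (z has_derivative (\<lambda>s. s *s d t)) (at t)" "open T"
  shows "(\<lambda>t. eval F (chart i (z t))) holomorphic_on T"
proof (rule holomorphic_onI)
  fix t assume "t \<in> T"
  note has_derivative_compose[OF has_derivative_compose[OF assms(1)[OF this] has_derivative_chart] has_derivative_eval, of F i]
  then have "((\<lambda>t. eval F (chart i (z t))) has_field_derivative grad F (chart i (z t)) (emb i (d t))) (at t)"
    unfolding has_field_derivative_def
    by (rule has_derivative_eq_rhs) (simp add: emb_smult fun_eq_iff grad_def sum_distrib_left sum_distrib_right mult_ac)
  then show "(\<lambda>t. eval F (chart i (z t))) field_differentiable at t within T"
    by (meson field_differentiable_at_within field_differentiable_def)
qed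

text \<open>Near \<open>w\<close> a curve with nonzero differential is a graph over one coordinate,
  so this coordinate is injective along \<open>z\<close> for small \<open>t\<close>. An injective
  holomorphic function of one variable has nonzero derivative, which contradicts
  \<open>d 0 = 0\<close>.\<close>

lemma smooth_branch_no_cusp:
  fixes z :: "complex \<Rightarrow> complex^2"
  assumes A: "grad A (chart i w) (emb i h) \<noteq> 0" and r: "r > 0"
    and z: "\<And>t. t \<in> ball 0 r \<Longrightarrow> (z has_derivative (\<lambda>s. s *s d t)) (at t)"
    and z0: "z 0 = w" "d 0 = 0" and inj: "inj_on z (ball 0 r)"
    and Az: "\<And>t. t \<in> ball 0 r \<Longrightarrow> eval A (chart i (z t)) = 0"
  shows False
proof -
  define e :: "2 \<Rightarrow> 3" where "e = (\<lambda>k. if k = 1 then i + 1 else i + 2)"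
  define E where "E = (\<lambda>k y. eval (pd (e k) A) (chart i y))"
  have g: "grad A (chart i y) (emb i h) = (\<Sum>k\<in>UNIV. E k y * h $ k)" for y h
    unfolding grad_def sum_index3[of _ i] by (simp add: emb_def E_def e_def sum_2)
  have "\<exists>k. E k w \<noteq> 0"
  proof (rule ccontr)
    assume "\<nexists>k. E k w \<noteq> 0"
    then show False using A unfolding g by simp
  qed
  then obtain k where D: "E k w \<noteq> 0" by blast
  define k' where "k' = k + 1"
  have kk: "j = k \<or> j = k'" for j
    using exhaust_2[of k] exhaust_2[of j] by (auto simp: k'_def)
  have k'k: "k' \<noteq> k" using exhaust_2[of k] by (auto simp: k'_def)
  define D where "D = E k w"
  have "isCont (E k) w" unfolding E_def by (rule isCont_eval_chart)
  then obtain \<delta> where \<delta>: "\<delta> > 0" "\<And>y. dist y w < \<delta> \<Longrightarrow> dist (E k y) D < norm D / 2"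
    using D unfolding continuous_at_eps_delta D_def by (metis half_gt_zero zero_less_norm_iff)
  \<comment> \<open>The graph property over the coordinate \<open>k'\<close>, by the mean value
    inequality: on the segment from \<open>y\<close> to \<open>y'\<close> the derivative of
    \<open>q\<close> differs from \<open>D * \<eta> $ k\<close> by at most half the norm of the
    latter, while \<open>q\<close> vanishes at both ends. Hence
    \<open>\<eta> $ k = 0\<close>.\<close>
  have uniq: "y = y'" if y: "dist y w < \<delta>" "dist y' w < \<delta>" "y $ k' = y' $ k'"
    "eval A (chart i y) = 0" "eval A (chart i y') = 0" for y y'
  proof -
    define \<eta> where "\<eta> = y' - y"
    define q where "q = line (chart i y) (emb i \<eta>) A"
    have q: "poly q t = eval A (chart i (y + t *s \<eta>))" for t
      by (simp add: q_def chart_line)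
    have dq: "poly (pderiv q) t = E k (y + t *s \<eta>) * \<eta> $ k" for t
    proof -
      have "chart i y + t *s emb i \<eta> = chart i (y + t *s \<eta>)"
        by (simp add: vec_eq_iff chart_def emb_def)
      then have "poly (pderiv q) t = grad A (chart i (y + t *s \<eta>)) (emb i \<eta>)"
        by (simp add: q_def pderiv_line poly_sum poly_line grad_def mult.commute)
      also have "\<dots> = (\<Sum>j\<in>UNIV. E j (y + t *s \<eta>) * \<eta> $ j)" by (rule g)
      also have "\<dots> = (\<Sum>j\<in>{k}. E j (y + t *s \<eta>) * \<eta> $ j)"
      proof (rule sum.mono_neutral_right)
        have "\<eta> $ j = 0" if "j \<noteq> k" for j
          using kk[of j] that y(3) by (auto simp: \<eta>_def)
        then show "\<forall>j\<in>UNIV - {k}. E j (y + t *s \<eta>) * \<eta> $ j = 0" by auto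
      qed auto
      finally show ?thesis by simp
    qed
    let ?S = "closed_segment 0 (1::complex)"
    have "norm ((poly q 1 - D * \<eta> $ k * 1) - (poly q 0 - D * \<eta> $ k * 0)) \<le> norm D / 2 * norm (\<eta> $ k) * norm (1 - 0 :: complex)"
    proof (rule field_differentiable_bound[of ?S "\<lambda>t. poly q t - D * \<eta> $ k * t" "\<lambda>t. poly (pderiv q) t - D * \<eta> $ k"])
      fix t :: complex assume "t \<in> ?S"
      then obtain s :: real where s: "0 \<le> s" "s \<le> 1" "t = of_real s"
        by (auto simp: closed_segment_def scaleR_conv_of_real)
      show "((\<lambda>t. poly q t - D * \<eta> $ k * t) has_field_derivative poly (pderiv q) t - D * \<eta> $ k) (at t within ?S)"
        by (auto intro!: derivative_eq_intros poly_DERIV[THEN has_field_derivative_at_within])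
      have "y + t *s \<eta> = (1 - s) *\<^sub>R y + s *\<^sub>R y'"
        by (simp add: \<eta>_def s vec_eq_iff algebra_simps scaleR_conv_of_real[where 'a = complex])
      moreover have "(1 - s) *\<^sub>R y + s *\<^sub>R y' \<in> ball w \<delta>"
        using convex_ball[of w \<delta>] y s by (intro convexD) (auto simp: dist_commute)
      ultimately have "dist (E k (y + t *s \<eta>)) D < norm D / 2"
        using \<delta>(2) by (simp add: dist_commute)
      then have "norm (E k (y + t *s \<eta>) - D) * norm (\<eta> $ k) \<le> norm D / 2 * norm (\<eta> $ k)"
        by (intro mult_right_mono) (auto simp: dist_norm)
      then show "norm (poly (pderiv q) t - D * \<eta> $ k) \<le> norm D / 2 * norm (\<eta> $ k)"
        by (simp add: dq norm_mult[symmetric] left_diff_distrib)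
    qed auto
    moreover have "poly q 1 = 0" "poly q 0 = 0"
      using y by (simp_all add: q \<eta>_def)
    ultimately have "norm D * norm (\<eta> $ k) \<le> norm D * norm (\<eta> $ k) / 2"
      by (simp add: norm_mult)
    then have "\<eta> $ k = 0" using D by (simp add: D_def)
    moreover have "\<eta> $ k' = 0" using y by (simp add: \<eta>_def)
    ultimately have "\<eta> $ j = 0" for j using kk[of j] by auto
    then have "\<eta> = 0" by (simp add: vec_eq_iff)
    then show ?thesis by (simp add: \<eta>_def)
  qed
  have "isCont z 0" using has_derivative_continuous[OF z[of 0]] r by simp
  then obtain r' where r': "r' > 0" "\<And>t. dist t 0 < r' \<Longrightarrow> dist (z t) w < \<delta>"
    unfolding continuous_at_eps_delta z0 using \<delta>(1) by blast
  define T where "T = ball (0::complex) (min r r')"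
  define s where "s = (\<lambda>t. z t $ k')"
  have ds: "(s has_field_derivative d t $ k') (at t)" if "t \<in> T" for t
  proof -
    have "((\<lambda>t. z t $ k') has_derivative (\<lambda>s. (s *s d t) $ k')) (at t)"
      by (rule bounded_linear.has_derivative[OF bounded_linear_vec_nth z]) (use that in \<open>auto simp: T_def\<close>)
    then show ?thesis by (simp add: s_def has_field_derivative_def mult.commute[of _ "d t $ k'"])
  qed
  have "inj_on s T"
  proof (rule inj_onI)
    fix t t' assume t: "t \<in> T" "t' \<in> T" "s t = s t'"
    then have b: "t \<in> ball 0 r" "t' \<in> ball 0 r" by (auto simp: T_def)
    have "z t = z t'"
      by (rule uniq) (use t b Az r' in \<open>auto simp: T_def s_def dist_commute\<close>)
    then show "t = t'" using inj b by (simp add: inj_on_eq_iff)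
  qed
  moreover have "s holomorphic_on T"
    using ds by (metis holomorphic_on_def field_differentiable_def has_field_derivative_at_within)
  ultimately have "deriv s 0 \<noteq> 0"
    by (intro holomorphic_injective_imp_regular) (use r r' in \<open>auto simp: T_def\<close>)
  moreover have "deriv s 0 = 0"
    using DERIV_imp_deriv[OF ds[of 0]] r r' by (simp add: T_def z0)
  ultimately show False by simp
qed

text \<open>
  Both factors have nonzero differential, for their product has the quadratic part of a cusp. One of them
  vanishes along \<open>t \<mapsto> (t\<^sup>2, t\<^sup>3)\<close>, which would be an injective parametrization of a smooth branch with
  derivative zero at the origin.
\<close>

lemma cusp_at_irreducible:
  assumes AB: "homogeneous k A" "homogeneous l B" and p: "cusp_at (A * B) p" and v: "represents v p"
    and v0: "eval A v = 0" "eval B v = 0"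
  shows False
proof -
  obtain i w U V \<phi> u where w: "represents (chart i w) p"
    and b: "w \<in> U" "biholomorphic \<phi> U V" "\<phi> w = 0" "holomorphic_fun u U" "\<And>z. z \<in> U \<Longrightarrow> u z \<noteq> 0"
    and f: "\<And>z. z \<in> U \<Longrightarrow> eval (A * B) (chart i z) = u z * ((\<phi> z $ 2)\<^sup>2 - (\<phi> z $ 1) ^ 3)"
    using p unfolding cusp_at_def has_singularity_type_def analytically_equivalent_def by blast
  obtain L where L: "(\<phi> has_derivative (\<lambda>h. L *v h)) (at w)" "\<And>h. L *v h = 0 \<Longrightarrow> h = 0"
    using biholomorphic_derivative[OF b(2,1)] by blast
  let ?c = "chart i w"
  have e: "eval A ?c = 0" "eval B ?c = 0"
    using vanishes_at_homogeneous[OF AB(1)] vanishes_at_homogeneous[OF AB(2)] v w v0 by blast+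
  \<comment> \<open>The cubic term keeps a spare factor \<open>t\<close> and disappears in the
    limit.\<close>
  have "((\<lambda>t. (\<phi> (w + t *s h) $ 2 / t)\<^sup>2 - t * (\<phi> (w + t *s h) $ 1 / t) ^ 3) \<longlongrightarrow> ((L *v h) $ 2)\<^sup>2 - 0 * ((L *v h) $ 1) ^ 3) (at 0)" for h
    by (intro tendsto_diff tendsto_mult tendsto_power tendsto_ident_at matrix_directional_quotient L(1) b(3))
  moreover have "\<forall>\<^sub>F t in at 0. (\<phi> (w + t *s h) $ 2 / t)\<^sup>2 - t * (\<phi> (w + t *s h) $ 1 / t) ^ 3
      = ((\<phi> (w + t *s h) $ 2)\<^sup>2 - (\<phi> (w + t *s h) $ 1) ^ 3) / t\<^sup>2" for h
    unfolding eventually_at_filter by (simp add: power2_eq_square power3_eq_cube diff_divide_distrib)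
  ultimately have lim: "((\<lambda>t. ((\<phi> (w + t *s h) $ 2)\<^sup>2 - (\<phi> (w + t *s h) $ 1) ^ 3) / t\<^sup>2) \<longlongrightarrow> ((L *v h) $ 2)\<^sup>2 - 0 * ((L *v h) $ 1) ^ 3) (at 0)" for h
    by (rule Lim_transform_eventually)
  note so = second_order[of U "A * B" i u "\<lambda>x. (x $ 2)\<^sup>2 - (x $ 1) ^ 3" \<phi> w, OF f b(1,4) lim]
  have gr: "grad A ?c (emb i h) * grad B ?c (emb i h) = u w * ((L *v h) $ 2)\<^sup>2" for h
  proof -
    have "coeff (line ?c (emb i h) (A * B)) 2 = grad A ?c (emb i h) * grad B ?c (emb i h)"
      by (simp add: line.mult coeff_mult coeff_line_0 coeff_line_1[symmetric] e numeral_2_eq_2)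
    then show ?thesis using so(3)[of h] by simp
  qed
  \<comment> \<open>A nonzero vector killed by the first row of \<open>L\<close> is not killed by
    the second, as \<open>L\<close> is injective.\<close>
  have "\<exists>h. (L *v h) $ 2 \<noteq> 0"
  proof (rule ccontr)
    assume "\<nexists>h. (L *v h) $ 2 \<noteq> 0"
    then have z: "(L *v h) $ 2 = 0" for h by blast
    define h :: "complex^2" where "h = (if L $ 1 = 0 then axis 1 1 else (\<chi> j. if j = 1 then - L $ 1 $ 2 else L $ 1 $ 1))"
    have "(L *v h) $ 1 = 0"
      by (simp add: h_def matrix_vector_mult_def sum_2)
    then have "L *v h = 0" using z[of h] by (simp add: vec_eq_iff forall_2)
    then have "h = 0" by (rule L(2))
    then show False
      by (auto simp: h_def axis_eq_0_iff vec_eq_iff forall_2 split: if_splits)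
  qed
  then obtain h where "(L *v h) $ 2 \<noteq> 0" by blast
  then have "grad A ?c (emb i h) * grad B ?c (emb i h) \<noteq> 0" using gr b(1,5) by simp
  then have gAB: "grad A ?c (emb i h) \<noteq> 0" "grad B ?c (emb i h) \<noteq> 0" by auto
  let ?\<psi> = "inv_into U \<phi>"
  have bij: "bij_betw \<phi> U V" "holomorphic_map ?\<psi> V" "open V"
    using b(2) by (auto simp: biholomorphic_def holomorphic_map_def holomorphic_fun_def)
  define cu :: "complex \<Rightarrow> complex^2" where "cu = (\<lambda>t. \<chi> j. if j = 1 then t\<^sup>2 else t ^ 3)"
  define cu' :: "complex \<Rightarrow> complex^2" where "cu' = (\<lambda>t. \<chi> j. if j = 1 then 2 * t else 3 * t\<^sup>2)"
  have dcu: "(cu has_derivative (\<lambda>s. s *s cu' t)) (at t)" for t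
  proof (rule has_derivative_vec)
    fix j :: 2
    have "((\<lambda>t. t\<^sup>2) has_field_derivative 2 * t) (at t)" "((\<lambda>t. t ^ 3) has_field_derivative 3 * t\<^sup>2) (at t)"
      by (auto intro!: derivative_eq_intros simp: power2_eq_square)
    then show "((\<lambda>x. cu x $ j) has_derivative (\<lambda>h. (h *s cu' t) $ j)) (at t)"
      using exhaust_2[of j] by (auto simp: cu_def cu'_def has_field_derivative_def mult_commute_abs)
  qed
  have "cu 0 = 0" by (simp add: cu_def vec_eq_iff)
  then have "cu 0 \<in> V" using b(1,3) bij(1) by (auto simp: bij_betw_def)
  moreover have "continuous_on UNIV cu"
    by (rule continuous_at_imp_continuous_on) (intro ballI has_derivative_continuous[OF dcu])
  ultimately have "open (cu -` V)" "0 \<in> cu -` V" using bij(3) by (auto intro: open_vimage)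
  then obtain r where r: "r > 0" "ball 0 r \<subseteq> cu -` V" by (auto elim: openE)
  define z where "z = (\<lambda>t. ?\<psi> (cu t))"
  have cuV: "cu t \<in> V" if "t \<in> ball 0 r" for t using r that by auto
  have zU: "z t \<in> U" "\<phi> (z t) = cu t" if "t \<in> ball 0 r" for t
    using cuV[OF that] bij(1) unfolding z_def bij_betw_def by (metis inv_into_into, metis f_inv_into_f)
  have "\<exists>M :: complex^2^2. t \<in> ball 0 r \<longrightarrow> (?\<psi> has_derivative (\<lambda>h. M *v h)) (at (cu t))" for t
    using holomorphic_map_derivative[OF bij(2)] cuV by metis
  then obtain M :: "complex \<Rightarrow> complex^2^2" where
    M: "\<And>t. t \<in> ball 0 r \<Longrightarrow> (?\<psi> has_derivative (\<lambda>h. M t *v h)) (at (cu t))" by metis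
  define d where "d = (\<lambda>t. M t *v cu' t)"
  have dz: "(z has_derivative (\<lambda>s. s *s d t)) (at t)" if "t \<in> ball 0 r" for t
    using has_derivative_compose[OF dcu M[OF that]]
    by (simp add: z_def d_def vector_scalar_commute)
  have z0: "z 0 = w" using b(1,3) bij(1) \<open>cu 0 = 0\<close> by (simp add: z_def bij_betw_def) (metis inv_into_f_f)
  have "cu' 0 = 0" by (simp add: cu'_def vec_eq_iff)
  then have d0: "d 0 = 0" by (simp add: d_def)
  have inj: "inj_on z (ball 0 r)"
  proof (rule inj_onI)
    fix t t' assume t: "t \<in> ball 0 r" "t' \<in> ball 0 r" "z t = z t'"
    then have "cu t = cu t'" using zU(2) by metis
    then have "cu t $ 1 = cu t' $ 1" "cu t $ 2 = cu t' $ 2" by simp_all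
    then have *: "t\<^sup>2 = t'\<^sup>2" "t ^ 3 = t' ^ 3" by (simp_all add: cu_def)
    then have "t\<^sup>2 * t = t\<^sup>2 * t'" by (simp add: power2_eq_square power3_eq_cube)
    then show "t = t'" using * by auto
  qed
  have prod0: "eval A (chart i (z t)) * eval B (chart i (z t)) = 0" if "t \<in> ball 0 r" for t
    using f[OF zU(1)[OF that]] by (simp add: eval.mult zU(2)[OF that] cu_def power_mult[symmetric])
  have hol: "(\<lambda>t. eval G (chart i (z t))) holomorphic_on ball 0 r" for G
    by (rule holomorphic_eval_chart[OF dz]) auto
  have "\<exists>t\<in>ball 0 r. eval A (chart i (z t)) \<noteq> 0"
    using smooth_branch_no_cusp[OF gAB(1) r(1) dz z0 d0 inj] by blast
  then obtain t0 where t0: "t0 \<in> ball 0 r" "eval A (chart i (z t0)) \<noteq> 0" by blast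
  \<comment> \<open>On this nonempty open set \<open>B\<close> vanishes along the branch, so by the
    identity theorem it vanishes along all of it, and the smooth branch argument then applies to
    \<open>B\<close>.\<close>
  define T where "T = {t \<in> ball 0 r. eval A (chart i (z t)) \<noteq> 0}"
  have "open T"
  proof -
    have "open (ball 0 r \<inter> (\<lambda>t. eval A (chart i (z t))) -` (- {0}))"
      by (intro continuous_open_preimage holomorphic_on_imp_continuous_on hol) auto
    then show ?thesis by (simp add: T_def vimage_def Int_def)
  qed
  moreover have "T \<noteq> {}" using t0 by (auto simp: T_def)
  ultimately have "eval B (chart i (z t)) = 0" if "t \<in> ball 0 r" for t
    by (intro analytic_continuation_open[of T "ball 0 r" "\<lambda>t. eval B (chart i (z t))" "\<lambda>_. 0", OF _ _ _ _ _ hol _ _ that])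
      (use prod0 in \<open>auto simp: T_def\<close>)
  then show False
    using smooth_branch_no_cusp[OF gAB(2) r(1) dz z0 d0 inj] by blast
qed

subsection \<open>Noether's theorem for transversal curves\<close>

definition pair_ideal :: "S \<Rightarrow> S \<Rightarrow> S set" where
  "pair_ideal A B = {U * A + V * B | U V. True}"

lemma pair_idealI: "F = U * A + V * B \<Longrightarrow> F \<in> pair_ideal A B"
  by (auto simp: pair_ideal_def)

lemma pair_ideal_gens: "A \<in> pair_ideal A B" "B \<in> pair_ideal A B"
  by (rule pair_idealI[of _ 1 _ 0], simp) (rule pair_idealI[of _ 0 _ 1], simp)

lemma pair_ideal_add: "F \<in> pair_ideal A B \<Longrightarrow> G \<in> pair_ideal A B \<Longrightarrow> F + G \<in> pair_ideal A B"
proof -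
  assume "F \<in> pair_ideal A B" "G \<in> pair_ideal A B"
  then obtain U V U' V' where "F = U * A + V * B" "G = U' * A + V' * B"
    by (auto simp: pair_ideal_def)
  then show ?thesis by (intro pair_idealI[of _ "U + U'" _ "V + V'"]) (simp add: algebra_simps)
qed

lemma pair_ideal_mult: "F \<in> pair_ideal A B \<Longrightarrow> G * F \<in> pair_ideal A B"
proof -
  assume "F \<in> pair_ideal A B"
  then obtain U V where "F = U * A + V * B" by (auto simp: pair_ideal_def)
  then show ?thesis by (intro pair_idealI[of _ "G * U" _ "G * V"]) (simp add: algebra_simps)
qed

lemma pair_ideal_diff: "F \<in> pair_ideal A B \<Longrightarrow> G \<in> pair_ideal A B \<Longrightarrow> F - G \<in> pair_ideal A B"
  using pair_ideal_add[of F A B "- 1 * G"] pair_ideal_mult[of G A B "- 1"] by simp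

lemma pair_ideal_hci:
  assumes "homogeneous k A" "homogeneous l B" "F \<in> pair_ideal A B"
  shows "hci e F \<in> pair_ideal A B"
proof -
  obtain U V where "F = U * A + V * B" using assms(3) by (auto simp: pair_ideal_def)
  then have "hci e F = hci (e - k) U * A + hci (e - l) V * B"
    using hci_mult[OF assms(1), of e U] hci_mult[OF assms(2), of e V] by (simp add: hci_add mult.commute)
  then show ?thesis by (rule pair_idealI)
qed

lemma pair_ideal_Const_cancel:
  assumes "Const c * F \<in> pair_ideal A B" "c \<noteq> 0"
  shows "F \<in> pair_ideal A B"
proof -
  have "Const (inverse c) * (Const c * F) \<in> pair_ideal A B"
    by (rule pair_ideal_mult) (rule assms)
  then show ?thesis using assms(2) by (simp add: mult.assoc[symmetric] Const.mult[symmetric])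
qed

text \<open>For \<open>p $ i = 1\<close> the forms with \<open>j = i + 1\<close> and
  \<open>j = i + 2\<close> generate the homogeneous ideal of the point \<open>p\<close>.\<close>

definition lin :: "complex^3 \<Rightarrow> 3 \<Rightarrow> 3 \<Rightarrow> S" where
  "lin p i j = X j - Const (p $ j) * X i"

text \<open>Reduction modulo these forms: restriction to the line through the origin and
  \<open>p\<close>, with \<open>X i\<close> as parameter.\<close>

definition ray_map :: "complex^3 \<Rightarrow> 3 \<Rightarrow> S \<Rightarrow> S" where
  "ray_map p i = psub Const (\<lambda>j. Const (p $ j) * X i)"

interpretation ray_map: comm_hom "ray_map p i"
  unfolding ray_map_def by (rule comm_hom_psub[OF comm_hom_Const])

lemma ray_map_Const [simp]: "ray_map p i (Const c) = Const c"
  by (simp add: ray_map_def psub_Const[OF comm_hom_Const])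

lemma ray_map_X [simp]: "ray_map p i (X j) = Const (p $ j) * X i"
  by (simp add: ray_map_def psub_X[OF comm_hom_Const])

lemma ray_map_reduction:
  assumes "p $ i = 1"
  obtains c1 c2 where "F = ray_map p i F + c1 * lin p i (i + 1) + c2 * lin p i (i + 2)"
proof -
  have "\<exists>c1 c2. F - ray_map p i F = c1 * lin p i (i + 1) + c2 * lin p i (i + 2)"
  proof (induction F rule: S_induct)
    case (Const c)
    show ?case by (intro exI[of _ 0]) simp
  next
    case (X j)
    consider "j = i" | "j = i + 1" | "j = i + 2" using index3_exhaust by blast
    then show ?case
    proof cases
      case 1
      then show ?thesis using assms by (intro exI[of _ 0]) simp
    next
      case 2
      then show ?thesis by (intro exI[of _ 1] exI[of _ 0]) (simp add: lin_def)
    next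
      case 3
      then show ?thesis by (intro exI[of _ 0] exI[of _ 1]) (simp add: lin_def)
    qed
  next
    case (add F G)
    then obtain c1 c2 d1 d2 where *: "F - ray_map p i F = c1 * lin p i (i + 1) + c2 * lin p i (i + 2)"
      "G - ray_map p i G = d1 * lin p i (i + 1) + d2 * lin p i (i + 2)" by blast
    have "F + G - ray_map p i (F + G) = (F - ray_map p i F) + (G - ray_map p i G)"
      by (simp add: ray_map.add)
    then show ?case
      by (intro exI[of _ "c1 + d1"] exI[of _ "c2 + d2"]) (simp add: * algebra_simps)
  next
    case (mult F G)
    then obtain c1 c2 d1 d2 where *: "F - ray_map p i F = c1 * lin p i (i + 1) + c2 * lin p i (i + 2)"
      "G - ray_map p i G = d1 * lin p i (i + 1) + d2 * lin p i (i + 2)" by blast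
    have "F * G - ray_map p i (F * G) = (F - ray_map p i F) * G + ray_map p i F * (G - ray_map p i G)"
      by (simp add: ray_map.mult algebra_simps)
    then show ?case
      by (intro exI[of _ "c1 * G + ray_map p i F * d1"] exI[of _ "c2 * G + ray_map p i F * d2"])
        (simp add: * algebra_simps)
  qed
  then obtain c1 c2 where "F - ray_map p i F = c1 * lin p i (i + 1) + c2 * lin p i (i + 2)" by blast
  then show ?thesis by (intro that[of c1 c2]) (simp add: algebra_simps)
qed

lemma ray_map_homogeneous:
  assumes "homogeneous (int n) F"
  shows "ray_map p i F = Const (eval F p) * X i ^ n"
proof -
  have h: "comm_hom (\<lambda>G. Const (eval G p))"
    by unfold_locales (simp_all add: eval.add eval.mult Const.add Const.mult)
  interpret h: comm_hom "\<lambda>G. Const (eval G p)" by (rule h)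
  interpret m: comm_hom "\<lambda>q. poly (map_poly (\<lambda>G. Const (eval G p)) q) (X i)"
    by (rule h.comm_hom_poly_map_poly)
  have t: "comm_hom (\<lambda>F. poly (map_poly (\<lambda>G. Const (eval G p)) (theta F)) (X i))"
    by unfold_locales (simp_all add: theta.add theta.mult m.add m.mult)
  have "ray_map p i F = poly (map_poly (\<lambda>G. Const (eval G p)) (theta F)) (X i)"
    by (rule S_hom_eqI[OF ray_map.comm_hom_axioms t]) (simp_all add: map_poly_pCons)
  then show ?thesis using assms by (simp add: homogeneous_iff_theta map_poly_monom poly_monom)
qed

lemma homogeneous_lin: "homogeneous 1 (lin p i j)"
  unfolding lin_def by (intro homogeneous_diff homogeneous_X homogeneous_Const_mult)

lemma homogeneous_Const_X_power: "homogeneous (int n) (Const c * X i ^ n)"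
  using homogeneous_Const_mult[OF homogeneous_power[OF homogeneous_X]] by simp

lemma point_reduction:
  assumes "p $ i = 1" "homogeneous (int n) F"
  obtains c1 c2 where "F = Const (eval F p) * X i ^ n + c1 * lin p i (i + 1) + c2 * lin p i (i + 2)"
    "homogeneous (int n - 1) c1" "homogeneous (int n - 1) c2"
proof -
  obtain c1 c2 where c: "F = ray_map p i F + c1 * lin p i (i + 1) + c2 * lin p i (i + 2)"
    using ray_map_reduction[OF assms(1)] .
  have "hci (int n) F = hci (int n) (ray_map p i F + lin p i (i + 1) * c1 + lin p i (i + 2) * c2)"
    by (subst c) (simp only: mult.commute)
  also have "\<dots> = Const (eval F p) * X i ^ n + lin p i (i + 1) * hci (int n - 1) c1 + lin p i (i + 2) * hci (int n - 1) c2"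
    unfolding hci_add hci_mult[OF homogeneous_lin] ray_map_homogeneous[OF assms(2)]
    by (simp add: hci_homogeneous[OF homogeneous_Const_X_power])
  finally have "F = Const (eval F p) * X i ^ n + hci (int n - 1) c1 * lin p i (i + 1) + hci (int n - 1) c2 * lin p i (i + 2)"
    using hci_homogeneous[OF assms(2)] by (simp add: mult.commute)
  then show ?thesis using that homogeneous_hci by blast
qed

lemma X_neq_0 [simp]: "X i \<noteq> 0"
proof
  assume "X i = 0"
  then have "eval (X i) (\<chi> j. 1) = 0" by simp
  then show False by simp
qed

text \<open>Two distinct variables form a regular sequence: setting \<open>X j\<close> to zero,
  which \<open>z\<close> does, shows that \<open>X j\<close> divides \<open>F\<close>.\<close>

lemma X_cross:
  assumes "i \<noteq> j" "X i * F = X j * G"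
  obtains q where "F = X j * q" "G = X i * q"
proof -
  define z where "z = psub Const (\<lambda>k. if k = j then 0 else X k)"
  interpret z: comm_hom z unfolding z_def by (rule comm_hom_psub[OF comm_hom_Const])
  have zX: "z (X k) = (if k = j then 0 else X k)" for k
    by (simp add: z_def psub_X[OF comm_hom_Const])
  have zC: "z (Const c) = Const c" for c
    by (simp add: z_def psub_Const[OF comm_hom_Const])
  have dvd: "X j dvd H - z H" for H
  proof (induction H rule: S_induct)
    case (add H K)
    then show ?case by (simp add: z.add add_diff_add)
  next
    case (mult H K)
    have "H * K - z (H * K) = (H - z H) * K + z H * (K - z K)"
      by (simp add: z.mult algebra_simps)
    then show ?case using mult by simp
  qed (simp_all add: zX zC)
  have "X i * z F = 0"
    using arg_cong[OF assms(2), of z] assms(1) by (simp add: z.mult zX)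
  then have "z F = 0" by simp
  then have "X j dvd F" using dvd[of F] by simp
  then obtain q where q: "F = X j * q" by (elim dvdE)
  then have "X j * (X i * q) = X j * G" using assms(2) by (simp add: mult_ac)
  then have "G = X i * q" by simp
  with q show ?thesis by (rule that)
qed

text \<open>The vanishing of the first homology of the Koszul complex of the three
  variables.\<close>

lemma koszul_relation:
  assumes "X i * e0 + X (i + 1) * e1 + X (i + 2) * e2 = 0"
  obtains w0 w1 w2 where "e0 = X (i + 2) * w1 - X (i + 1) * w2"
    "e1 = X i * w2 - X (i + 2) * w0" "e2 = X (i + 1) * w0 - X i * w1"
proof -
  \<comment> \<open>For this coordinate point \<open>ray_map p i\<close> sets the other two
    variables to zero, so the relation shows that it kills \<open>e0\<close>.\<close>
  define p :: "complex^3" where "p = axis i 1"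
  have p: "p $ i = 1" "p $ (i + 1) = 0" "p $ (i + 2) = 0"
    by (simp_all add: p_def axis_def)
  obtain c1 c2 where c: "e0 = ray_map p i e0 + c1 * lin p i (i + 1) + c2 * lin p i (i + 2)"
    using ray_map_reduction[OF p(1)] .
  have "ray_map p i (X i * e0 + X (i + 1) * e1 + X (i + 2) * e2) = 0" by (simp add: assms)
  then have "ray_map p i e0 = 0"
    by (simp add: ray_map.add ray_map.mult p)
  then have e0: "e0 = c1 * X (i + 1) + c2 * X (i + 2)" using c p by (simp add: lin_def)
  have r: "X (i + 1) * (X i * c1 + e1) = X (i + 2) * (- (X i * c2 + e2))"
    using assms by (simp add: e0 algebra_simps eq_neg_iff_add_eq_0)
  obtain q where q: "X i * c1 + e1 = X (i + 2) * q" "- (X i * c2 + e2) = X (i + 1) * q"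
    by (rule X_cross[OF index3_neq(3) r])
  have "e1 = X (i + 2) * q - X i * c1" using q(1) by (simp add: eq_diff_eq add.commute)
  moreover have "X i * c2 + e2 = - (X (i + 1) * q)" using q(2) by (metis minus_minus)
  then have "e2 = - (X (i + 1) * q) - X i * c2" by (simp add: eq_diff_eq add.commute)
  ultimately show ?thesis
    by (intro that[of c2 "- c1" "- q"]) (simp_all add: e0 algebra_simps)
qed

lemma prime_syzygy:
  fixes A B :: S
  assumes "prime_elem A" "\<not> A dvd B" "a * A = b * B"
  obtains e where "a = e * B" "b = e * A"
proof -
  have "A dvd b * B" using assms(3) by (metis dvd_triv_right)
  then have "A dvd b" using assms(1,2) by (metis prime_elem_dvd_mult_iff)
  then obtain e where e: "b = A * e" by (elim dvdE)
  then have "A * a = A * (e * B)" using assms(3) by (simp add: mult_ac)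
  then have "a = e * B" using assms(1) by (auto simp: prime_elem_def)
  with e show ?thesis by (intro that[of e]) (auto simp: mult.commute)
qed

text \<open>This is where it matters that \<open>A\<close> and \<open>B\<close> form a regular sequence: \<open>S/(A, B)\<close> has positive depth.\<close>

lemma pair_ideal_saturated:
  assumes A: "prime_elem A" "\<not> A dvd B" and u: "\<And>i. X i * u \<in> pair_ideal A B"
  shows "u \<in> pair_ideal A B"
proof -
  have "\<exists>a b. X i * u = a * A + b * B" for i
    using u[of i] by (auto simp: pair_ideal_def)
  then obtain a b where ab: "\<And>i. X i * u = a i * A + b i * B" by metis
  \<comment> \<open>The two representations of \<open>X i * X j * u\<close> differ by a syzygy of
    \<open>A\<close> and \<open>B\<close>, which is a multiple of the Koszul syzygy.\<close>
  have ex: "\<exists>e. X j * a i - X i * a j = e * B \<and> X i * b j - X j * b i = e * A" for i j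
  proof -
    have "X j * (X i * u) = X i * (X j * u)" by (simp add: mult_ac)
    then have "(X j * a i - X i * a j) * A = (X i * b j - X j * b i) * B"
      unfolding ab by (simp add: algebra_simps)
    then show ?thesis using prime_syzygy[OF A] by metis
  qed
  define e where "e = (\<lambda>i j. SOME e. X j * a i - X i * a j = e * B \<and> X i * b j - X j * b i = e * A)"
  have e: "X j * a i - X i * a j = e i j * B" "X i * b j - X j * b i = e i j * A" for i j
    unfolding e_def using someI_ex[OF ex[of j i]] by blast+
  define i :: 3 where "i = 0"
  have B: "B \<noteq> 0" using A by auto
  \<comment> \<open>The factors \<open>e i j\<close> form a Koszul cycle, so they come from
    \<open>w0\<close>, \<open>w1\<close>, \<open>w2\<close>. Correcting the representation of
    \<open>X i * u\<close> by \<open>w0\<close> makes both its coefficients divisible by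
    \<open>X i\<close>.\<close>
  have "(X i * e (i + 1) (i + 2) + X (i + 1) * e (i + 2) i + X (i + 2) * e i (i + 1)) * B
     = X i * (X (i + 2) * a (i + 1) - X (i + 1) * a (i + 2)) + X (i + 1) * (X i * a (i + 2) - X (i + 2) * a i)
       + X (i + 2) * (X (i + 1) * a i - X i * a (i + 1))"
    unfolding e by (simp add: algebra_simps)
  also have "\<dots> = 0" by (simp add: algebra_simps)
  finally have "X i * e (i + 1) (i + 2) + X (i + 1) * e (i + 2) i + X (i + 2) * e i (i + 1) = 0"
    using B by simp
  then obtain w0 w1 w2 where w: "e (i + 1) (i + 2) = X (i + 2) * w1 - X (i + 1) * w2"
    "e (i + 2) i = X i * w2 - X (i + 2) * w0" "e i (i + 1) = X (i + 1) * w0 - X i * w1"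
    by (rule koszul_relation)
  have main: "\<exists>s. c0 = X i * s" if c: "X (i + 1) * c0 = X i * c1" for c0 c1
    by (rule X_cross[OF index3_neq(1) c]) blast
  have "X (i + 1) * (a i - B * w0) = X i * (a (i + 1) - B * w1)"
    using e(1)[of "i + 1" i] unfolding w(3) by (simp add: algebra_simps)
  then obtain s where s: "a i - B * w0 = X i * s" using main by blast
  have "X (i + 1) * (b i + A * w0) = X i * (b (i + 1) + A * w1)"
    using e(2)[of i "i + 1"] unfolding w(3) by (simp add: algebra_simps)
  then obtain t where t: "b i + A * w0 = X i * t" using main by blast
  have "X i * u = (a i - B * w0) * A + (b i + A * w0) * B"
    unfolding ab by (simp add: algebra_simps)
  also have "\<dots> = X i * (s * A + t * B)"
    unfolding s t by (simp add: algebra_simps)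
  finally have "u = s * A + t * B" by simp
  then show ?thesis by (rule pair_idealI)
qed

text \<open>The homogenization \<open>y^e q(x/y)\<close>, where \<open>e\<close> may exceed the
  degree of \<open>q\<close>. The arguments \<open>x\<close> and \<open>y\<close> are arbitrary
  because they will be variables in one place and iterated images of a generator in another.\<close>

definition binary_form :: "S \<Rightarrow> S \<Rightarrow> nat \<Rightarrow> complex poly \<Rightarrow> S" where
  "binary_form x y e q = (\<Sum>l\<le>e. Const (coeff q l) * x ^ l * y ^ (e - l))"

lemma binary_form_linear_factor:
  assumes "degree q \<le> e"
  shows "binary_form x y (Suc e) ([:- \<alpha>, 1:] * q) = (x - Const \<alpha> * y) * binary_form x y e q"
proof -
  have 1: "binary_form x y (Suc e) (pCons 0 q) = x * binary_form x y e q"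
    unfolding binary_form_def by (subst sum.atMost_Suc_shift) (simp add: sum_distrib_left mult_ac)
  have 2: "binary_form x y (Suc e) q = y * binary_form x y e q"
    using assms by (simp add: binary_form_def coeff_eq_0 sum_distrib_left Suc_diff_le mult_ac)
  have 3: "binary_form x y (Suc e) (p - smult \<alpha> q) = binary_form x y (Suc e) p - Const \<alpha> * binary_form x y (Suc e) q" for p
    unfolding binary_form_def sum_distrib_left sum_subtractf[symmetric]
    by (rule sum.cong) (simp_all add: Const.diff Const.mult algebra_simps)
  have "[:- \<alpha>, 1:] * q = pCons 0 q - smult \<alpha> q" by simp
  then have "binary_form x y (Suc e) ([:- \<alpha>, 1:] * q) = binary_form x y (Suc e) (pCons 0 q) - Const \<alpha> * binary_form x y (Suc e) q"
    using 3[of "pCons 0 q"] by presburger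
  then show ?thesis by (simp only: 1 2) (simp add: algebra_simps)
qed

text \<open>Elimination puts a nonzero polynomial free of \<open>X i\<close> into the ideal, and a
  nonzero homogeneous component of it is a binary form. Reversing the coefficients gives the same
  form with the variables exchanged; \<open>binary_form_exists\<close> needs both orders.\<close>

lemma binary_form_in_pair_ideal:
  assumes A: "prime_elem A" "\<not> A dvd B" "homogeneous k A" "homogeneous l B"
  obtains e q where "q \<noteq> 0" "degree q \<le> e" "binary_form (X (i + 1)) (X (i + 2)) e q \<in> pair_ideal A B"
    "binary_form (X (i + 2)) (X (i + 1)) e (\<Sum>n\<le>e. monom (coeff q (e - n)) n) \<in> pair_ideal A B"
    "(\<Sum>n\<le>e. monom (coeff q (e - n)) n) \<noteq> 0"
    "degree (\<Sum>n\<le>e. monom (coeff q (e - n)) n) \<le> e"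
proof -
  obtain U V r where r: "U * A + V * B = down2 i r" "r \<noteq> 0" using elimination[OF A(1,2)] .
  then obtain a where "coeff r a \<noteq> 0" by (metis leading_coeff_neq_0)
  then obtain b where ab: "coeff (coeff r a) b \<noteq> 0" by (metis leading_coeff_neq_0)
  define e where "e = a + b"
  define q where "q = (\<Sum>n\<le>e. monom (coeff (coeff r n) (e - n)) n)"
  have cq: "coeff q n = (if n \<le> e then coeff (coeff r n) (e - n) else 0)" for n
    by (simp add: q_def coeff_sum)
  have "down2 i r \<in> pair_ideal A B" by (rule pair_idealI[OF r(1)[symmetric]])
  then have "hci (int e) (down2 i r) \<in> pair_ideal A B" by (rule pair_ideal_hci[OF A(3,4)])
  then have 1: "binary_form (X (i + 1)) (X (i + 2)) e q \<in> pair_ideal A B"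
    by (simp add: hci_down2 binary_form_def cq)
  have q: "q \<noteq> 0"
  proof
    assume "q = 0"
    then have "coeff q a = 0" by simp
    then show False using ab by (simp add: cq e_def)
  qed
  define q' where "q' = (\<Sum>n\<le>e. monom (coeff q (e - n)) n)"
  have cq': "coeff q' n = (if n \<le> e then coeff q (e - n) else 0)" for n
    by (simp add: q'_def coeff_sum)
  have "binary_form (X (i + 2)) (X (i + 1)) e q' = binary_form (X (i + 1)) (X (i + 2)) e q"
    unfolding binary_form_def
    by (rule sum.reindex_bij_witness[of _ "\<lambda>n. e - n" "\<lambda>n. e - n"]) (auto simp: cq' mult_ac)
  then have 2: "binary_form (X (i + 2)) (X (i + 1)) e q' \<in> pair_ideal A B" using 1 by simp
  have "q' \<noteq> 0"
  proof
    assume "q' = 0"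
    then have "coeff q' (e - a) = 0" by simp
    then show False using ab by (simp add: cq' cq e_def)
  qed
  moreover have "degree q' \<le> e" "degree q \<le> e"
    by (rule degree_le; simp add: cq' cq)+
  ultimately show ?thesis using q 1 2 unfolding q'_def by (intro that)
qed

lemma binary_form_exists:
  assumes "prime_elem A" "\<not> A dvd B" "homogeneous k A" "homogeneous l B" "i \<noteq> j"
  obtains e q where "q \<noteq> 0" "degree q \<le> e" "binary_form (X j) (X i) e q \<in> pair_ideal A B"
proof -
  consider "j = i + 1" | "j = i + 2" using index3_exhaust[of j i] assms(5) by auto
  then show ?thesis
  proof cases
    case 1
    have "i + 2 + 2 = j" "i + 2 + 1 = i" using 1 by (simp_all add: add.assoc)
    then show ?thesis using that by (metis binary_form_in_pair_ideal[OF assms(1-4), of "i + 2"])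
  next
    case 2
    have "i + 1 + 1 = j" "i + 1 + 2 = i" using 2 by (simp_all add: add.assoc)
    then show ?thesis using that by (metis binary_form_in_pair_ideal[OF assms(1-4), of "i + 1"])
  qed
qed

text \<open>The form splits into linear factors, which are tried on \<open>u\<close> one after
  another. If a factor sends some \<open>X i ^ n * u\<close> into the ideal, then \<open>h\<close>
  absorbs that power; otherwise the product with the factor takes the place of \<open>u\<close>. The
  factors cannot run out, since then a power of \<open>X i\<close> would send \<open>u\<close> into
  the ideal.\<close>

lemma binary_form_kill:
  assumes "q \<noteq> 0" "degree q \<le> e" "binary_form (X j) (X i) e q * u \<in> pair_ideal A B"
    "\<And>n. X i ^ n * u \<notin> pair_ideal A B"
  shows "\<exists>h \<alpha>. (\<forall>n. X i ^ n * (h * u) \<notin> pair_ideal A B) \<and> (X j - Const \<alpha> * X i) * (h * u) \<in> pair_ideal A B"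
  using assms
proof (induction "degree q" arbitrary: q e u)
  case 0
  then obtain c where c: "q = [:c:]" by (metis degree_eq_zeroE)
  have "binary_form (X j) (X i) e q = (\<Sum>l\<le>e. if l = 0 then Const c * X i ^ e else 0)"
    unfolding binary_form_def by (intro sum.cong) (auto simp: c coeff_pCons split: nat.splits)
  also have "\<dots> = Const c * X i ^ e" by simp
  finally have "Const c * (X i ^ e * u) \<in> pair_ideal A B" using 0 by (simp add: mult.assoc)
  then have "X i ^ e * u \<in> pair_ideal A B" by (rule pair_ideal_Const_cancel) (use 0 c in simp)
  then show ?case using 0 by blast
next
  case (Suc d)
  then have "\<not> constant (poly q)" by (simp add: constant_degree)
  then have "\<exists>\<alpha>. poly q \<alpha> = 0" by (rule Fundamental_Theorem_Algebra.fundamental_theorem_of_algebra)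
  then obtain \<alpha> where "poly q \<alpha> = 0" by blast
  then obtain q' where q': "q = [:- \<alpha>, 1:] * q'" by (auto simp: poly_eq_0_iff_dvd elim: dvdE)
  have q'0: "q' \<noteq> 0" using Suc.prems(1) q' by auto
  then have dq: "degree q = Suc (degree q')" unfolding q' by (subst degree_mult_eq) auto
  then obtain e' where e': "e = Suc e'" "degree q' \<le> e'" using Suc.prems(2) by (cases e) auto
  have b: "binary_form (X j) (X i) e q = (X j - Const \<alpha> * X i) * binary_form (X j) (X i) e' q'"
    unfolding e' q' by (rule binary_form_linear_factor) (rule e')
  show ?case
  proof (cases "\<exists>n. X i ^ n * ((X j - Const \<alpha> * X i) * u) \<in> pair_ideal A B")
    case True
    then obtain n where "X i ^ n * ((X j - Const \<alpha> * X i) * u) \<in> pair_ideal A B" by blast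
    then have "(X j - Const \<alpha> * X i) * (X i ^ n * u) \<in> pair_ideal A B" by (simp add: mult_ac)
    moreover have "X i ^ n' * (X i ^ n * u) \<notin> pair_ideal A B" for n'
      using Suc.prems(4)[of "n' + n"] by (simp add: power_add mult_ac)
    ultimately show ?thesis by (intro exI[of _ "X i ^ n"] exI[of _ \<alpha>]) blast
  next
    case False
    have "\<exists>h \<beta>. (\<forall>n. X i ^ n * (h * ((X j - Const \<alpha> * X i) * u)) \<notin> pair_ideal A B)
        \<and> (X j - Const \<beta> * X i) * (h * ((X j - Const \<alpha> * X i) * u)) \<in> pair_ideal A B"
      using False Suc.hyps(2) Suc.prems(3) dq
      by (intro Suc.hyps(1)[OF _ q'0 e'(2)]) (auto simp: b mult_ac)
    then obtain h \<beta> where "\<And>n. X i ^ n * (h * ((X j - Const \<alpha> * X i) * u)) \<notin> pair_ideal A B"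
      "(X j - Const \<beta> * X i) * (h * ((X j - Const \<alpha> * X i) * u)) \<in> pair_ideal A B" by blast
    then show ?thesis
      by (intro exI[of _ "h * (X j - Const \<alpha> * X i)"] exI[of _ \<beta>]) (simp add: mult.assoc)
  qed
qed

lemma last_power:
  fixes u x :: S
  assumes "u \<notin> J" "x ^ n * u \<in> J"
  obtains m where "x ^ m * u \<notin> J" "x * (x ^ m * u) \<in> J"
proof -
  have "\<exists>m<n. (\<forall>i\<le>m. \<not> x ^ i * u \<in> J) \<and> x ^ Suc m * u \<in> J"
    by (rule ex_least_nat_less) (use assms in auto)
  then show ?thesis using that by (auto simp: mult.assoc)
qed

text \<open>Otherwise a power of each variable sends \<open>g\<close> into the ideal. Multiplying by
  the last power that does not, for one variable after the other, gives a nonmember that every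
  variable sends into the ideal, against saturation.\<close>

lemma exists_persistent_variable:
  assumes A: "prime_elem A" "\<not> A dvd B" and g: "g \<notin> pair_ideal A B"
  shows "\<exists>i. \<forall>n. X i ^ n * g \<notin> pair_ideal A B"
proof (rule ccontr)
  let ?J = "pair_ideal A B"
  assume "\<nexists>i. \<forall>n. X i ^ n * g \<notin> ?J"
  then have ex: "\<exists>n. X i ^ n * g \<in> ?J" for i by blast
  have "\<exists>n. X i ^ n * (h * g) \<in> ?J" for i h
    using ex[of i] pair_ideal_mult[of _ A B h] by (metis mult.left_commute)
  then have step: "\<exists>h'. h' * (h * g) \<notin> ?J \<and> X i * (h' * (h * g)) \<in> ?J" if "h * g \<notin> ?J" for i h
    using last_power[OF that] by metis
  obtain h0 where h0: "h0 * g \<notin> ?J" "X 0 * (h0 * g) \<in> ?J"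
    using step[of 1 0] g by auto
  obtain h1 where h1: "h1 * (h0 * g) \<notin> ?J" "X 1 * (h1 * (h0 * g)) \<in> ?J"
    using step[OF h0(1), of 1] by blast
  obtain h2 where h2: "h2 * (h1 * (h0 * g)) \<notin> ?J" "X 2 * (h2 * (h1 * (h0 * g))) \<in> ?J"
    using step[of "h1 * h0" 2] h1(1) by (auto simp: mult.assoc)
  have "X i * (h2 * (h1 * (h0 * g))) \<in> ?J" for i
  proof -
    have "X 0 * (h2 * (h1 * (h0 * g))) \<in> ?J" "X 1 * (h2 * (h1 * (h0 * g))) \<in> ?J"
      using pair_ideal_mult[OF h0(2), of "h2 * h1"] pair_ideal_mult[OF h1(2), of h2]
      by (simp_all add: mult_ac)
    then show ?thesis using h2(2) index3_exhaust[of i 0] by auto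
  qed
  then have "h2 * (h1 * (h0 * g)) \<in> ?J" by (rule pair_ideal_saturated[OF A])
  then show False using h2(1) by blast
qed


text \<open>
  Some multiple \<open>u\<close> of \<open>g\<close> is annihilated modulo \<open>(A, B)\<close> by the linear forms vanishing at one point \<open>p\<close>,
  but by no power of the remaining variable. Then \<open>p\<close> lies on both curves, and by Cramer's rule the Jacobian
  determinant times \<open>g\<close> lies in \<open>(A, B)\<close>.
\<close>

lemma noether:
  assumes A: "prime_elem A" "\<not> A dvd B" "homogeneous (int \<alpha>) A" "homogeneous (int \<beta>) B"
    and tr: "\<And>v. v \<noteq> 0 \<Longrightarrow> eval A v = 0 \<Longrightarrow> eval B v = 0 \<Longrightarrow> eval g v = 0 \<and> nondegenerate (A * B) v"
    and g: "homogeneous (int \<gamma>) g"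
  shows "g \<in> pair_ideal A B"
proof (rule ccontr)
  let ?J = "pair_ideal A B"
  assume "g \<notin> ?J"
  then obtain i where i: "\<And>n. X i ^ n * g \<notin> ?J"
    using exists_persistent_variable[OF A(1,2)] by blast
  obtain e1 q1 where q1: "q1 \<noteq> 0" "degree q1 \<le> e1" "binary_form (X (i + 1)) (X i) e1 q1 \<in> ?J"
    by (rule binary_form_exists[OF A index3_neq(5)])
  obtain e2 q2 where q2: "q2 \<noteq> 0" "degree q2 \<le> e2" "binary_form (X (i + 2)) (X i) e2 q2 \<in> ?J"
    by (rule binary_form_exists[OF A index3_neq(6)])
  have "binary_form (X (i + 1)) (X i) e1 q1 * g \<in> ?J"
    using pair_ideal_mult[OF q1(3), of g] by (simp add: mult.commute)
  from binary_form_kill[OF q1(1,2) this i]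
  obtain h1 a where h1: "\<And>n. X i ^ n * (h1 * g) \<notin> ?J" "(X (i + 1) - Const a * X i) * (h1 * g) \<in> ?J"
    by blast
  have "binary_form (X (i + 2)) (X i) e2 q2 * (h1 * g) \<in> ?J"
    using pair_ideal_mult[OF q2(3), of "h1 * g"] by (simp add: mult.commute)
  from binary_form_kill[OF q2(1,2) this h1(1)]
  obtain h2 b where h2: "\<And>n. X i ^ n * (h2 * (h1 * g)) \<notin> ?J" "(X (i + 2) - Const b * X i) * (h2 * (h1 * g)) \<in> ?J"
    by blast
  define u where "u = h2 * (h1 * g)"
  define p :: "complex^3" where "p = (\<chi> j. if j = i then 1 else if j = i + 1 then a else b)"
  have p: "p $ i = 1" by (simp add: p_def)
  then have p0: "p \<noteq> 0" by (metis zero_index zero_neq_one)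
  let ?x = "lin p i (i + 1)" and ?y = "lin p i (i + 2)"
  have xy: "?x = X (i + 1) - Const a * X i" "?y = X (i + 2) - Const b * X i"
    by (simp_all add: lin_def p_def)
  have ev0: "eval ?x p = 0" "eval ?y p = 0"
    by (simp_all add: lin_def eval.diff eval.mult p)
  have ux: "?x * u \<in> ?J"
    using pair_ideal_mult[OF h1(2), of h2] by (simp add: u_def xy mult_ac)
  have uy: "?y * u \<in> ?J" using h2(2) by (simp add: u_def xy)
  \<comment> \<open>Modulo \<open>?x\<close> and \<open>?y\<close> a form is its value at
    \<open>p\<close> times a power of \<open>X i\<close>, and no power of \<open>X i\<close> sends
    \<open>u\<close> into the ideal.\<close>
  have vanish: "eval H p = 0" if H: "homogeneous (int n) H" "H * u \<in> ?J" for H n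
  proof (rule ccontr)
    assume nz: "eval H p \<noteq> 0"
    obtain c1 c2 where c: "H = Const (eval H p) * X i ^ n + c1 * ?x + c2 * ?y"
      using point_reduction[OF p H(1)] by blast
    have "Const (eval H p) * (X i ^ n * u) = H * u - c1 * (?x * u) - c2 * (?y * u)"
      by (subst (2) c) (simp add: algebra_simps)
    also have "\<dots> \<in> ?J" by (intro pair_ideal_diff pair_ideal_mult H(2) ux uy)
    finally have "X i ^ n * u \<in> ?J" using nz by (rule pair_ideal_Const_cancel)
    then show False using h2(1) by (simp add: u_def)
  qed
  have AB0: "eval A p = 0" "eval B p = 0"
    using vanish[OF A(3)] vanish[OF A(4)] pair_ideal_mult[of _ A B u] pair_ideal_gens(1)[of A B] pair_ideal_gens(2)[of B A]
    by (simp_all add: mult.commute)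
  then have gp: "eval g p = 0" "nondegenerate (A * B) p" using tr p0 by blast+
  obtain c1 c2 where c: "A = c1 * ?x + c2 * ?y" "homogeneous (int \<alpha> - 1) c1" "homogeneous (int \<alpha> - 1) c2"
    using point_reduction[OF p A(3)] AB0 by (metis Const.zero add_0 mult_zero_left)
  obtain d1 d2 where d: "B = d1 * ?x + d2 * ?y" "homogeneous (int \<beta> - 1) d1" "homogeneous (int \<beta> - 1) d2"
    using point_reduction[OF p A(4)] AB0 by (metis Const.zero add_0 mult_zero_left)
  obtain e1 e2 where e: "g = e1 * ?x + e2 * ?y"
    using point_reduction[OF p g] gp by (metis Const.zero add_0 mult_zero_left)
  define D where "D = c1 * d2 - c2 * d1"
  have Dh: "homogeneous (int \<alpha> - 1 + (int \<beta> - 1)) D"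
    unfolding D_def by (intro homogeneous_diff homogeneous_mult c d)
  have "D * ?x = d2 * A - c2 * B" "D * ?y = c1 * B - d1 * A"
    by (simp_all add: D_def c(1) d(1) algebra_simps)
  then have Dxy: "D * ?x \<in> ?J" "D * ?y \<in> ?J"
    by (simp_all add: pair_ideal_diff pair_ideal_mult pair_ideal_gens)
  have "e1 * (D * ?x) + e2 * (D * ?y) \<in> ?J"
    by (intro pair_ideal_add pair_ideal_mult[OF Dxy(1)] pair_ideal_mult[OF Dxy(2)])
  then have "D * g \<in> ?J" by (subst e) (simp add: algebra_simps)
  then have Du: "D * u \<in> ?J"
    using pair_ideal_mult[of "D * g" A B "h2 * h1"] by (simp add: u_def mult_ac)
  \<comment> \<open>\<open>vanish\<close> expects a natural number as degree; a negative degree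
    forces \<open>D = 0\<close>.\<close>
  have D0: "eval D p = 0"
  proof (cases "D = 0")
    case False
    then have "\<not> int \<alpha> - 1 + (int \<beta> - 1) < 0" using Dh homogeneous_neg by blast
    then obtain n where "int \<alpha> - 1 + (int \<beta> - 1) = int n" by (metis nat_0_le not_less)
    then show ?thesis using vanish[of n D] Dh Du by simp
  qed simp
  have gA: "grad A p \<eta> = eval c1 p * grad ?x p \<eta> + eval c2 p * grad ?y p \<eta>" for \<eta>
    by (subst c(1)) (simp add: grad_add grad_mult ev0)
  have gB: "grad B p \<eta> = eval d1 p * grad ?x p \<eta> + eval d2 p * grad ?y p \<eta>" for \<eta>
    by (subst d(1)) (simp add: grad_add grad_mult ev0)
  \<comment> \<open>As \<open>D\<close> vanishes at \<open>p\<close>, the gradients of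
    \<open>A\<close> and \<open>B\<close> are proportional there. The Hessian of
    \<open>A * B\<close> then has rank at most one, which makes isotropic directions
    orthogonal.\<close>
  have dep: "grad A p \<eta> * grad B p \<zeta> = grad B p \<eta> * grad A p \<zeta>" for \<eta> \<zeta>
  proof -
    have "grad A p \<eta> * grad B p \<zeta> - grad B p \<eta> * grad A p \<zeta>
      = eval D p * (grad ?x p \<eta> * grad ?y p \<zeta> - grad ?y p \<eta> * grad ?x p \<zeta>)"
      unfolding gA gB D_def eval.diff eval.mult by (simp add: algebra_simps)
    then show ?thesis by (simp add: D0)
  qed
  obtain \<eta> \<zeta> where h: "hess (A * B) p \<eta> \<eta> = 0" "hess (A * B) p \<zeta> \<zeta> = 0" "hess (A * B) p \<eta> \<zeta> \<noteq> 0"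
    using gp(2) by (auto simp: nondegenerate_def)
  then have "grad A p \<eta> * grad B p \<eta> = 0" "grad A p \<eta> * grad B p \<zeta> \<noteq> 0"
    unfolding hess_mult[OF AB0] using dep[of \<eta> \<zeta>] by (auto simp: mult.commute)
  then show False using dep[of \<eta> \<zeta>] by auto
qed

subsection \<open>Linear algebra\<close>

text \<open>Gaussian elimination of one unknown. All comparisons of dimensions below go through this
  lemma.\<close>

lemma underdetermined_system:
  fixes A :: "'y \<Rightarrow> 'z \<Rightarrow> complex"
  assumes "finite Y" "finite Z" "card Y < card Z"
  obtains c where "\<exists>z\<in>Z. c z \<noteq> 0" "\<And>y. y \<in> Y \<Longrightarrow> (\<Sum>z\<in>Z. A y z * c z) = 0"
proof -
  have "\<exists>c. (\<exists>z\<in>Z. c z \<noteq> 0) \<and> (\<forall>y\<in>Y. (\<Sum>z\<in>Z. A y z * c z) = 0)"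
    using assms
  proof (induction Y arbitrary: Z A rule: finite_induct)
    case empty
    then have "Z \<noteq> {}" by auto
    then show ?case by (intro exI[of _ "\<lambda>_. 1"]) auto
  next
    case (insert y Y)
    show ?case
    proof (cases "\<forall>z\<in>Z. A y z = 0")
      case True
      have "card Y < card Z" using insert by simp
      then obtain c where "\<exists>z\<in>Z. c z \<noteq> 0" "\<forall>y\<in>Y. (\<Sum>z\<in>Z. A y z * c z) = 0"
        using insert.IH[OF insert.prems(1), of A] by blast
      then show ?thesis using True by (intro exI[of _ c]) auto
    next
      case False
      then obtain z0 where z0: "z0 \<in> Z" "A y z0 \<noteq> 0" by blast
      define B where "B = (\<lambda>y' z. A y' z - A y' z0 * A y z / A y z0)"
      have "card Y < card (Z - {z0})" using insert z0 by simp
      then obtain c where c: "\<exists>z\<in>Z - {z0}. c z \<noteq> 0" "\<forall>y'\<in>Y. (\<Sum>z\<in>Z - {z0}. B y' z * c z) = 0"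
        using insert.IH[of "Z - {z0}" B] insert.prems(1) by blast
      define t where "t = - (\<Sum>z\<in>Z - {z0}. A y z * c z) / A y z0"
      define c' where "c' = c(z0 := t)"
      have s: "(\<Sum>z\<in>Z. A y' z * c' z) = A y' z0 * t + (\<Sum>z\<in>Z - {z0}. A y' z * c z)" for y'
        using insert.prems(1) z0(1) by (subst sum.remove[of Z z0]) (auto simp: c'_def intro!: sum.cong)
      have "(\<Sum>z\<in>Z. A y' z * c' z) = 0" if "y' \<in> insert y Y" for y'
      proof (cases "y' = y")
        case True
        then show ?thesis using z0 by (simp add: s t_def)
      next
        case False
        then have "0 = (\<Sum>z\<in>Z - {z0}. A y' z * c z - A y' z0 / A y z0 * (A y z * c z))"
        proof -
          have "B y' z * c z = A y' z * c z - A y' z0 / A y z0 * (A y z * c z)" for z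
            by (simp add: B_def algebra_simps)
          then show ?thesis using c(2) that False by auto
        qed
        also have "\<dots> = (\<Sum>z\<in>Z - {z0}. A y' z * c z) - A y' z0 / A y z0 * (\<Sum>z\<in>Z - {z0}. A y z * c z)"
          by (simp add: sum_subtractf sum_distrib_left)
        finally show ?thesis by (simp add: s t_def)
      qed
      moreover have "\<exists>z\<in>Z. c' z \<noteq> 0" using c(1) by (auto simp: c'_def)
      ultimately show ?thesis by blast
    qed
  qed
  then show ?thesis using that by blast
qed

lemma lookup_Const_mult: "Poly_Mapping.lookup (Const c * F) m = c * Poly_Mapping.lookup F m"
  unfolding Const_def mult_map_scale_conv_mult[symmetric]
  by (simp add: Poly_Mapping.map.rep_eq when_def)

lemma finite_monomials: "finite {m. int (mdeg m) = k}"
proof -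
  have "{m. int (mdeg m) = k} \<subseteq> Poly_Mapping.lookup -` (Pi\<^sub>E UNIV (\<lambda>_. {..nat k}))"
  proof
    fix m assume "m \<in> {m. int (mdeg m) = k}"
    moreover have "Poly_Mapping.lookup m i \<le> mdeg m" for i
      unfolding mdeg_def by (rule member_le_sum) auto
    ultimately have "Poly_Mapping.lookup m i \<le> nat k" for i by auto
    then show "m \<in> Poly_Mapping.lookup -` (Pi\<^sub>E UNIV (\<lambda>_. {..nat k}))" by auto
  qed
  moreover have "finite (Poly_Mapping.lookup -` (Pi\<^sub>E (UNIV :: 3 set) (\<lambda>_. {..nat k})))"
  proof (rule finite_vimageI)
    show "finite (Pi\<^sub>E (UNIV :: 3 set) (\<lambda>_. {..nat k}))" by (rule finite_PiE) auto
    show "inj (Poly_Mapping.lookup :: (3 \<Rightarrow>\<^sub>0 nat) \<Rightarrow> _)"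
      by (rule injI) (rule poly_mapping_eqI, simp)
  qed
  ultimately show ?thesis by (rule finite_subset)
qed

text \<open>There are more forms than monomials of degree \<open>k\<close>. The coefficients are
  packed into a polynomial so that the relation can be turned into a binary form.\<close>

lemma homogeneous_dependent:
  assumes "\<And>i. homogeneous k (s i)"
  obtains e q where "q \<noteq> 0" "degree q \<le> e" "(\<Sum>i\<le>e. Const (coeff q i) * s i) = 0"
proof -
  let ?Y = "{m. int (mdeg m) = k}"
  obtain c where c: "\<exists>i\<in>{..card ?Y}. c i \<noteq> 0"
    "\<And>m. m \<in> ?Y \<Longrightarrow> (\<Sum>i\<le>card ?Y. Poly_Mapping.lookup (s i) m * c i) = 0"
    using underdetermined_system[OF finite_monomials, of "{..card ?Y}" k "\<lambda>m i. Poly_Mapping.lookup (s i) m"]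
    by auto
  define e where "e = card ?Y"
  define q where "q = (\<Sum>i\<le>e. monom (c i) i)"
  have q: "coeff q i = (if i \<le> e then c i else 0)" for i
    by (simp add: q_def coeff_sum)
  have "q \<noteq> 0" using c(1) q unfolding e_def by (metis atMost_iff coeff_0)
  moreover have "degree q \<le> e" by (rule degree_le) (simp add: q)
  moreover have "(\<Sum>i\<le>e. Const (coeff q i) * s i) = 0"
  proof (rule poly_mapping_eqI)
    fix m
    have "Poly_Mapping.lookup (\<Sum>i\<le>e. Const (coeff q i) * s i) m = (\<Sum>i\<le>e. Poly_Mapping.lookup (s i) m * c i)"
      unfolding lookup_sum by (rule sum.cong) (auto simp: lookup_Const_mult q)
    also have "\<dots> = 0"
    proof (cases "m \<in> ?Y")
      case True
      then show ?thesis using c(2) by (simp add: e_def)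
    next
      case False
      then have "Poly_Mapping.lookup (s i) m = 0" for i
        using assms[of i] by (auto simp: homogeneous_def in_keys_iff)
      then show ?thesis by simp
    qed
    finally show "Poly_Mapping.lookup (\<Sum>i\<le>e. Const (coeff q i) * s i) m = Poly_Mapping.lookup 0 m" by simp
  qed
  ultimately show ?thesis by (rule that)
qed

text \<open>Modulo the prime \<open>P\<close> the fraction \<open>x / y\<close> is a root of
  \<open>q\<close>. As \<open>q\<close> splits into linear factors, the fraction equals a
  constant.\<close>

lemma binary_form_root:
  assumes "prime_elem P" "\<not> P dvd y" "q \<noteq> 0" "degree q \<le> e" "P dvd binary_form x y e q"
  shows "\<exists>\<gamma>. P dvd x - Const \<gamma> * y"
  using assms(3-)
proof (induction "degree q" arbitrary: q e)
  case 0
  then obtain c where c: "q = [:c:]" by (metis degree_eq_zeroE)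
  then have "c \<noteq> 0" using 0 by simp
  have "binary_form x y e q = (\<Sum>l\<le>e. if l = 0 then Const c * y ^ e else 0)"
    unfolding binary_form_def by (intro sum.cong) (auto simp: c coeff_pCons split: nat.splits)
  also have "\<dots> = Const c * y ^ e" by simp
  finally have "P dvd Const (inverse c) * (Const c * y ^ e)" using 0 by simp
  then have "P dvd y ^ e"
    using \<open>c \<noteq> 0\<close> by (simp add: mult.assoc[symmetric] Const.mult[symmetric])
  then show ?case using assms(1,2) prime_elem_dvd_power by blast
next
  case (Suc d)
  then have "\<not> constant (poly q)" by (simp add: constant_degree)
  then have "\<exists>\<alpha>. poly q \<alpha> = 0" by (rule Fundamental_Theorem_Algebra.fundamental_theorem_of_algebra)
  then obtain \<alpha> where "poly q \<alpha> = 0" by blast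
  then obtain q' where q': "q = [:- \<alpha>, 1:] * q'" by (auto simp: poly_eq_0_iff_dvd elim: dvdE)
  have q'0: "q' \<noteq> 0" using Suc.prems(1) q' by auto
  then have dq: "degree q = Suc (degree q')" unfolding q' by (subst degree_mult_eq) auto
  then obtain e' where e': "e = Suc e'" "degree q' \<le> e'" using Suc.prems(2) by (cases e) auto
  have "P dvd (x - Const \<alpha> * y) * binary_form x y e' q'"
    using Suc.prems(3) binary_form_linear_factor[OF e'(2), of x y \<alpha>] by (simp only: e' q')
  then consider "P dvd x - Const \<alpha> * y" | "P dvd binary_form x y e' q'"
    using assms(1) by (metis prime_elem_dvd_mult_iff)
  then show ?case
  proof cases
    case 2
    then show ?thesis using Suc.hyps(2) dq by (intro Suc.hyps(1)[OF _ q'0 e'(2)]) auto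
  qed blast
qed

lemma exists_lookup_nonzero:
  assumes "m \<noteq> 0" obtains i where "Poly_Mapping.lookup m i \<noteq> 0"
proof -
  have "\<not> (\<forall>i. Poly_Mapping.lookup m i = Poly_Mapping.lookup 0 i)"
    using assms poly_mapping_eqI by blast
  then show ?thesis using that by auto
qed

lemma homogeneous_0_Const:
  assumes "homogeneous 0 F"
  obtains c where "F = Const c"
proof
  show "F = Const (Poly_Mapping.lookup F 0)"
  proof (rule poly_mapping_eqI)
    fix m
    show "Poly_Mapping.lookup F m = Poly_Mapping.lookup (Const (Poly_Mapping.lookup F 0)) m"
    proof (cases "m = 0")
      case False
      then obtain i where "Poly_Mapping.lookup m i \<noteq> 0" by (rule exists_lookup_nonzero)
      then have "mdeg m \<noteq> 0" by (auto simp: mdeg_def)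
      then have "Poly_Mapping.lookup F m = 0"
        using assms by (force simp: homogeneous_def in_keys_iff)
      then show ?thesis using False by (simp add: Const_def lookup_single)
    qed (simp add: Const_def)
  qed
qed

lemma eval_zero_vector: "eval F 0 = Poly_Mapping.lookup F 0"
proof -
  have "(\<Prod>i\<in>UNIV. (0::complex) ^ Poly_Mapping.lookup m i) = (if m = 0 then 1 else 0)" for m :: "3 \<Rightarrow>\<^sub>0 nat"
  proof (cases "m = 0")
    case False
    then obtain i where "Poly_Mapping.lookup m i \<noteq> 0" by (rule exists_lookup_nonzero)
    then have "\<exists>i\<in>UNIV. (0::complex) ^ Poly_Mapping.lookup m i = 0" by auto
    then show ?thesis using False by (simp add: prod_zero)
  qed simp
  then have "eval F 0 = (\<Sum>m\<in>Poly_Mapping.keys F. if m = 0 then Poly_Mapping.lookup F 0 else 0)"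
    unfolding eval_def by (intro sum.cong) auto
  then show ?thesis by (auto simp: in_keys_iff)
qed

subsection \<open>Multipliers of the ideal of nodes\<close>

text \<open>What the algebra takes from the curve: \<open>NV\<close> stands for the coordinate
  vectors of the nodes, \<open>Q P\<close> for \<open>F / P\<close>, \<open>node\<close> for the
  second order data, and \<open>crossing\<close> says that a component meets the rest of the curve
  only at nodes.\<close>

locale nodal_resolution =
  fixes F :: S and d :: nat and PS :: "S set" and Q :: "S \<Rightarrow> S" and NV :: "(complex^3) set"
    and I :: "S set" and m n :: nat and a b :: "nat \<Rightarrow> int" and g :: "nat \<Rightarrow> S"
    and M :: "nat \<Rightarrow> nat \<Rightarrow> S"
  assumes F: "homogeneous (int d) F" "0 < d" "F \<noteq> 0"
    and PS: "finite PS" "\<And>P. P \<in> PS \<Longrightarrow> prime_elem P"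
    and cofactor: "\<And>P. P \<in> PS \<Longrightarrow> F = P * Q P" "\<And>P. P \<in> PS \<Longrightarrow> \<not> P dvd Q P"
      "\<And>P P'. P \<in> PS \<Longrightarrow> P' \<in> PS \<Longrightarrow> P' \<noteq> P \<Longrightarrow> P' dvd Q P"
    and F_dvd: "\<And>x. (\<And>P. P \<in> PS \<Longrightarrow> P dvd x) \<Longrightarrow> F dvd x"
    and node: "\<And>v. v \<in> NV \<Longrightarrow> eval F v = 0" "\<And>v j. v \<in> NV \<Longrightarrow> eval (pd j F) v = 0"
      "\<And>v. v \<in> NV \<Longrightarrow> nondegenerate F v"
    and crossing: "\<And>P v. P \<in> PS \<Longrightarrow> v \<noteq> 0 \<Longrightarrow> eval P v = 0 \<Longrightarrow> eval (Q P) v = 0 \<Longrightarrow> v \<in> NV"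
    and I: "I = {f. \<forall>v\<in>NV. eval f v = 0}"
    and res: "graded_free_resolution I m a n b g M"
    and minimal: "\<And>i j. i < n \<Longrightarrow> j < m \<Longrightarrow> M i j \<in> irrelevant_ideal"
begin

lemma gen_homogeneous: "j < m \<Longrightarrow> homogeneous (a j) (g j)"
  and M_homogeneous: "i < n \<Longrightarrow> j < m \<Longrightarrow> homogeneous (b i - a j) (M i j)"
  and ideal_eq: "I = {\<Sum>j<m. h j * g j | h. True}"
  and syzygy_iff: "(\<Sum>j<m. h j * g j) = 0 \<longleftrightarrow> (\<exists>k. \<forall>j<m. h j = (\<Sum>i<n. k i * M i j))"
  and rows_independent: "(\<And>j. j < m \<Longrightarrow> (\<Sum>i<n. k i * M i j) = 0) \<Longrightarrow> i < n \<Longrightarrow> k i = 0"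
  using res unfolding graded_free_resolution_def by auto

lemma ideal_repr:
  assumes "f \<in> I" obtains h where "f = (\<Sum>j<m. h j * g j)"
  using assms unfolding ideal_eq by blast

lemma idealI: "(\<Sum>j<m. h j * g j) \<in> I"
  unfolding ideal_eq by blast

lemma gen_in_ideal: "j < m \<Longrightarrow> g j \<in> I"
  using idealI[of "\<lambda>x. if x = j then 1 else 0"] by (simp add: if_distrib[of "\<lambda>x. x * _"] cong: if_cong)

lemma M_row: "i < n \<Longrightarrow> (\<Sum>j<m. M i j * g j) = 0"
  unfolding syzygy_iff by (intro exI[of _ "\<lambda>x. if x = i then 1 else 0"]) (simp add: if_distrib[of "\<lambda>x. x * _"] cong: if_cong)

lemma homogeneous_repr:
  assumes "f \<in> I" "homogeneous k f"
  obtains h where "f = (\<Sum>j<m. h j * g j)" "\<And>j. j < m \<Longrightarrow> homogeneous (k - a j) (h j)"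
proof -
  obtain h where h: "f = (\<Sum>j<m. h j * g j)" using ideal_repr[OF assms(1)] .
  have "f = hci k (\<Sum>j<m. g j * h j)"
    using h hci_homogeneous[OF assms(2), of k] by (simp add: mult.commute)
  also have "\<dots> = (\<Sum>j<m. hci (k - a j) (h j) * g j)"
    unfolding hci_sum by (rule sum.cong) (simp_all add: hci_mult[OF gen_homogeneous] mult.commute)
  finally show ?thesis using homogeneous_hci by (intro that)
qed

lemma F_in_ideal: "F \<in> I" and pd_F_in_ideal: "pd i F \<in> I"
  using node by (auto simp: I)

lemma dvd_gens_imp_dvd: "f \<in> I \<Longrightarrow> (\<And>j. j < m \<Longrightarrow> P dvd g j) \<Longrightarrow> P dvd f"
  by (elim ideal_repr) (auto intro!: dvd_sum)

lemma PS_homogeneous: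
  assumes "P \<in> PS"
  obtains k l where "homogeneous (int k) P" "homogeneous (int l) (Q P)" "k \<noteq> 0"
proof -
  have PQ: "homogeneous (int d) (P * Q P)" "P * Q P \<noteq> 0" using F cofactor(1)[OF assms] by auto
  obtain k where k: "homogeneous (int k) P" "homogeneous (int d - int k) (Q P)"
    using homogeneous_factor[OF PQ] .
  have "\<not> int d - int k < 0" using k(2) PQ(2) homogeneous_neg by fastforce
  then obtain l where l: "int d - int k = int l" by (metis nat_0_le not_less)
  have "k \<noteq> 0"
  proof
    assume "k = 0"
    then obtain c where c: "P = Const c" using k(1) homogeneous_0_Const by auto
    moreover have "c \<noteq> 0" using PQ(2) c by auto
    ultimately have "P * Const (inverse c) = 1" by (simp add: Const.mult[symmetric])
    then have "P dvd 1" by (metis dvd_triv_left)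
    then show False using PS(2)[OF assms] by (simp add: prime_elem_def)
  qed
  then show ?thesis using k l that by auto
qed

text \<open>A common factor \<open>P\<close> of the generators would divide the polars of
  \<open>F\<close>, hence \<open>pd i P * Q P\<close>, hence \<open>pd i P\<close>, whose degree is
  too small. The lemma provides a generator that can be cancelled modulo \<open>P\<close>.\<close>

lemma gen_not_dvd:
  assumes "P \<in> PS" obtains j where "j < m" "\<not> P dvd g j"
proof -
  have "\<exists>j<m. \<not> P dvd g j"
  proof (rule ccontr)
    assume "\<not> (\<exists>j<m. \<not> P dvd g j)"
    then have all: "P dvd f" if "f \<in> I" for f using dvd_gens_imp_dvd that by blast
    obtain k l where k: "homogeneous (int k) P" "k \<noteq> 0" using PS_homogeneous[OF assms] by blast
    have P0: "P \<noteq> 0" using PS(2)[OF assms] by auto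
    obtain i where i: "pd i P \<noteq> 0" using exists_pd_nonzero[OF k(1) P0] k(2) by auto
    have "P dvd pd i F" by (rule all[OF pd_F_in_ideal])
    then have "P dvd pd i (P * Q P)" using cofactor(1)[OF assms] by metis
    then have "P dvd pd i P * Q P" by (simp add: pd_mult dvd_add_left_iff)
    then have "P dvd pd i P" using PS(2)[OF assms] cofactor(2)[OF assms] by (metis prime_elem_dvd_mult_iff)
    then obtain h where h: "pd i P = P * h" by (elim dvdE)
    then have "homogeneous (int k - 1) (P * h)" using homogeneous_pd[OF k(1)] by metis
    then have "homogeneous (int k - 1 - int k) h" by (rule homogeneous_dvd[OF k(1) _ P0])
    then have "h = 0" by (rule homogeneous_neg) simp
    then show False using h i by simp
  qed
  then show ?thesis using that by blast
qed

text \<open>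
  Homogeneous homomorphisms \<open>I \<rightarrow> S/F\<close> of degree \<open>e\<close>, given by lifts \<open>t j\<close> of the images of the generators.
\<close>

definition multiplier :: "int \<Rightarrow> (nat \<Rightarrow> S) \<Rightarrow> bool" where
  "multiplier e t \<longleftrightarrow> (\<forall>j<m. homogeneous (a j + e) (t j)) \<and>
     (\<forall>l<m. \<forall>j<m. F dvd g l * t j - g j * t l)"

text \<open>If the image \<open>t'\<close> did not vanish at a node, differentiating
  \<open>g l * t' = f * t l\<close> modulo \<open>F\<close> would make the gradients of all elements
  of \<open>I\<close> multiples of that of \<open>f\<close>. For the polars this says that the
  Hessian is a product of two linear forms, one in each argument; being symmetric, it would make the
  two isotropic directions orthogonal.\<close>

lemma multiplier_image:
  assumes t: "multiplier e t" and f: "f \<in> I" "homogeneous k f"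
  obtains t' where "t' \<in> I" "homogeneous (k + e) t'" "\<And>j. j < m \<Longrightarrow> F dvd g j * t' - f * t j"
proof -
  obtain h where h: "f = (\<Sum>j<m. h j * g j)" "\<And>j. j < m \<Longrightarrow> homogeneous (k - a j) (h j)"
    using homogeneous_repr[OF f] by blast
  define t' where "t' = (\<Sum>j<m. h j * t j)"
  have hom: "homogeneous (k + e) t'"
    unfolding t'_def
  proof (rule homogeneous_sum)
    fix j assume "j \<in> {..<m}"
    then have "homogeneous (k - a j + (a j + e)) (h j * t j)"
      using t h(2) by (intro homogeneous_mult) (auto simp: multiplier_def)
    then show "homogeneous (k + e) (h j * t j)" by (simp add: algebra_simps)
  qed
  have cross: "F dvd g l * t' - f * t l" if "l < m" for l
  proof -
    have "g l * t' - f * t l = (\<Sum>j<m. h j * (g l * t j - g j * t l))"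
      by (simp add: h(1) t'_def sum_distrib_left sum_distrib_right sum_subtractf algebra_simps)
    also have "F dvd \<dots>" using t that by (intro dvd_sum dvd_mult) (auto simp: multiplier_def)
    finally show ?thesis .
  qed
  have "eval t' v = 0" if v: "v \<in> NV" for v
  proof (rule ccontr)
    assume nz: "eval t' v \<noteq> 0"
    have gradF: "grad F v \<eta> = 0" for \<eta> using node(2)[OF v] by (simp add: grad_def)
    have f0: "eval f v = 0" using f(1) v by (simp add: I)
    \<comment> \<open>\<open>F\<close> vanishes to second order at \<open>v\<close>, so the unknown
      multiple of \<open>F\<close> does not contribute to the gradient.\<close>
    have gg: "eval t' v * grad (g l) v \<eta> = eval (t l) v * grad f v \<eta>" if l: "l < m" for l \<eta>
    proof -
      obtain k where k: "g l * t' - f * t l = F * k" using cross[OF l] by (elim dvdE)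
      have "grad (g l * t') v \<eta> = grad (f * t l + F * k) v \<eta>" using k by (simp add: algebra_simps)
      moreover have "eval (g l) v = 0" using gen_in_ideal[OF l] v by (simp add: I)
      ultimately show ?thesis
        by (simp add: grad_add grad_mult gradF f0 node(1)[OF v] mult.commute)
    qed
    have "\<exists>c. \<forall>\<eta>. grad f' v \<eta> = c * grad f v \<eta>" if f': "f' \<in> I" for f'
    proof -
      obtain h' where h': "f' = (\<Sum>j<m. h' j * g j)" using ideal_repr[OF f'] .
      have "grad f' v \<eta> = (\<Sum>j<m. eval (h' j) v * eval (t j) v / eval t' v) * grad f v \<eta>" for \<eta>
      proof -
        have "grad f' v \<eta> = (\<Sum>i\<in>UNIV. \<Sum>j<m. eval (pd i (h' j * g j)) v * \<eta> $ i)"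
          by (simp add: h' grad_def pd_sum eval.sum sum_distrib_right)
        also have "\<dots> = (\<Sum>j<m. grad (h' j * g j) v \<eta>)"
          by (subst sum.swap) (simp add: grad_def)
        also have "\<dots> = (\<Sum>j<m. eval (h' j) v * eval (t j) v / eval t' v * grad f v \<eta>)"
        proof (rule sum.cong)
          fix j assume "j \<in> {..<m}"
          then have j: "j < m" by simp
          have "eval (g j) v = 0" using gen_in_ideal[OF j] v by (simp add: I)
          moreover have "grad (g j) v \<eta> = eval (t j) v * grad f v \<eta> / eval t' v"
            using gg[OF j, of \<eta>] nz by (simp add: field_simps)
          ultimately show "grad (h' j * g j) v \<eta> = eval (h' j) v * eval (t j) v / eval t' v * grad f v \<eta>"
            by (simp add: grad_mult)
        qed simp
        finally show ?thesis by (simp add: sum_distrib_right)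
      qed
      then show ?thesis by blast
    qed
    then have "\<forall>j. \<exists>c. \<forall>\<eta>. grad (pd j F) v \<eta> = c * grad f v \<eta>" using pd_F_in_ideal by blast
    then obtain c where c: "\<And>j \<eta>. grad (pd j F) v \<eta> = c j * grad f v \<eta>" by metis
    define \<psi> where "\<psi> = (\<lambda>\<zeta>::complex^3. \<Sum>j\<in>UNIV. c j * \<zeta> $ j)"
    have H: "hess F v \<eta> \<zeta> = grad f v \<eta> * \<psi> \<zeta>" for \<eta> \<zeta>
      by (simp add: grad_sum_pd c \<psi>_def sum_distrib_left mult_ac)
    obtain \<eta> \<zeta> where nd: "hess F v \<eta> \<eta> = 0" "hess F v \<zeta> \<zeta> = 0" "hess F v \<eta> \<zeta> \<noteq> 0"
      using node(3)[OF v] by (auto simp: nondegenerate_def)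
    then have "\<psi> \<eta> = 0" by (auto simp: H)
    then have "hess F v \<zeta> \<eta> = 0" by (simp add: H)
    then show False using nd(3) hess_sym by metis
  qed
  then have "t' \<in> I" by (simp add: I)
  with hom cross show ?thesis using that by blast
qed

text \<open>\<open>s i\<close> lifts the \<open>i\<close>-th iterate at \<open>f\<close>. Iteration
  is possible because the images stay in \<open>I\<close>; lifts are determined only modulo
  \<open>F\<close>, so they are chosen successively.\<close>

lemma multiplier_sequence:
  assumes t: "multiplier e t" and f: "f \<in> I" "homogeneous k f"
  obtains s where "s 0 = f" "\<And>i. homogeneous (k + int i * e) (s i)"
    "\<And>i j. j < m \<Longrightarrow> F dvd g j * s (Suc i) - s i * t j"
proof -
  have "\<exists>s. \<forall>i. (s i \<in> I \<and> homogeneous (k + int i * e) (s i) \<and> (i = 0 \<longrightarrow> s i = f)) \<and>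
    (\<forall>j<m. F dvd g j * s (Suc i) - s i * t j)"
  proof (rule dependent_nat_choice)
    show "\<exists>x. x \<in> I \<and> homogeneous (k + int 0 * e) x \<and> (0 = 0 \<longrightarrow> x = f)" using f by auto
  next
    fix x i assume x: "x \<in> I \<and> homogeneous (k + int i * e) x \<and> (i = 0 \<longrightarrow> x = f)"
    obtain t' where "t' \<in> I" "homogeneous (k + int i * e + e) t'" "\<And>j. j < m \<Longrightarrow> F dvd g j * t' - x * t j"
      using multiplier_image[OF t, of x "k + int i * e"] x by blast
    then show "\<exists>y. (y \<in> I \<and> homogeneous (k + int (Suc i) * e) y \<and> (Suc i = 0 \<longrightarrow> y = f)) \<and>
      (\<forall>j<m. F dvd g j * y - x * t j)" by (intro exI[of _ t']) (auto simp: algebra_simps)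
  qed
  then show ?thesis using that by metis
qed

text \<open>Modulo \<open>P\<close> the homomorphism is multiplication by \<open>s 1 / s 0\<close>,
  so \<open>s i\<close> equals \<open>s 0 * (s 1 / s 0) ^ i\<close>; denominators are
  cleared.\<close>

lemma multiplier_sequence_power:
  assumes P: "P \<in> PS" and s: "\<And>i j. j < m \<Longrightarrow> F dvd g j * s (Suc i) - s i * t j"
  shows "P dvd s i * s 0 ^ i - s 1 ^ i * s 0"
proof (induction i)
  case (Suc i)
  obtain j where j: "j < m" "\<not> P dvd g j" using gen_not_dvd[OF P] .
  have PF: "P dvd F" using cofactor(1)[OF P] by (metis dvd_triv_left)
  have c: "P dvd g j * s (Suc i) - s i * t j" for i
    using s[OF j(1)] PF dvd_trans by blast
  have "g j * (s 0 * s (Suc i) - s i * s 1) = s 0 * (g j * s (Suc i) - s i * t j) - s i * (g j * s (Suc 0) - s 0 * t j)"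
    by (simp add: algebra_simps)
  then have "P dvd g j * (s 0 * s (Suc i) - s i * s 1)"
    using c by (simp add: dvd_diff)
  then have 1: "P dvd s 0 * s (Suc i) - s i * s 1"
    using j(2) PS(2)[OF P] by (metis prime_elem_dvd_mult_iff)
  have "s (Suc i) * s 0 ^ Suc i - s 1 ^ Suc i * s 0
     = s 0 ^ i * (s 0 * s (Suc i) - s i * s 1) + s 1 * (s i * s 0 ^ i - s 1 ^ i * s 0)"
    by (simp add: algebra_simps)
  then show ?case using 1 Suc.IH by simp
qed simp

lemma multiplier_negative:
  assumes t: "multiplier e t" and e: "e < 0" and j: "j < m"
  shows "F dvd t j"
proof (rule F_dvd)
  fix P assume P: "P \<in> PS"
  have pr: "prime_elem P" by (rule PS(2)[OF P])
  obtain j0 where j0: "j0 < m" "\<not> P dvd g j0" using gen_not_dvd[OF P] .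
  obtain s where s: "s 0 = g j0" "\<And>i. homogeneous (a j0 + int i * e) (s i)"
    "\<And>i j. j < m \<Longrightarrow> F dvd g j * s (Suc i) - s i * t j"
    using multiplier_sequence[OF t gen_in_ideal[OF j0(1)] gen_homogeneous[OF j0(1)]] by blast
  \<comment> \<open>Since \<open>e \<le> -1\<close>, this many iterations push the degree below
    zero.\<close>
  define i where "i = nat (\<bar>a j0\<bar> + 1)"
  have "a j0 + int i * e \<le> a j0 + int i * (- 1)"
    using e by (intro add_left_mono mult_left_mono) auto
  then have "a j0 + int i * e < 0" by (simp add: i_def)
  then have "s i = 0" using s(2) homogeneous_neg by blast
  then have "P dvd s 1 ^ i * s 0"
    using multiplier_sequence_power[OF P, of s t, OF s(3), of i] by simp
  then have "P dvd s 1" using pr j0(2) s(1) prime_elem_dvd_power by (metis prime_elem_dvd_mult_iff)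
  moreover have "P dvd g j * s (Suc 0) - s 0 * t j"
    using s(3)[OF j] cofactor(1)[OF P] by (metis dvd_trans dvd_triv_left)
  ultimately have "P dvd s 0 * t j"
    by (metis One_nat_def dvd_diff_right_iff dvd_mult)
  then show "P dvd t j" using pr j0(2) s(1) by (metis prime_elem_dvd_mult_iff)
qed

lemma multiplier_zero:
  assumes t: "multiplier 0 t" and P: "P \<in> PS"
  obtains \<gamma> where "\<And>j. j < m \<Longrightarrow> P dvd t j - Const \<gamma> * g j"
proof -
  have pr: "prime_elem P" by (rule PS(2)[OF P])
  obtain j0 where j0: "j0 < m" "\<not> P dvd g j0" using gen_not_dvd[OF P] .
  obtain s where s: "s 0 = g j0" "\<And>i. homogeneous (a j0 + int i * 0) (s i)"
    "\<And>i j. j < m \<Longrightarrow> F dvd g j * s (Suc i) - s i * t j"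
    using multiplier_sequence[OF t gen_in_ideal[OF j0(1)] gen_homogeneous[OF j0(1)]] by blast
  have "homogeneous (a j0) (s i)" for i using s(2)[of i] by simp
  then obtain e q where q: "q \<noteq> 0" "degree q \<le> e" "(\<Sum>i\<le>e. Const (coeff q i) * s i) = 0"
    by (rule homogeneous_dependent)
  \<comment> \<open>Modulo \<open>P\<close> the linear relation among the iterates becomes the
    equation \<open>q(s 1 / s 0) = 0\<close>, with denominators cleared by
    \<open>s 0 ^ e\<close>.\<close>
  have "(\<Sum>i\<le>e. Const (coeff q i) * s i) * s 0 ^ e - binary_form (s 1) (s 0) e q * s 0
     = (\<Sum>i\<le>e. Const (coeff q i) * s 0 ^ (e - i) * (s i * s 0 ^ i - s 1 ^ i * s 0))"
    unfolding binary_form_def sum_distrib_right sum_subtractf[symmetric]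
  proof (rule sum.cong)
    fix i assume "i \<in> {..e}"
    then have "s 0 ^ e = s 0 ^ (e - i) * s 0 ^ i" by (simp add: power_add[symmetric])
    then show "Const (coeff q i) * s i * s 0 ^ e - Const (coeff q i) * s 1 ^ i * s 0 ^ (e - i) * s 0
      = Const (coeff q i) * s 0 ^ (e - i) * (s i * s 0 ^ i - s 1 ^ i * s 0)"
      by (simp add: algebra_simps)
  qed simp
  also have "P dvd \<dots>"
    using multiplier_sequence_power[OF P, of s t, OF s(3)] by (intro dvd_sum dvd_mult)
  finally have "P dvd binary_form (s 1) (s 0) e q * s 0" by (simp add: q(3))
  then have "P dvd binary_form (s 1) (s 0) e q"
    using pr j0(2) s(1) by (metis prime_elem_dvd_mult_iff)
  then obtain \<gamma> where \<gamma>: "P dvd s 1 - Const \<gamma> * s 0"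
    using binary_form_root[OF pr _ q(1,2)] j0(2) s(1) by metis
  have "P dvd t j - Const \<gamma> * g j" if j: "j < m" for j
  proof -
    have 1: "P dvd g j * s (Suc 0) - s 0 * t j"
      using s(3)[OF j] cofactor(1)[OF P] by (metis dvd_trans dvd_triv_left)
    have "s 0 * (t j - Const \<gamma> * g j) = g j * (s 1 - Const \<gamma> * s 0) - (g j * s (Suc 0) - s 0 * t j)"
      by (simp add: algebra_simps)
    then have "P dvd s 0 * (t j - Const \<gamma> * g j)" using 1 \<gamma> by (simp add: dvd_diff)
    then show ?thesis using pr j0(2) s(1) by (metis prime_elem_dvd_mult_iff)
  qed
  then show ?thesis by (rule that)
qed

section \<open>The null-homotopy and the kernel of \<open>M\<close>\<close>

text \<open>\<open>K l j i\<close> is a null-homotopy for multiplication by \<open>g l\<close>: it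
  expresses the Koszul syzygy of \<open>g l\<close> and \<open>g j\<close> by the rows of
  \<open>M\<close>. Combining these with the coefficients of \<open>F\<close> in the generators
  gives \<open>\<kappa>0\<close>.\<close>

lemma adjugate_exists:
  obtains \<kappa> where "\<And>i j. homogeneous (a j + (int d - b i)) (\<kappa> i j)"
    "\<And>i i'. i < n \<Longrightarrow> i' < n \<Longrightarrow> (\<Sum>j<m. M i' j * \<kappa> i j) = (if i = i' then F else 0)"
proof -
  define h where "h = (\<lambda>l j x. (if x = j then g l else 0) - (if x = l then g j else 0))"
  have "\<exists>k. \<forall>x<m. h l j x = (\<Sum>i<n. k i * M i x)" if "l < m" "j < m" for l j
  proof -
    have "(\<Sum>x<m. h l j x * g x) = (\<Sum>x<m. if x = j then g l * g j else 0) - (\<Sum>x<m. if x = l then g j * g l else 0)"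
      unfolding h_def sum_subtractf[symmetric] by (rule sum.cong) auto
    also have "\<dots> = 0" using that by simp
    finally show ?thesis unfolding syzygy_iff .
  qed
  then have "\<forall>l j. \<exists>k. l < m \<longrightarrow> j < m \<longrightarrow> (\<forall>x<m. h l j x = (\<Sum>i<n. k i * M i x))" by blast
  then obtain K where K: "\<And>l j x. l < m \<Longrightarrow> j < m \<Longrightarrow> x < m \<Longrightarrow> h l j x = (\<Sum>i<n. K l j i * M i x)"
    by metis
  have MK: "(\<Sum>j<m. M i' j * K l j i) = (if i = i' then g l else 0)" if l: "l < m" and i: "i' < n" "i < n" for l i i'
  proof -
    have "(\<Sum>j<m. M i' j * K l j i) - (if i = i' then g l else 0) = 0"
    \<comment> \<open>As the rows are independent, \<open>M K\<^sup>T = g l\<close> may be checked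
      after multiplication by \<open>M\<close>; there the extra term contains a row of
      \<open>M\<close> applied to \<open>g\<close>, which is zero.\<close>
    proof (rule rows_independent[OF _ i(2), where k = "\<lambda>i. (\<Sum>j<m. M i' j * K l j i) - (if i = i' then g l else 0)"])
      fix x assume x: "x < m"
      have "(\<Sum>i<n. (\<Sum>j<m. M i' j * K l j i) * M i x) = (\<Sum>j<m. M i' j * (\<Sum>i<n. K l j i * M i x))"
        unfolding sum_distrib_right sum_distrib_left by (subst sum.swap) (simp add: mult.assoc)
      also have "\<dots> = (\<Sum>j<m. M i' j * h l j x)"
        by (rule sum.cong) (use K l x in auto)
      also have "\<dots> = (\<Sum>j<m. (if j = x then M i' x * g l else 0) - (if x = l then M i' j * g j else 0))"
        unfolding h_def by (rule sum.cong) (auto simp: algebra_simps)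
      also have "\<dots> = M i' x * g l - (if x = l then \<Sum>j<m. M i' j * g j else 0)"
        unfolding sum_subtractf using x by simp
      also have "\<dots> = M i' x * g l" using M_row[OF i(1)] by simp
      finally have 1: "(\<Sum>i<n. (\<Sum>j<m. M i' j * K l j i) * M i x) = M i' x * g l" .
      have "(\<Sum>i<n. (if i = i' then g l else 0) * M i x) = (\<Sum>i<n. if i = i' then g l * M i' x else 0)"
        by (rule sum.cong) auto
      also have "\<dots> = g l * M i' x" using i(1) by simp
      finally show "(\<Sum>i<n. ((\<Sum>j<m. M i' j * K l j i) - (if i = i' then g l else 0)) * M i x) = 0"
        using 1 by (simp add: left_diff_distrib right_diff_distrib sum_subtractf mult.commute)
    qed
    then show ?thesis by simp
  qed
  obtain f where f: "F = (\<Sum>l<m. f l * g l)" using ideal_repr[OF F_in_ideal] .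
  define \<kappa>0 where "\<kappa>0 = (\<lambda>i j. \<Sum>l<m. f l * K l j i)"
  have M\<kappa>0: "(\<Sum>j<m. M i' j * \<kappa>0 i j) = (if i = i' then F else 0)" if "i < n" "i' < n" for i i'
  proof -
    have "(\<Sum>j<m. M i' j * \<kappa>0 i j) = (\<Sum>l<m. f l * (\<Sum>j<m. M i' j * K l j i))"
      unfolding \<kappa>0_def sum_distrib_left by (subst sum.swap) (simp add: mult_ac)
    also have "\<dots> = (\<Sum>l<m. f l * (if i = i' then g l else 0))"
      by (rule sum.cong) (use MK that in auto)
    also have "\<dots> = (if i = i' then F else 0)" using f by auto
    finally show ?thesis .
  qed
  \<comment> \<open>Components in the degrees prescribed by \<open>M \<kappa>\<^sup>T = F\<close>
    keep this identity, since \<open>F\<close> and the entries of \<open>M\<close> are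
    homogeneous.\<close>
  define \<kappa> where "\<kappa> = (\<lambda>i j. hci (a j + (int d - b i)) (\<kappa>0 i j))"
  have "(\<Sum>j<m. M i' j * \<kappa> i j) = (if i = i' then F else 0)" if i: "i < n" "i' < n" for i i'
  proof -
    have "hci (int d + b i' - b i) (\<Sum>j<m. M i' j * \<kappa>0 i j) = (\<Sum>j<m. M i' j * \<kappa> i j)"
      unfolding hci_sum
    proof (rule sum.cong)
      fix j assume "j \<in> {..<m}"
      then have "hci (int d + b i' - b i) (M i' j * \<kappa>0 i j) = M i' j * hci (int d + b i' - b i - (b i' - a j)) (\<kappa>0 i j)"
        using hci_mult[OF M_homogeneous[OF i(2)]] by simp
      moreover have "int d + b i' - b i - (b i' - a j) = a j + (int d - b i)" by simp
      ultimately show "hci (int d + b i' - b i) (M i' j * \<kappa>0 i j) = M i' j * \<kappa> i j" by (simp add: \<kappa>_def)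
    qed simp
    moreover have "hci (int d + b i' - b i) (if i = i' then F else 0) = (if i = i' then F else 0)"
      using hci_homogeneous[OF F(1)] by simp
    ultimately show ?thesis using M\<kappa>0[OF i] by simp
  qed
  moreover have "homogeneous (a j + (int d - b i)) (\<kappa> i j)" for i j
    by (simp add: \<kappa>_def homogeneous_hci)
  ultimately show ?thesis by (intro that) auto
qed

text \<open>The Koszul syzygy of \<open>g l\<close> and \<open>g j\<close> is a combination of rows
  whose coefficients do not depend on \<open>t\<close>. Hence \<open>M t = 0\<close>, over
  \<open>S\<close> or modulo \<open>F\<close>, makes the cross products of \<open>t\<close> and
  \<open>g\<close> vanish.\<close>

lemma generator_syzygy:
  assumes l: "l < m" "j < m"
  obtains k where "\<And>t. g l * t j - g j * t l = (\<Sum>i<n. k i * (\<Sum>x<m. M i x * t x))"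
proof -
  define h where "h = (\<lambda>x. (if x = j then g l else 0) - (if x = l then g j else 0))"
  have s: "(\<Sum>x<m. h x * t x) = g l * t j - g j * t l" for t
  proof -
    have "(\<Sum>x<m. h x * t x) = (\<Sum>x<m. if x = j then g l * t j else 0) - (\<Sum>x<m. if x = l then g j * t l else 0)"
      unfolding h_def sum_subtractf[symmetric] by (rule sum.cong) auto
    then show ?thesis using l by simp
  qed
  have "(\<Sum>x<m. h x * g x) = 0" by (simp add: s)
  then obtain k where k: "\<And>x. x < m \<Longrightarrow> h x = (\<Sum>i<n. k i * M i x)" unfolding syzygy_iff by blast
  have "g l * t j - g j * t l = (\<Sum>i<n. k i * (\<Sum>x<m. M i x * t x))" for t
  proof -
    have "g l * t j - g j * t l = (\<Sum>x<m. (\<Sum>i<n. k i * M i x) * t x)"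
      unfolding s[symmetric] by (rule sum.cong) (simp_all add: k)
    also have "\<dots> = (\<Sum>i<n. k i * (\<Sum>x<m. M i x * t x))"
      unfolding sum_distrib_right sum_distrib_left by (subst sum.swap) (simp add: mult.assoc)
    finally show ?thesis .
  qed
  then show ?thesis by (rule that)
qed

lemma dvd_cross_product:
  assumes t: "\<And>i. i < n \<Longrightarrow> F dvd (\<Sum>j<m. M i j * t j)" and l: "l < m" "j < m"
  shows "F dvd g l * t j - g j * t l"
proof -
  obtain k where "\<And>t. g l * t j - g j * t l = (\<Sum>i<n. k i * (\<Sum>x<m. M i x * t x))"
    using generator_syzygy[OF l] by blast
  then show ?thesis using t by (auto intro!: dvd_sum)
qed

text \<open>Minimality in the form in which it is applied: no entry of \<open>M t\<close> is a
  nonzero constant.\<close>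

lemma eval_irrelevant:
  assumes i: "i < n" shows "eval (\<Sum>j<m. M i j * t j) 0 = 0"
proof -
  have "eval (M i j) 0 = 0" if "j < m" for j
    using minimal[OF i that] by (simp add: eval_zero_vector irrelevant_ideal_def)
  then show ?thesis unfolding eval.sum eval.mult by simp
qed

text \<open>The factor is \<open>\<tau> / F\<close>, where \<open>\<tau>\<close> is the image of
  \<open>F\<close> under \<open>g j \<mapsto> t j\<close>. It is a polynomial because no prime
  factor of \<open>F\<close> divides all generators, and its degree is zero. So the homomorphisms
  from \<open>I\<close> to \<open>S\<close> of degree zero are constants.\<close>

lemma kernel_M:
  assumes t: "\<And>i. i < n \<Longrightarrow> (\<Sum>j<m. M i j * t j) = 0" and hom: "\<And>j. j < m \<Longrightarrow> homogeneous (a j) (t j)"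
  shows "\<exists>\<alpha>. \<forall>j<m. t j = Const \<alpha> * g j"
proof -
  obtain f where f: "F = (\<Sum>l<m. f l * g l)" using ideal_repr[OF F_in_ideal] .
  define \<tau> where "\<tau> = (\<Sum>l<m. f l * t l)"
  have cross: "g l * t j = g j * t l" if l: "l < m" "j < m" for l j
  proof -
    obtain k where "\<And>t. g l * t j - g j * t l = (\<Sum>i<n. k i * (\<Sum>x<m. M i x * t x))"
      using generator_syzygy[OF l] by blast
    then have "g l * t j - g j * t l = 0" using t by simp
    then show ?thesis by simp
  qed
  have \<tau>: "\<tau> * g j = F * t j" if j: "j < m" for j
  proof -
    have "\<tau> * g j = (\<Sum>l<m. f l * (g j * t l))"
      by (simp add: \<tau>_def sum_distrib_left sum_distrib_right mult_ac)
    also have "\<dots> = (\<Sum>l<m. f l * (g l * t j))"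
      by (rule sum.cong) (simp_all add: cross[OF _ j])
    also have "\<dots> = F * t j" by (subst f) (simp add: sum_distrib_left sum_distrib_right mult_ac)
    finally show ?thesis .
  qed
  have "F dvd \<tau>"
  proof (rule F_dvd)
    fix P assume P: "P \<in> PS"
    obtain j where j: "j < m" "\<not> P dvd g j" using gen_not_dvd[OF P] .
    have "P dvd \<tau> * g j" unfolding \<tau>[OF j(1)] using cofactor(1)[OF P] by (metis dvd_triv_left dvd_mult2)
    then show "P dvd \<tau>" using PS(2)[OF P] j(2) by (metis prime_elem_dvd_mult_iff)
  qed
  then obtain \<alpha> where \<alpha>: "\<tau> = F * \<alpha>" by (elim dvdE)
  have tg: "t j = g j * \<alpha>" if "j < m" for j
    using \<tau>[OF that] F(3) by (simp add: \<alpha> mult_ac)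
  show ?thesis
  proof (cases "\<exists>j<m. g j \<noteq> 0")
    case True
    then obtain j where j: "j < m" "g j \<noteq> 0" by blast
    have "homogeneous (a j - a j) \<alpha>"
      using homogeneous_dvd[OF gen_homogeneous[OF j(1)], of "a j" \<alpha>] hom[OF j(1)] j(2) tg[OF j(1)] by simp
    then obtain c where "\<alpha> = Const c" using homogeneous_0_Const by auto
    then show ?thesis using tg by (intro exI[of _ c]) (simp add: mult.commute)
  next
    case False
    then show ?thesis using tg by (intro exI[of _ 0]) simp
  qed
qed

lemma PS_nonempty: "PS \<noteq> {}"
proof
  assume "PS = {}"
  then have "F dvd 1" using F_dvd by blast
  then obtain G where G: "F * G = 1" by (metis dvdE)
  have "homogeneous 0 (F * G)" using homogeneous_Const[of 1] by (simp add: G)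
  then have "homogeneous (0 - int d) G" by (rule homogeneous_dvd[OF F(1) _ F(3)])
  then have "G = 0" by (rule homogeneous_neg) (use F(2) in simp)
  then show False using G by simp
qed

text \<open>Noether's theorem writes \<open>g j = U * P + V * Q P\<close>, and the second summand is
  \<open>g j\<close> modulo \<open>P\<close> and zero modulo the other primes. The theorem applies
  because \<open>P\<close> and \<open>Q P\<close> meet only at nodes, where \<open>g j\<close>
  vanishes and \<open>P * Q P\<close> is nondegenerate.\<close>

lemma idempotent_multiplier:
  assumes P: "P \<in> PS"
  obtains t where "\<And>j. j < m \<Longrightarrow> homogeneous (a j) (t j)" "\<And>j. j < m \<Longrightarrow> P dvd t j - g j"
    "\<And>P' j. P' \<in> PS \<Longrightarrow> P' \<noteq> P \<Longrightarrow> j < m \<Longrightarrow> P' dvd t j"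
proof -
  obtain k l where kl: "homogeneous (int k) P" "homogeneous (int l) (Q P)" using PS_homogeneous[OF P] by blast
  have "\<exists>x. homogeneous (a j) x \<and> P dvd x - g j \<and> Q P dvd x" if j: "j < m" for j
  proof (cases "a j < 0")
    case True
    then show ?thesis using homogeneous_neg[OF gen_homogeneous[OF j]] by (intro exI[of _ 0]) simp
  next
    case False
    then obtain \<gamma> where \<gamma>: "a j = int \<gamma>" by (metis nat_0_le not_less)
    have "g j \<in> pair_ideal P (Q P)"
    proof (rule noether[OF PS(2)[OF P] cofactor(2)[OF P] kl])
      show "homogeneous (int \<gamma>) (g j)" using gen_homogeneous[OF j] \<gamma> by simp
      fix v assume "v \<noteq> 0" "eval P v = 0" "eval (Q P) v = 0"
      then have "v \<in> NV" using crossing[OF P] by blast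
      then show "eval (g j) v = 0 \<and> nondegenerate (P * Q P) v"
        using gen_in_ideal[OF j] node(3) cofactor(1)[OF P] by (auto simp: I)
    qed
    then obtain U V where UV: "g j = U * P + V * Q P" by (auto simp: pair_ideal_def)
    have "g j = P * hci (a j - int k) U + Q P * hci (a j - int l) V"
      using hci_homogeneous[OF gen_homogeneous[OF j], of "a j"] hci_mult[OF kl(1), of "a j" U] hci_mult[OF kl(2), of "a j" V]
      by (metis UV hci_add mult.commute)
    moreover have "homogeneous (int l + (a j - int l)) (Q P * hci (a j - int l) V)"
      by (intro homogeneous_mult kl homogeneous_hci)
    ultimately show ?thesis
      by (intro exI[of _ "Q P * hci (a j - int l) V"]) simp
  qed
  then obtain t where t: "\<And>j. j < m \<Longrightarrow> homogeneous (a j) (t j) \<and> P dvd t j - g j \<and> Q P dvd t j" by metis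
  show ?thesis
  proof (rule that[of t])
    show "P' dvd t j" if "P' \<in> PS" "P' \<noteq> P" "j < m" for P' j
      using t[OF that(3)] cofactor(3)[OF P that(1,2)] dvd_trans by blast
  qed (use t in auto)
qed

lemma resolution_degrees:
  "(\<forall>i<n. b i \<le> int d) \<and> card {i. i < n \<and> b i = int d} + 1 = card PS"
proof -
  obtain \<kappa> where \<kappa>: "\<And>i j. homogeneous (a j + (int d - b i)) (\<kappa> i j)"
    "\<And>i i'. i < n \<Longrightarrow> i' < n \<Longrightarrow> (\<Sum>j<m. M i' j * \<kappa> i j) = (if i = i' then F else 0)"
    using adjugate_exists by blast
  have mult: "multiplier (int d - b i) (\<kappa> i)" if i: "i < n" for i
    unfolding multiplier_def
  proof (intro conjI allI impI)
    show "F dvd g l * \<kappa> i j - g j * \<kappa> i l" if "l < m" "j < m" for l j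
      by (rule dvd_cross_product[OF _ that]) (simp add: \<kappa>(2)[OF i])
  qed (rule \<kappa>(1))
  have le: "b i \<le> int d" if i: "i < n" for i
  proof (rule ccontr)
    assume "\<not> b i \<le> int d"
    then have "\<forall>j. \<exists>s. j < m \<longrightarrow> \<kappa> i j = F * s"
      using multiplier_negative[OF mult[OF i]] by (auto simp: dvd_def)
    then obtain s where s: "\<And>j. j < m \<Longrightarrow> \<kappa> i j = F * s j" by metis
    \<comment> \<open>Dividing the diagonal entry of \<open>M \<kappa>\<^sup>T = F\<close> by
      \<open>F\<close> leaves the constant \<open>1\<close>, which minimality forbids.\<close>
    have "F * 1 = (\<Sum>j<m. M i j * \<kappa> i j)" using \<kappa>(2)[OF i i] by simp
    also have "\<dots> = F * (\<Sum>j<m. M i j * s j)"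
      unfolding sum_distrib_left by (rule sum.cong) (simp_all add: s mult_ac)
    finally have "(\<Sum>j<m. M i j * s j) = 1" using F(3) by simp
    then show False using eval_irrelevant[OF i, of s] by simp
  qed
  define D where "D = {i. i < n \<and> b i = int d}"
  have D: "finite D" "n \<notin> D" "D \<subseteq> {..<n}" by (auto simp: D_def)
  \<comment> \<open>The index \<open>n\<close> lies outside the range of the rows and stands for the
    inclusion, that is, for \<open>g\<close> itself.\<close>
  let ?Z = "insert n D"
  have cZ: "card ?Z = card D + 1" using D by simp
  have "\<exists>\<gamma>. \<forall>j<m. P dvd \<kappa> i j - Const \<gamma> * g j" if "i \<in> D" "P \<in> PS" for i P
    using multiplier_zero[OF _ that(2), of "\<kappa> i"] mult[of i] that(1) by (auto simp: D_def)
  then obtain \<gamma> where \<gamma>: "\<And>i P j. i \<in> D \<Longrightarrow> P \<in> PS \<Longrightarrow> j < m \<Longrightarrow> P dvd \<kappa> i j - Const (\<gamma> i P) * g j"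
    by metis
  \<comment> \<open>On the component of \<open>P\<close> the elements of \<open>?Z\<close> act by
    the constants \<open>1\<close> and \<open>\<gamma> i P\<close>. If they outnumber the primes, a
    nontrivial combination \<open>T\<close> vanishes modulo every prime, hence modulo
    \<open>F\<close>.\<close>
  have upper: "\<not> card PS < card ?Z"
  proof
    assume "card PS < card ?Z"
    then obtain c where c: "\<exists>z\<in>?Z. c z \<noteq> 0"
      "\<And>P. P \<in> PS \<Longrightarrow> (\<Sum>z\<in>?Z. (if z = n then 1 else \<gamma> z P) * c z) = 0"
      using underdetermined_system[OF PS(1), of ?Z "\<lambda>P z. if z = n then 1 else \<gamma> z P"] D(1) by auto
    define T where "T = (\<lambda>j. Const (c n) * g j + (\<Sum>i\<in>D. Const (c i) * \<kappa> i j))"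
    have "F dvd T j" if j: "j < m" for j
    proof (rule F_dvd)
      fix P assume P: "P \<in> PS"
      have "(\<Sum>z\<in>D. (if z = n then 1 else \<gamma> z P) * c z) = (\<Sum>z\<in>D. \<gamma> z P * c z)"
        by (rule sum.cong) (use D(2) in auto)
      then have z: "c n + (\<Sum>z\<in>D. \<gamma> z P * c z) = 0" using c(2)[OF P] D by simp
      have "T j - Const (c n + (\<Sum>i\<in>D. \<gamma> i P * c i)) * g j = (\<Sum>i\<in>D. Const (c i) * (\<kappa> i j - Const (\<gamma> i P) * g j))"
        by (simp add: T_def Const.add Const.sum Const.mult algebra_simps sum_distrib_left sum_distrib_right sum_subtractf)
      then have "T j = (\<Sum>i\<in>D. Const (c i) * (\<kappa> i j - Const (\<gamma> i P) * g j))" by (simp add: z)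
      also have "P dvd \<dots>" using \<gamma>[OF _ P j] by (intro dvd_sum dvd_mult)
      finally show "P dvd T j" .
    qed
    then have "\<forall>j. \<exists>s. j < m \<longrightarrow> T j = F * s" by (auto simp: dvd_def)
    then obtain s where s: "\<And>j. j < m \<Longrightarrow> T j = F * s j" by metis
    \<comment> \<open>The entry of \<open>M T / F\<close> at \<open>i'\<close> is
      \<open>c i'\<close>, but it also equals that of \<open>M s\<close>, which has no constant
      term.\<close>
    have c0: "c i' = 0" if i': "i' \<in> D" for i'
    proof -
      have i'n: "i' < n" using i' by (simp add: D_def)
      have "F * (\<Sum>j<m. M i' j * s j) = (\<Sum>j<m. M i' j * T j)"
        unfolding sum_distrib_left by (rule sum.cong) (simp_all add: s mult_ac)
      also have "\<dots> = Const (c n) * (\<Sum>j<m. M i' j * g j) + (\<Sum>i\<in>D. Const (c i) * (\<Sum>j<m. M i' j * \<kappa> i j))"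
        unfolding T_def sum_distrib_left
        by (subst sum.swap) (simp add: algebra_simps sum.distrib sum_distrib_left)
      also have "\<dots> = (\<Sum>i\<in>D. if i = i' then Const (c i') * F else 0)"
        unfolding M_row[OF i'n] using \<kappa>(2)[OF _ i'n] D(3) by (auto intro!: sum.cong)
      also have "\<dots> = F * Const (c i')" using i' D(1) by (simp add: mult.commute)
      finally have "(\<Sum>j<m. M i' j * s j) = Const (c i')" using F(3) by simp
      then show ?thesis using eval_irrelevant[OF i'n, of s] by simp
    qed
    then have cn: "c n \<noteq> 0" using c(1) by auto
    obtain P where P: "P \<in> PS" using PS_nonempty by blast
    obtain j where j: "j < m" "\<not> P dvd g j" using gen_not_dvd[OF P] .
    have "T j = Const (c n) * g j" by (simp add: T_def c0)
    then have "g j = Const (inverse (c n)) * (F * s j)"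
      using cn s[OF j(1)] by (simp add: mult.assoc[symmetric] Const.mult[symmetric])
    then have "P dvd g j" using cofactor(1)[OF P] by (metis dvd_mult dvd_triv_left dvd_mult2)
    then show False using j(2) by blast
  qed
  \<comment> \<open>Every idempotent is a combination of \<open>g\<close> and the rows of
    \<open>\<kappa>\<close> with index in \<open>D\<close>. With more primes than elements of
    \<open>?Z\<close> the idempotents would be linearly dependent.\<close>
  have lower: "\<not> card ?Z < card PS"
  proof
    assume less: "card ?Z < card PS"
    have "\<forall>P. \<exists>t. P \<in> PS \<longrightarrow> (\<forall>j<m. homogeneous (a j) (t j) \<and> P dvd t j - g j \<and> (\<forall>P'\<in>PS. P' \<noteq> P \<longrightarrow> P' dvd t j))"
      using idempotent_multiplier by metis
    then obtain t where t: "\<And>P j. P \<in> PS \<Longrightarrow> j < m \<Longrightarrow> homogeneous (a j) (t P j) \<and> P dvd t P j - g j \<and> (\<forall>P'\<in>PS. P' \<noteq> P \<longrightarrow> P' dvd t P j)"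
      by metis
    \<comment> \<open>The \<open>i\<close>-th entry of \<open>M t / F\<close> has degree
      \<open>b i - d \<le> 0\<close>, so it is a constant that can be nonzero only for
      \<open>i \<in> D\<close>.\<close>
    have "\<exists>v. (\<Sum>j<m. M i j * t P j) = F * Const v \<and> (i \<notin> D \<longrightarrow> v = 0)" if P: "P \<in> PS" and i: "i < n" for P i
    proof -
      have "F dvd (\<Sum>j<m. M i j * t P j)"
      proof (rule F_dvd)
        fix P' assume P': "P' \<in> PS"
        show "P' dvd (\<Sum>j<m. M i j * t P j)"
        proof (cases "P' = P")
          case True
          have "(\<Sum>j<m. M i j * t P j) = (\<Sum>j<m. M i j * (t P j - g j)) + (\<Sum>j<m. M i j * g j)"
            by (simp add: right_diff_distrib sum_subtractf)
          then have "(\<Sum>j<m. M i j * t P j) = (\<Sum>j<m. M i j * (t P j - g j))" by (simp add: M_row[OF i])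
          also have "P dvd \<dots>" using t[OF P] by (intro dvd_sum dvd_mult) auto
          finally show ?thesis using True by simp
        next
          case False
          then show ?thesis using t[OF P] P' by (intro dvd_sum dvd_mult) auto
        qed
      qed
      then obtain w where w: "(\<Sum>j<m. M i j * t P j) = F * w" by (elim dvdE)
      have "homogeneous (b i) (\<Sum>j<m. M i j * t P j)"
      proof (rule homogeneous_sum)
        fix j assume "j \<in> {..<m}"
        then have "homogeneous (b i - a j + a j) (M i j * t P j)"
          using t[OF P] by (intro homogeneous_mult M_homogeneous[OF i]) auto
        then show "homogeneous (b i) (M i j * t P j)" by simp
      qed
      then have hw: "homogeneous (b i - int d) w"
        unfolding w by (rule homogeneous_dvd[OF F(1) _ F(3)])
      show ?thesis
      proof (cases "i \<in> D")
        case True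
        then have "homogeneous 0 w" using hw by (simp add: D_def)
        then obtain v where "w = Const v" by (rule homogeneous_0_Const)
        then show ?thesis using w True by blast
      next
        case False
        then have "b i - int d < 0" using le[OF i] i by (simp add: D_def)
        then have "w = 0" using homogeneous_neg[OF hw] by blast
        then show ?thesis using w by (intro exI[of _ 0]) simp
      qed
    qed
    then have "\<forall>P i. \<exists>v. P \<in> PS \<longrightarrow> i < n \<longrightarrow> (\<Sum>j<m. M i j * t P j) = F * Const v \<and> (i \<notin> D \<longrightarrow> v = 0)" by blast
    then obtain v where v: "\<And>P i. P \<in> PS \<Longrightarrow> i < n \<Longrightarrow> (\<Sum>j<m. M i j * t P j) = F * Const (v P i)"
      "\<And>P i. P \<in> PS \<Longrightarrow> i < n \<Longrightarrow> i \<notin> D \<Longrightarrow> v P i = 0" by metis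
    have "\<exists>\<alpha>. \<forall>j<m. t P j = (\<Sum>i\<in>D. Const (v P i) * \<kappa> i j) + Const \<alpha> * g j" if P: "P \<in> PS" for P
    proof -
      \<comment> \<open>The rows of \<open>\<kappa>\<close> realize the unit vectors, so the
        difference lies in the kernel of \<open>M\<close>, where \<open>kernel_M\<close> leaves only
        constant multiples of \<open>g\<close>.\<close>
      have "(\<Sum>j<m. M i' j * (t P j - (\<Sum>i\<in>D. Const (v P i) * \<kappa> i j))) = 0" if i': "i' < n" for i'
      proof -
        have "(\<Sum>j<m. M i' j * (\<Sum>i\<in>D. Const (v P i) * \<kappa> i j)) = (\<Sum>i\<in>D. Const (v P i) * (\<Sum>j<m. M i' j * \<kappa> i j))"
          unfolding sum_distrib_left by (subst sum.swap) (simp add: mult_ac)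
        also have "\<dots> = (\<Sum>i\<in>D. if i = i' then Const (v P i') * F else 0)"
          using \<kappa>(2)[OF _ i'] D(3) by (auto intro!: sum.cong)
        also have "\<dots> = F * Const (v P i')" using D(1) v(2)[OF P i'] by (simp add: mult.commute)
        finally show ?thesis by (simp add: right_diff_distrib sum_subtractf v(1)[OF P i'])
      qed
      moreover have "homogeneous (a j) (t P j - (\<Sum>i\<in>D. Const (v P i) * \<kappa> i j))" if "j < m" for j
      proof (intro homogeneous_diff homogeneous_sum homogeneous_Const_mult)
        show "homogeneous (a j) (t P j)" using t[OF P that] by blast
        fix i assume "i \<in> D"
        then show "homogeneous (a j) (\<kappa> i j)" using \<kappa>(1)[of j i] by (simp add: D_def)
      qed
      ultimately have "\<exists>\<alpha>. \<forall>j<m. t P j - (\<Sum>i\<in>D. Const (v P i) * \<kappa> i j) = Const \<alpha> * g j"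
        by (rule kernel_M)
      then show ?thesis by (simp add: diff_eq_eq add.commute)
    qed
    then have "\<forall>P\<in>PS. \<exists>\<alpha>. \<forall>j<m. t P j = (\<Sum>i\<in>D. Const (v P i) * \<kappa> i j) + Const \<alpha> * g j" by blast
    from bchoice[OF this] obtain \<alpha> where
      \<alpha>: "\<And>P j. P \<in> PS \<Longrightarrow> j < m \<Longrightarrow> t P j = (\<Sum>i\<in>D. Const (v P i) * \<kappa> i j) + Const (\<alpha> P) * g j"
      by blast
    obtain c where c: "\<exists>P\<in>PS. c P \<noteq> 0"
      "\<And>y. y \<in> ?Z \<Longrightarrow> (\<Sum>P\<in>PS. (if y = n then \<alpha> P else v P y) * c P) = 0"
      using underdetermined_system[OF _ PS(1) less, of "\<lambda>y P. if y = n then \<alpha> P else v P y"] D(1) by auto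
    have cv: "(\<Sum>P\<in>PS. v P i * c P) = 0" if "i \<in> D" for i
    proof -
      have "i \<noteq> n" using that D(2) by auto
      then show ?thesis using c(2)[of i] that by simp
    qed
    have c\<alpha>: "(\<Sum>P\<in>PS. \<alpha> P * c P) = 0" using c(2)[of n] by simp
    obtain P0 where P0: "P0 \<in> PS" "c P0 \<noteq> 0" using c(1) by blast
    obtain j where j: "j < m" "\<not> P0 dvd g j" using gen_not_dvd[OF P0(1)] .
    have "(\<Sum>P\<in>PS. Const (c P) * t P j) = (\<Sum>P\<in>PS. \<Sum>i\<in>D. Const (v P i * c P) * \<kappa> i j) + (\<Sum>P\<in>PS. Const (\<alpha> P * c P) * g j)"
      unfolding sum.distrib[symmetric]
      by (rule sum.cong) (simp_all add: \<alpha>[OF _ j(1)] distrib_left sum_distrib_left Const.mult mult_ac)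
    also have "(\<Sum>P\<in>PS. \<Sum>i\<in>D. Const (v P i * c P) * \<kappa> i j) = (\<Sum>i\<in>D. Const (\<Sum>P\<in>PS. v P i * c P) * \<kappa> i j)"
      by (subst sum.swap) (simp add: Const.sum sum_distrib_right)
    also have "\<dots> = 0" by (rule sum.neutral) (simp add: cv)
    also have "(\<Sum>P\<in>PS. Const (\<alpha> P * c P) * g j) = Const (\<Sum>P\<in>PS. \<alpha> P * c P) * g j"
      by (simp add: Const.sum sum_distrib_right)
    finally have "(\<Sum>P\<in>PS. Const (c P) * t P j) = 0" by (simp add: c\<alpha>)
    \<comment> \<open>Modulo \<open>P0\<close> the other idempotents vanish while
      \<open>t P0\<close> agrees with \<open>g\<close>, so the relation makes \<open>P0\<close>
      divide \<open>g j\<close>.\<close>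
    then have "Const (c P0) * t P0 j = - (\<Sum>P\<in>PS - {P0}. Const (c P) * t P j)"
      using sum.remove[OF PS(1) P0(1), of "\<lambda>P. Const (c P) * t P j"] by (simp add: eq_neg_iff_add_eq_0)
    also have "P0 dvd \<dots>"
      unfolding dvd_minus_iff
    proof (rule dvd_sum)
      fix P assume "P \<in> PS - {P0}"
      then show "P0 dvd Const (c P) * t P j" using t[of P j] P0(1) j(1) by auto
    qed
    finally have "P0 dvd Const (inverse (c P0)) * (Const (c P0) * t P0 j)" by (rule dvd_mult)
    then have "P0 dvd t P0 j" using P0(2) by (simp add: mult.assoc[symmetric] Const.mult[symmetric])
    moreover have "P0 dvd t P0 j - g j" using t[OF P0(1) j(1)] by blast
    ultimately have "P0 dvd g j" by (metis dvd_diff_left_iff dvd_diff_right_iff)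
    then show False using j(2) by blast
  qed
  show ?thesis using le upper lower cZ unfolding D_def by force
qed

end

section \<open>From the geometry of the curve to the algebraic data\<close>

theorem proposition3p6:
  fixes F :: S and d c m n :: nat and a b :: "nat \<Rightarrow> int"
    and g :: "nat \<Rightarrow> S" and M :: "nat \<Rightarrow> nat \<Rightarrow> S"
  assumes "reduced_plane_curve F d"
    and "\<And>p. singular_at F p \<Longrightarrow> node_at F p \<or> cusp_at F p"
    and "c = card (irreducible_components (curve_points F))"
    and "minimal_graded_free_resolution (vanishing_ideal (nodes F)) m a n b g M"
  shows "(\<forall>i<n. b i \<le> int d) \<and> int (card {i. i < n \<and> b i = int d}) = int c - 1"
proof -
  have F: "homogeneous (int d) F" "0 < d" "squarefree F"
    using assms(1) by (auto simp: reduced_plane_curve_def)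
  obtain u PS where u: "u dvd 1" and PS: "finite PS" "\<And>P. P \<in> PS \<Longrightarrow> prime_elem P"
    "\<And>P Q. P \<in> PS \<Longrightarrow> Q \<in> PS \<Longrightarrow> P dvd Q \<Longrightarrow> P = Q" and Fu: "F = u * \<Prod>PS"
    using squarefree_prime_factorization[OF F(3)] by metis
  \<comment> \<open>The unit goes into the cofactor, so that \<open>F = P * Q P\<close> holds
    exactly.\<close>
  define Q where "Q = (\<lambda>P. u * \<Prod>(PS - {P}))"
  have FQ: "F = P * Q P" if "P \<in> PS" for P
    using prod.remove[OF PS(1) that, of "\<lambda>x. x"] by (simp add: Fu Q_def mult_ac)
  have prod_dvd: "P \<in> A" if "finite A" "A \<subseteq> PS" "P \<in> PS" "P dvd \<Prod>A" for P A
    using that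
  proof (induction A rule: finite_induct)
    case empty
    then show ?case using PS(2) by (auto simp: prime_elem_def)
  next
    case (insert R A)
    then have "P dvd R \<or> P dvd \<Prod>A" using PS(2) by (simp add: prime_elem_dvd_mult_iff)
    then show ?case using insert PS(3) by blast
  qed
  have unit: "\<not> P dvd u" if "P \<in> PS" for P
    using u PS(2)[OF that] dvd_trans by (auto simp: prime_elem_def)
  have nd: "\<not> P dvd Q P" if P: "P \<in> PS" for P
  proof
    assume "P dvd Q P"
    then have "P dvd \<Prod>(PS - {P})"
      using unit[OF P] PS(2)[OF P] by (simp add: Q_def prime_elem_dvd_mult_iff)
    then show False using prod_dvd[of "PS - {P}" P] PS(1) P by auto
  qed
  have other: "P' dvd Q P" if "P \<in> PS" "P' \<in> PS" "P' \<noteq> P" for P P'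
    unfolding Q_def using that PS(1) by (intro dvd_mult dvd_prodI) auto
  have Fdvd: "F dvd x" if "\<And>P. P \<in> PS \<Longrightarrow> P dvd x" for x
  proof -
    have "\<Prod>A dvd x" if "finite A" "A \<subseteq> PS" for A
      using that
    proof (induction A rule: finite_induct)
      case (insert R A)
      then obtain y where y: "x = \<Prod>A * y" by (auto elim: dvdE)
      have "R dvd \<Prod>A * y" using \<open>\<And>P. P \<in> PS \<Longrightarrow> P dvd x\<close>[of R] insert y by auto
      moreover have "\<not> R dvd \<Prod>A" using prod_dvd[of A R] insert by auto
      ultimately have "R dvd y" using PS(2)[of R] insert.prems by (auto simp: prime_elem_dvd_mult_iff)
      then show ?case using insert y by (auto simp: mult.commute intro: mult_dvd_mono)
    qed simp
    then have "\<Prod>PS dvd x" using PS(1) by blast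
    then have "u * \<Prod>PS dvd 1 * x" using u by (intro mult_dvd_mono) auto
    then show ?thesis by (simp add: Fu)
  qed
  have F0: "F \<noteq> 0" by (rule squarefree_nonzero[OF F(3)])
  have homPQ: "\<exists>k l. homogeneous (int k) P \<and> homogeneous l (Q P)" if "P \<in> PS" for P
    using homogeneous_factor[of "int d" P "Q P"] FQ[OF that] F(1) F0 by metis
  define NV where "NV = {v. v \<noteq> 0 \<and> node_at F (abs_P2 v)}"
  have NV: "v \<in> NV \<longleftrightarrow> (\<exists>p. represents v p \<and> p \<in> nodes F)" for v
    by (auto simp: NV_def represents_def nodes_def)
  \<comment> \<open>At a common zero of \<open>P\<close> and \<open>Q P\<close> the product rule
    makes \<open>F\<close> singular. A cusp cannot lie on both factors, so the hypothesis on the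
    singularities leaves only a node.\<close>
  have cross: "v \<in> NV" if P: "P \<in> PS" and v: "v \<noteq> 0" "eval P v = 0" "eval (Q P) v = 0" for P v
  proof -
    obtain k l where kl: "homogeneous (int k) P" "homogeneous l (Q P)" using homPQ[OF P] by blast
    define p where "p = abs_P2 v"
    have rv: "represents v p" using v(1) by (simp add: p_def represents_self)
    have z: "eval P v' = 0" "eval (Q P) v' = 0" if "represents v' p" for v'
      using vanishes_at_homogeneous[OF kl(1)] vanishes_at_homogeneous[OF kl(2)] rv v that by blast+
    have "eval F v' = 0" "eval (pd j F) v' = 0" if "represents v' p" for v' j
      using z[OF that] FQ[OF P] by (simp_all add: eval.mult eval.add pd_mult)
    then have "singular_at F p"
      unfolding singular_at_def curve_points_iff vanishes_at_def
    proof (intro conjI allI impI)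
      fix v' assume "represents v' p"
      then show "(eval F has_derivative (\<lambda>_. 0)) (at v')"
        using has_derivative_eval[of F v'] \<open>\<And>v' j. represents v' p \<Longrightarrow> eval (pd j F) v' = 0\<close> by simp
    qed
    moreover have "\<not> cusp_at F p"
      using cusp_at_irreducible[OF kl _ rv v(2,3)] FQ[OF P] by metis
    ultimately have "node_at F p" using assms(2) by blast
    then show ?thesis using v(1) by (simp add: NV_def p_def)
  qed
  have I: "vanishing_ideal (nodes F) = {f. \<forall>v\<in>NV. eval f v = 0}"
    by (auto simp: vanishing_ideal_def vanishes_at_def NV)
  note pairwise = PS(3)
  interpret nodal_resolution F d PS Q NV "vanishing_ideal (nodes F)" m n a b g M
  proof
    fix v assume "v \<in> NV"
    then have v: "node_at F (abs_P2 v)" "represents v (abs_P2 v)"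
      by (auto simp: NV_def represents_self)
    show "eval F v = 0" "nondegenerate F v" "\<And>j. eval (pd j F) v = 0"
      using node_at_coordinates[OF F(1) v] by auto
  qed (use F F0 PS FQ nd other Fdvd cross I assms(4) in \<open>auto simp: minimal_graded_free_resolution_def\<close>)
  have "curve_points F = (\<Union>P\<in>PS. curve_points P)"
  proof -
    have "eval u v \<noteq> 0" for v
    proof -
      obtain w where "1 = u * w" using u by (elim dvdE)
      then have "eval u v * eval w v = 1" by (metis eval.mult eval.one)
      then show ?thesis by auto
    qed
    then have "vanishes_at F p \<longleftrightarrow> vanishes_at (\<Prod>PS) p" for p
      by (simp add: vanishes_at_def Fu eval.mult)
    then have "curve_points F = curve_points (\<Prod>PS)" by (auto simp: curve_points_iff)
    also have "\<dots> = (\<Union>P\<in>PS. curve_points P)"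
      using homPQ by (intro curve_points_prod PS(1)) blast
    finally show ?thesis .
  qed
  moreover have "\<exists>k. k \<noteq> 0 \<and> homogeneous k P" if "P \<in> PS" for P
    using PS_homogeneous[OF that] by (metis of_nat_0_eq_iff)
  ultimately have "c = card PS"
    unfolding assms(3) using PS pairwise by (intro card_irreducible_components) auto
  then show ?thesis using resolution_degrees by auto
qed

end
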